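(* Let $U$ be the affine group and $\widehat U=\{\rho_+,\rho_-\}$. For every $p$ with $2<p<\infty$ there exists an operator-valued function $\sigma\in L^p(U\times\widehat U,S_p)$ such that the Weyl transform $W_\sigma$ is not a bounded linear operator on $L^2(U)$.
   Context: Affine group: $U=\{(b,a): b\in\mathbb R,\ a>0\}$ with the product $(b,a)\cdot(c,d)=(b+ac,ad)$ and left Haar measure $d\mu(b,a)=\frac{db\,da}{a^2}$; $L^2(U)=L^2(U,\mu)$. Let $\mathbb R_+=[0,\infty)$, $\mathbb R_-=(-\infty,0]$. The unitary representations $\rho_\pm$ of $U$ on $L^2(\mathbb R_\pm)$ are $(\rho_\pm(b,a)u)(s)=a^{1/2}e^{-ibs}u(as)$, $s\in\mathbb R_\pm$. We write $\widehat U=\{\rho_+,\rho_-\}$. The Duflo-Moore operators are the unbounded positive operators $K_{\rho_\pm}=K_\pm$ on $L^2(\mathbb R_\pm)$, $(K_\pm\phi)(s)=|s|\phi(s)$; powers $K_\pm^{r}$ are multiplication by $|s|^{r}$. $S_r$ denotes the $r$-Schatten class (on $L^2(\mathbb R_+)$ or $L^2(\mathbb R_-)$ as appropriate), $\|A\|_{S_r}^r=\operatorname{Tr}(A^*A)^{r/2}$, with $\|A\|_{S_r}=\infty$ if $A$ does not extend to an element of $S_r$. For $1\le p<\infty$, $L^p(U\times\widehat U,S_p)$ is the set of measurable operator-valued functions $\sigma$ ($\sigma(x,\rho)$ an operator on the space of $\rho$) such that $$\|\sigma\|_{p,\mu}^p=\sum_{\rho\in\widehat U}\int_U\|\sigma(x,\rho)K_\rho^{1/p}\|_{S_p}^p\,d\mu(x)<\infty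 .$$ Wigner transform: $W(f,g)(x,\rho)=\int_U f(x')\,g(x'^{-1}x)\,\rho(x')\,d\mu(x')$ for $f,g\in C_c(U)$, extended to $f,g\in L^2(U)$ by continuity, using $\|W(f,g)\|_{2,\mu}\le\|f\|_{L^2(U)}\|g\|_{L^2(U)}$. Weyl transform: for a symbol $\sigma\in L^p(U\times\widehat U,S_p)$, $W_\sigma$ is defined by $$\langle W_\sigma f,\overline g\rangle=\langle W(f,g),\sigma\rangle_\mu=\sum_{\rho\in\widehat U}\int_U\operatorname{Tr}\big(\sigma(x,\rho)^*W(f,g)(x,\rho)K_\rho\big)\,d\mu(x),\qquad f,g\in L^2(U),$$ where the trace is understood as $\operatorname{Tr}\big((\sigma K_\rho^{1/p})^*\,(W(f,g)K_\rho^{1/p'})\big)$, $\frac1p+\frac1{p'}=1$. For $p>2$, "$W_\sigma$ is a bounded linear operator on $L^2(U)$" means that the right-hand side is well defined for all $f,g\in L^2(U)$ and there is a constant $C(\sigma)$ with $|\langle W(f,g),\sigma\rangle_\mu|\le C(\sigma)\|f\|_{L^2(U)}\|g\|_{L^2(U)}$ for all $f,g\in L^2(U)$. *)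

theory Defs
  imports "HOL-Analysis.Analysis"
begin

section \<open>Square-integrable functions\<close>

text \<open>Elements of the Hilbert space \<open>L\<^sup>2(M)\<close> are handled through representatives; the
  inner product is linear in the first argument.\<close>

definition L2 :: "'a measure \<Rightarrow> ('a \<Rightarrow> complex) set" where
  "L2 M = {f \<in> borel_measurable M. integrable M (\<lambda>x. (cmod (f x))\<^sup>2)}"

definition ip :: "'a measure \<Rightarrow> ('a \<Rightarrow> complex) \<Rightarrow> ('a \<Rightarrow> complex) \<Rightarrow> complex" where
  "ip M f g = (LINT x|M. f x * cnj (g x))"

definition l2norm :: "'a measure \<Rightarrow> ('a \<Rightarrow> complex) \<Rightarrow> real" where
  "l2norm M f = sqrt (LINT x|M. (cmod (f x))\<^sup>2)"

definition onb :: "'a measure \<Rightarrow> ('a \<Rightarrow> complex) set \<Rightarrow> bool" where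
  "onb M E \<longleftrightarrow> E \<subseteq> L2 M \<and> (\<forall>e\<in>E. ip M e e = 1) \<and>
     (\<forall>e\<in>E. \<forall>e'\<in>E. e \<noteq> e' \<longrightarrow> ip M e e' = 0) \<and>
     (\<forall>u\<in>L2 M. (\<forall>e\<in>E. ip M u e = 0) \<longrightarrow> (AE x in M. u x = 0))"

section \<open>Operators on \<open>L\<^sup>2(M)\<close>\<close>

text \<open>A possibly unbounded, partially defined operator is its graph, saturated under almost
  everywhere equality. The product \<open>AB\<close> (first \<open>B\<close>, then \<open>A\<close>, on its natural domain) is
  then the relational composition \<open>B O A\<close>.\<close>

type_synonym 'a opr = "(('a \<Rightarrow> complex) \<times> ('a \<Rightarrow> complex)) set"

definition linear_opr :: "'a measure \<Rightarrow> 'a opr \<Rightarrow> bool" where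
  "linear_opr M A \<longleftrightarrow> A \<subseteq> L2 M \<times> L2 M \<and>
     (\<lambda>x. 0, \<lambda>x. 0) \<in> A \<and>
     (\<forall>(u, v)\<in>A. \<forall>(u', v')\<in>A. (\<lambda>x. u x + u' x, \<lambda>x. v x + v' x) \<in> A) \<and>
     (\<forall>(u, v)\<in>A. \<forall>c. (\<lambda>x. c * u x, \<lambda>x. c * v x) \<in> A) \<and>
     (\<forall>(u, v)\<in>A. \<forall>u'\<in>L2 M. \<forall>v'\<in>L2 M.
        (AE x in M. u' x = u x) \<longrightarrow> (AE x in M. v' x = v x) \<longrightarrow> (u', v') \<in> A) \<and>
     (\<forall>u v v'. (u, v) \<in> A \<longrightarrow> (u, v') \<in> A \<longrightarrow> (AE x in M. v x = v' x))"

text \<open>A version of \<open>Au\<close>, for \<open>u\<close> in the domain of \<open>A\<close>.\<close>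

definition op_app :: "'a opr \<Rightarrow> ('a \<Rightarrow> complex) \<Rightarrow> ('a \<Rightarrow> complex)" where
  "op_app A u = (SOME v. (u, v) \<in> A)"

definition norm_bounded :: "'a measure \<Rightarrow> 'a opr \<Rightarrow> bool" where
  "norm_bounded M A \<longleftrightarrow> (\<exists>C. \<forall>(u, v)\<in>A. l2norm M v \<le> C * l2norm M u)"

definition bounded_opr :: "'a measure \<Rightarrow> 'a opr \<Rightarrow> bool" where
  "bounded_opr M A \<longleftrightarrow> linear_opr M A \<and> Domain A = L2 M \<and> norm_bounded M A"

definition op_diff :: "'a opr \<Rightarrow> 'a opr \<Rightarrow> 'a opr" where
  "op_diff A B = {(u, \<lambda>x. v x - w x) | u v w. (u, v) \<in> A \<and> (u, w) \<in> B}"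

definition op_adj :: "'a measure \<Rightarrow> 'a opr \<Rightarrow> 'a opr" where
  "op_adj M A = {(u, v). u \<in> L2 M \<and> v \<in> L2 M \<and> (\<forall>(x, y)\<in>A. ip M y u = ip M x v)}"

text \<open>The closure of the graph. An operator \<open>A\<close> is densely defined with a bounded extension iff
  \<open>op_closure M A\<close> is a \<open>bounded_opr\<close>, and this closure is then the unique bounded extension.\<close>

definition op_closure :: "'a measure \<Rightarrow> 'a opr \<Rightarrow> 'a opr" where
  "op_closure M A = {(u, v). u \<in> L2 M \<and> v \<in> L2 M \<and>
     (\<exists>un vn. (\<forall>n::nat. (un n, vn n) \<in> A) \<and>
        (\<lambda>n. l2norm M (\<lambda>x. un n x - u x)) \<longlonglongrightarrow> 0 \<and>
        (\<lambda>n. l2norm M (\<lambda>x. vn n x - v x)) \<longlonglongrightarrow> 0)}"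

text \<open>\<open>T = B\<^sup>t\<close> (\<open>t > 0\<close>) by functional calculus, for a positive bounded operator \<open>B\<close>
  that has an orthonormal basis of eigenvectors. Only such \<open>B\<close> matter below: if \<open>B\<^sup>t\<close> has
  finite trace then \<open>B\<close> is compact.\<close>

definition op_power :: "'a measure \<Rightarrow> 'a opr \<Rightarrow> real \<Rightarrow> 'a opr \<Rightarrow> bool" where
  "op_power M B t T \<longleftrightarrow> bounded_opr M B \<and> bounded_opr M T \<and>
     (\<exists>E lam. onb M E \<and> (\<forall>e\<in>E. 0 \<le> lam e \<and>
        (e, \<lambda>x. complex_of_real (lam e) * e x) \<in> B \<and>
        (e, \<lambda>x. complex_of_real (lam e powr t) * e x) \<in> T))"

text \<open>For trace class operators, and for positive ones, the trace is independent of the basis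
  selected here.\<close>

definition some_onb :: "'a measure \<Rightarrow> ('a \<Rightarrow> complex) set" where
  "some_onb M = (SOME E. onb M E)"

definition trace :: "'a measure \<Rightarrow> 'a opr \<Rightarrow> complex" where
  "trace M T = (\<Sum>\<^sub>\<infinity>e\<in>some_onb M. ip M (op_app T e) e)"

definition pos_trace :: "'a measure \<Rightarrow> 'a opr \<Rightarrow> ennreal" where
  "pos_trace M T = (\<Sum>\<^sub>\<infinity>e\<in>some_onb M. ennreal (Re (ip M (op_app T e) e)))"

text \<open>The \<open>r\<close>-th power \<open>Tr((A\<^sup>*A)\<^bsup>r/2\<^esup>)\<close> of the Schatten norm of the bounded extension of
  \<open>A\<close>. The power is unique when it exists, so the infimum is over at most one value; it is
  \<open>\<infinity>\<close> when \<open>A\<^sup>*A\<close> is not diagonalizable, hence not compact.\<close>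

definition schatten_pow :: "'a measure \<Rightarrow> real \<Rightarrow> 'a opr \<Rightarrow> ennreal" where
  "schatten_pow M r A =
     (let A' = op_closure M A in
      if bounded_opr M A' then Inf {pos_trace M T | T. op_power M (A' O op_adj M A') (r / 2) T}
      else \<infinity>)"

definition trace_class :: "'a measure \<Rightarrow> 'a opr \<Rightarrow> bool" where
  "trace_class M T \<longleftrightarrow> bounded_opr M T \<and> schatten_pow M 1 T < \<infinity>"

section \<open>The affine group and its dual\<close>

definition aff :: "(real \<times> real) set" where
  "aff = {(b, a). a > 0}"

definition aff_mult :: "real \<times> real \<Rightarrow> real \<times> real \<Rightarrow> real \<times> real" where
  "aff_mult = (\<lambda>(b, a) (c, d). (b + a * c, a * d))"

definition aff_inv :: "real \<times> real \<Rightarrow> real \<times> real" where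
  "aff_inv = (\<lambda>(b, a). (- b / a, 1 / a))"

lemma aff_inv:
  assumes "x \<in> aff"
  shows "aff_inv x \<in> aff" "aff_mult x (aff_inv x) = (0, 1)" "aff_mult (aff_inv x) x = (0, 1)"
  using assms by (auto simp: aff_def aff_mult_def aff_inv_def)

definition haar :: "(real \<times> real) measure" where
  "haar = density (restrict_space lborel aff) (\<lambda>(b, a). ennreal (1 / a\<^sup>2))"

datatype dual = rho_plus | rho_minus

lemma UNIV_dual: "(UNIV :: dual set) = {rho_plus, rho_minus}"
  using dual.exhaust by blast

fun half_line :: "dual \<Rightarrow> real set" where
  "half_line rho_plus = {0..}"
| "half_line rho_minus = {..0}"

definition HL :: "dual \<Rightarrow> real measure" where
  "HL \<rho> = restrict_space lborel (half_line \<rho>)"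

text \<open>Both representations are given by this formula, on \<open>L2 (HL \<rho>)\<close>.\<close>

definition rep :: "real \<times> real \<Rightarrow> (real \<Rightarrow> complex) \<Rightarrow> (real \<Rightarrow> complex)" where
  "rep = (\<lambda>(b, a) u s. complex_of_real (a powr (1/2)) * exp (- \<i> * complex_of_real (b * s)) * u (a * s))"

text \<open>The power \<open>K\<^sub>\<rho>\<^sup>r\<close> of the Duflo-Moore operator, on its maximal domain.\<close>

definition K :: "dual \<Rightarrow> real \<Rightarrow> real opr" where
  "K \<rho> r = {(u, v). u \<in> L2 (HL \<rho>) \<and> v \<in> L2 (HL \<rho>) \<and>
      (AE s in HL \<rho>. v s = complex_of_real (\<bar>s\<bar> powr r) * u s)}"

section \<open>Operator-valued functions\<close>

type_synonym op_field = "real \<times> real \<Rightarrow> dual \<Rightarrow> real opr"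

text \<open>An element \<open>\<sigma>\<close> of the space of exponent \<open>p\<close> is determined by the bounded extensions of
  \<open>\<sigma>(x,\<rho>)K\<^sub>\<rho>\<^bsup>1/p\<^esup>\<close> for almost every \<open>x\<close>. Representatives are normalised: \<open>\<sigma>(x,\<rho>)\<close>
  is defined at least on the range of \<open>K\<^sub>\<rho>\<^bsup>1/p\<^esup>\<close>, and \<open>\<sigma>(x,\<rho>)K\<^sub>\<rho>\<^bsup>1/p\<^esup>\<close> is bounded for every
  \<open>x\<close> (every class has such a representative). Otherwise different representatives, restricted
  to different dense domains, could give different products \<open>\<sigma>(x,\<rho>)K\<^sub>\<rho>\<^sup>r\<close> for other
  exponents \<open>r\<close>. Measurability is meant weakly.\<close>

definition op_field :: "real \<Rightarrow> op_field \<Rightarrow> bool" where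
  "op_field p \<sigma> \<longleftrightarrow>
     (\<forall>\<rho>. \<forall>x\<in>aff. linear_opr (HL \<rho>) (\<sigma> x \<rho>) \<and> Range (K \<rho> (1/p)) \<subseteq> Domain (\<sigma> x \<rho>) \<and>
        norm_bounded (HL \<rho>) (K \<rho> (1/p) O \<sigma> x \<rho>)) \<and>
     (\<forall>\<rho>. \<forall>u\<in>Range (K \<rho> (1/p)). \<forall>v\<in>L2 (HL \<rho>).
        (\<lambda>x. ip (HL \<rho>) (op_app (\<sigma> x \<rho>) u) v) \<in> borel_measurable haar)"

text \<open>The \<open>p\<close>-th power of the norm \<open>\<parallel>\<sigma>\<parallel>\<^bsub>p,\<mu>\<^esub>\<close>.\<close>

definition Lp_norm_pow :: "real \<Rightarrow> op_field \<Rightarrow> ennreal" where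
  "Lp_norm_pow p \<sigma> = (\<Sum>\<rho>\<in>{rho_plus, rho_minus}.
      \<integral>\<^sup>+x. schatten_pow (HL \<rho>) p (K \<rho> (1/p) O \<sigma> x \<rho>) \<partial>haar)"

definition Lp_op :: "real \<Rightarrow> op_field set" where
  "Lp_op p = {\<sigma>. op_field p \<sigma> \<and> Lp_norm_pow p \<sigma> < \<infinity>}"

section \<open>Wigner and Weyl transforms\<close>

definition Cc :: "(real \<times> real \<Rightarrow> complex) set" where
  "Cc = {f. continuous_on aff f \<and> (\<exists>S. compact S \<and> S \<subseteq> aff \<and> (\<forall>x\<in>aff - S. f x = 0))}"

text \<open>The operator-valued integral defining the Wigner transform on \<open>Cc\<close>, in the weak sense.\<close>

definition wigner_Cc :: "(real \<times> real \<Rightarrow> complex) \<Rightarrow> (real \<times> real \<Rightarrow> complex) \<Rightarrow> op_field" where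
  "wigner_Cc f g x \<rho> = {(u, v). u \<in> L2 (HL \<rho>) \<and> v \<in> L2 (HL \<rho>) \<and>
      (\<forall>h\<in>L2 (HL \<rho>). ip (HL \<rho>) v h =
         (LINT y|haar. f y * g (aff_mult (aff_inv y) x) * ip (HL \<rho>) (rep y u) h))}"

text \<open>\<open>w\<close> represents \<open>W(f,g)\<close>, the extension by continuity to \<open>L\<^sup>2\<close>. Being a limit of elements
  of \<open>Lp_op 2\<close> in the norm of exponent 2, such a \<open>w\<close> lies in \<open>Lp_op 2\<close>.\<close>

definition is_wigner ::
  "(real \<times> real \<Rightarrow> complex) \<Rightarrow> (real \<times> real \<Rightarrow> complex) \<Rightarrow> op_field \<Rightarrow> bool" where
  "is_wigner f g w \<longleftrightarrow> op_field 2 w \<and>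
     (\<exists>fn gn. (\<forall>n::nat. fn n \<in> Cc \<and> gn n \<in> Cc) \<and>
        (\<lambda>n. l2norm haar (\<lambda>x. fn n x - f x)) \<longlonglongrightarrow> 0 \<and>
        (\<lambda>n. l2norm haar (\<lambda>x. gn n x - g x)) \<longlonglongrightarrow> 0 \<and>
        (\<lambda>n. Lp_norm_pow 2 (\<lambda>x \<rho>. op_diff (wigner_Cc (fn n) (gn n) x \<rho>) (w x \<rho>))) \<longlonglongrightarrow> 0)"

text \<open>The bounded extension of \<open>(\<sigma>K\<^sub>\<rho>\<^bsup>1/p\<^esup>)\<^sup>*(wK\<^sub>\<rho>\<^bsup>1/p'\<^esup>)\<close>, where \<open>1/p' = 1 - 1/p\<close>.\<close>

definition weyl_prod :: "real \<Rightarrow> op_field \<Rightarrow> op_field \<Rightarrow> op_field" where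
  "weyl_prod p \<sigma> w x \<rho> =
     op_closure (HL \<rho>) ((K \<rho> (1 - 1/p) O w x \<rho>) O op_adj (HL \<rho>) (K \<rho> (1/p) O \<sigma> x \<rho>))"

text \<open>The trace is only determined for almost every \<open>x\<close>, hence the completed measure.\<close>

definition weyl_form_defined :: "real \<Rightarrow> op_field \<Rightarrow> op_field \<Rightarrow> bool" where
  "weyl_form_defined p \<sigma> w \<longleftrightarrow>
     (\<forall>\<rho>. (AE x in haar. trace_class (HL \<rho>) (weyl_prod p \<sigma> w x \<rho>)) \<and>
          integrable (completion haar) (\<lambda>x. trace (HL \<rho>) (weyl_prod p \<sigma> w x \<rho>)))"

text \<open>The pairing \<open>\<langle>w,\<sigma>\<rangle>\<^sub>\<mu>\<close>, which for \<open>w = W(f,g)\<close> is \<open>\<langle>W\<^sub>\<sigma>f, cnj g\<rangle>\<close>.\<close>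

definition weyl_form :: "real \<Rightarrow> op_field \<Rightarrow> op_field \<Rightarrow> complex" where
  "weyl_form p \<sigma> w =
     (\<Sum>\<rho>\<in>{rho_plus, rho_minus}. LINT x|completion haar. trace (HL \<rho>) (weyl_prod p \<sigma> w x \<rho>))"

text \<open>Boundedness of the Weyl transform. All representatives \<open>w\<close> of \<open>W(f,g)\<close> give the same
  pairing, so quantifying over them is no restriction.\<close>

definition weyl_bounded :: "real \<Rightarrow> op_field \<Rightarrow> bool" where
  "weyl_bounded p \<sigma> \<longleftrightarrow>
     (\<exists>C. \<forall>f\<in>L2 haar. \<forall>g\<in>L2 haar. \<forall>w. is_wigner f g w \<longrightarrow>
        weyl_form_defined p \<sigma> w \<and> cmod (weyl_form p \<sigma> w) \<le> C * l2norm haar f * l2norm haar g)"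

end

theory Submission
  imports Defs
begin

text \<open>
  Why the statement holds. If \<open>f\<close> and \<open>g\<close> are square integrable, then \<open>W(f,g)(x) K\<^bsup>1/2\<^esup>\<close> is a
  Hilbert-Schmidt operator for almost every \<open>x\<close>, but the pairing with a symbol of exponent \<open>p\<close>
  involves \<open>W(f,g)(x) K\<^bsup>1-1/p\<^esup>\<close>. For \<open>p > 2\<close> the surplus factor \<open>K\<^bsup>1/2-1/p\<^esup>\<close> is unbounded, and
  nothing compensates for it: there are \<open>f\<close>, \<open>g\<close>, even continuous with compact support, such that
  \<open>W(f,g)(x) K\<^bsup>1-1/p\<^esup>\<close> is unbounded for every \<open>x\<close> in a box \<open>Q\<close> of positive measure. A symbol
  that is one suitable rank one operator on \<open>Q\<close> and \<open>0\<close> elsewhere detects this: the product whose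
  trace defines the pairing is an unbounded operator for all \<open>x \<in> Q\<close>, so that the pairing is not
  even defined.

  To find \<open>f\<close> and \<open>g\<close>, write \<open>k(b,a) = f(b,a) g((b,a)\<inverse>x)\<close>. Then \<open>W(f,g)(x)\<close> is the integral
  operator sending \<open>u\<close> to \<open>s \<mapsto> \<integral> a\<^bsup>-3/2\<^esup> F(s,a) u(as) da\<close>, with \<open>F\<close> the Fourier transform of \<open>k\<close> in
  \<open>b\<close>. Let \<open>f(b,a) = \<omega>(a) \<chi>(b) \<Sum>\<^sub>j 2\<^bsup>-j\<^esup> exp(i M\<^sup>j b)\<close>, with \<open>\<chi>\<close> the triangle function and \<open>\<omega>\<close> a
  bump, and let \<open>g\<close> be a plateau that equals \<open>1\<close> wherever it matters for \<open>x \<in> Q\<close>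
  (\<open>aff_kernel_wild\<close>). The Fourier transform of \<open>\<chi>\<close> is nonnegative, so there is no cancellation,
  and \<open>F(s,a)\<close> is at least a constant times \<open>2\<^bsup>-k\<^esup> \<omega>(a)\<close> on an interval of length \<open>1\<close> near \<open>s = M\<^sup>k\<close>
  (\<open>lacunary_ft_ge\<close>). Apply \<open>W(f,g)(x) K\<^bsup>1-1/p\<^esup>\<close> to the indicator of \<open>[2M\<^sup>k, 12M\<^sup>k]\<close>, of norm
  comparable to \<open>M\<^bsup>k/2\<^esup>\<close>, and pair the result with a vector having a spike of height \<open>2\<^bsup>-k\<^esup>\<close> on each
  of these intervals. The outcome is at least a constant times \<open>4\<^bsup>-k\<^esup> M\<^bsup>k(1-1/p)\<^esup>\<close>
  (\<open>wigner_coefficient_ge\<close>), and the quotient \<open>4\<^bsup>-k\<^esup> M\<^bsup>k(1/2-1/p)\<^esup>\<close> is unbounded once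
  \<open>M\<^bsup>1/2-1/p\<^esup> = 8\<close> (\<open>weyl_prod_unbounded\<close>).

  Two points need care. First, the pointwise integral has to be recognised as a representative of
  the Wigner transform, which includes the boundedness of \<open>W(f,g)(x) K\<^bsup>1/2\<^esup>\<close> for every \<open>x\<close>. This
  is \<open>is_wigner_wigner_Cc\<close>, which rests on Plancherel's inequality. Second, Schatten norms have to be
  evaluated, but only for operators of rank at most one; they are diagonalised by any orthonormal
  basis through a single vector (\<open>op_power_rank_one\<close>), so no spectral theorem is involved.
\<close>


section \<open>The geometry of \<open>L\<^sup>2\<close>\<close>

lemma L2_measurable: "u \<in> L2 M \<Longrightarrow> u \<in> borel_measurable M"
  by (simp add: L2_def)

lemma L2_integrable: "u \<in> L2 M \<Longrightarrow> integrable M (\<lambda>x. (cmod (u x))\<^sup>2)"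
  by (simp add: L2_def)

lemma L2_iff_nn_integral:
  "u \<in> L2 M \<longleftrightarrow> u \<in> borel_measurable M \<and> (\<integral>\<^sup>+x. ennreal ((cmod (u x))\<^sup>2) \<partial>M) < \<infinity>"
  by (auto simp: L2_def integrable_iff_bounded)

lemma L2_dominated:
  assumes "u \<in> L2 M" "v \<in> borel_measurable M" "\<And>x. x \<in> space M \<Longrightarrow> cmod (v x) \<le> C * cmod (u x)"
  shows "v \<in> L2 M"
proof -
  have "integrable M (\<lambda>x. C\<^sup>2 * (cmod (u x))\<^sup>2)"
    using L2_integrable[OF assms(1)] by simp
  then have "integrable M (\<lambda>x. (cmod (v x))\<^sup>2)"
  proof (rule Bochner_Integration.integrable_bound)
    show "(\<lambda>x. (cmod (v x))\<^sup>2) \<in> borel_measurable M" using assms(2) by measurable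
    have "(cmod (v x))\<^sup>2 \<le> C\<^sup>2 * (cmod (u x))\<^sup>2" if "x \<in> space M" for x
      using power_mono[OF assms(3)[OF that], of 2] by (simp add: power_mult_distrib)
    then show "AE x in M. norm ((cmod (v x))\<^sup>2) \<le> norm (C\<^sup>2 * (cmod (u x))\<^sup>2)" by auto
  qed
  with assms(2) show ?thesis by (simp add: L2_def)
qed

lemma L2_zero: "(\<lambda>x. 0) \<in> L2 M"
  by (simp add: L2_def)

lemma L2_scale:
  assumes "u \<in> L2 M"
  shows "(\<lambda>x. c * u x) \<in> L2 M"
proof (rule L2_dominated[OF assms, where C = "cmod c"])
  show "(\<lambda>x. c * u x) \<in> borel_measurable M"
    using L2_measurable[OF assms] by measurable
qed (simp add: norm_mult)

lemma L2_add:
  assumes "u \<in> L2 M" "v \<in> L2 M"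
  shows "(\<lambda>x. u x + v x) \<in> L2 M"
proof -
  have m: "(\<lambda>x. u x + v x) \<in> borel_measurable M"
    using assms[THEN L2_measurable] by measurable
  have "integrable M (\<lambda>x. 2 * (cmod (u x))\<^sup>2 + 2 * (cmod (v x))\<^sup>2)"
    using assms[THEN L2_integrable] by simp
  then have "integrable M (\<lambda>x. (cmod (u x + v x))\<^sup>2)"
  proof (rule Bochner_Integration.integrable_bound)
    show "(\<lambda>x. (cmod (u x + v x))\<^sup>2) \<in> borel_measurable M" using m by measurable
    have "(cmod (u x + v x))\<^sup>2 \<le> 2 * (cmod (u x))\<^sup>2 + 2 * (cmod (v x))\<^sup>2" for x
    proof -
      have "(cmod (u x + v x))\<^sup>2 \<le> (cmod (u x) + cmod (v x))\<^sup>2"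
        by (intro power_mono norm_triangle_ineq) auto
      then show ?thesis
        using zero_le_power2[of "cmod (u x) - cmod (v x)"] by (simp add: power2_eq_square algebra_simps)
    qed
    then show "AE x in M. norm ((cmod (u x + v x))\<^sup>2) \<le> norm (2 * (cmod (u x))\<^sup>2 + 2 * (cmod (v x))\<^sup>2)"
      by auto
  qed
  with m show ?thesis by (simp add: L2_def)
qed

lemma L2_diff:
  assumes "u \<in> L2 M" "v \<in> L2 M"
  shows "(\<lambda>x. u x - v x) \<in> L2 M"
  using L2_add[OF assms(1) L2_scale[OF assms(2), of "-1"]] by simp

lemma L2_sum: "(\<And>i. i \<in> F \<Longrightarrow> u i \<in> L2 M) \<Longrightarrow> (\<lambda>x. \<Sum>i\<in>F. u i x) \<in> L2 M"
  by (induction F rule: infinite_finite_induct) (auto intro: L2_zero L2_add)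

lemma L2_cong_AE:
  assumes "u \<in> L2 M" "v \<in> borel_measurable M" "AE x in M. v x = u x"
  shows "v \<in> L2 M"
proof -
  have "integrable M (\<lambda>x. (cmod (v x))\<^sup>2) = integrable M (\<lambda>x. (cmod (u x))\<^sup>2)"
    using assms(1,2) L2_measurable[OF assms(1)] by (intro integrable_cong_AE) (use assms(3) in auto)
  with assms show ?thesis by (simp add: L2_def)
qed

lemma ip_integrable:
  assumes "u \<in> L2 M" "v \<in> L2 M"
  shows "integrable M (\<lambda>x. u x * cnj (v x))"
proof (rule Bochner_Integration.integrable_bound)
  show "integrable M (\<lambda>x. (cmod (u x))\<^sup>2 + (cmod (v x))\<^sup>2)"
    using assms[THEN L2_integrable] by simp
  have [measurable]: "u \<in> borel_measurable M" "v \<in> borel_measurable M"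
    using assms[THEN L2_measurable] by auto
  have "cnj \<in> borel_measurable borel"
    by (intro borel_measurable_continuous_onI continuous_intros)
  then show "(\<lambda>x. u x * cnj (v x)) \<in> borel_measurable M"
    by measurable
  have "cmod (u x * cnj (v x)) \<le> (cmod (u x))\<^sup>2 + (cmod (v x))\<^sup>2" for x
  proof -
    have "cmod (u x) * cmod (v x) \<le> 2 * cmod (u x) * cmod (v x)" by simp
    also have "\<dots> \<le> (cmod (u x))\<^sup>2 + (cmod (v x))\<^sup>2" by (rule sum_squares_bound)
    finally show ?thesis by (simp add: norm_mult)
  qed
  then show "AE x in M. norm (u x * cnj (v x)) \<le> norm ((cmod (u x))\<^sup>2 + (cmod (v x))\<^sup>2)"
    by auto
qed

lemma ip_add_left:
  "u \<in> L2 M \<Longrightarrow> u' \<in> L2 M \<Longrightarrow> v \<in> L2 M \<Longrightarrow> ip M (\<lambda>x. u x + u' x) v = ip M u v + ip M u' v"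
  unfolding ip_def by (simp add: ring_distribs ip_integrable)

lemma ip_diff_left:
  "u \<in> L2 M \<Longrightarrow> u' \<in> L2 M \<Longrightarrow> v \<in> L2 M \<Longrightarrow> ip M (\<lambda>x. u x - u' x) v = ip M u v - ip M u' v"
  unfolding ip_def by (simp add: ring_distribs ip_integrable left_diff_distrib)

lemma ip_scale_left: "ip M (\<lambda>x. c * u x) v = c * ip M u v"
  unfolding ip_def by (simp add: mult.assoc)

lemma ip_zero_left: "ip M (\<lambda>x. 0) v = 0"
  by (simp add: ip_def)

lemma cnj_ip: "cnj (ip M u v) = ip M v u"
proof -
  have "cnj (ip M u v) = (LINT x|M. cnj (u x * cnj (v x)))"
    unfolding ip_def by (rule Bochner_Integration.integral_cnj [symmetric])
  also have "\<dots> = ip M v u"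
    unfolding ip_def by (intro Bochner_Integration.integral_cong refl) simp
  finally show ?thesis .
qed

lemma ip_eq_flip: "ip M u v = ip M u' v' \<Longrightarrow> ip M v u = ip M v' u'"
  by (drule arg_cong[of _ _ cnj]) (simp add: cnj_ip)

lemma ip_scale_right: "ip M u (\<lambda>x. c * v x) = cnj c * ip M u v"
  by (metis cnj_ip complex_cnj_cnj complex_cnj_mult ip_scale_left)

lemma ip_sum_left:
  "(\<And>i. i \<in> F \<Longrightarrow> u i \<in> L2 M) \<Longrightarrow> v \<in> L2 M \<Longrightarrow> ip M (\<lambda>x. \<Sum>i\<in>F. u i x) v = (\<Sum>i\<in>F. ip M (u i) v)"
  by (induction F rule: infinite_finite_induct) (auto simp: ip_zero_left ip_add_left L2_sum)

lemma ip_cong_AE: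
  assumes "u \<in> borel_measurable M" "u' \<in> borel_measurable M" "v \<in> borel_measurable M"
    and "AE x in M. u x = u' x"
  shows "ip M u v = ip M u' v"
proof -
  have "cnj \<in> borel_measurable borel"
    by (intro borel_measurable_continuous_onI continuous_intros)
  then show ?thesis
    unfolding ip_def using assms(1-3) by (intro integral_cong_AE) (use assms(4) in auto)
qed

lemma l2norm_nonneg: "0 \<le> l2norm M u"
  by (simp add: l2norm_def)

lemma l2norm_sq: "(l2norm M u)\<^sup>2 = (LINT x|M. (cmod (u x))\<^sup>2)"
  by (simp add: l2norm_def)

lemma ip_self: "ip M u u = complex_of_real ((l2norm M u)\<^sup>2)"
  unfolding l2norm_sq ip_def by (simp add: complex_mult_cnj cmod_power2 flip: integral_complex_of_real)

lemma nn_integral_l2norm: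
  "u \<in> L2 M \<Longrightarrow> (\<integral>\<^sup>+x. ennreal ((cmod (u x))\<^sup>2) \<partial>M) = ennreal ((l2norm M u)\<^sup>2)"
  unfolding l2norm_sq by (intro nn_integral_eq_integral L2_integrable) auto

lemma l2norm_le:
  assumes "u \<in> borel_measurable M" "0 \<le> C" "(\<integral>\<^sup>+x. ennreal ((cmod (u x))\<^sup>2) \<partial>M) \<le> ennreal (C\<^sup>2)"
  shows "u \<in> L2 M" "l2norm M u \<le> C"
proof -
  show u: "u \<in> L2 M"
    using assms by (auto simp: L2_iff_nn_integral intro: le_less_trans)
  have "(l2norm M u)\<^sup>2 \<le> C\<^sup>2"
    using assms(3) by (simp add: nn_integral_l2norm[OF u])
  then show "l2norm M u \<le> C"
    using assms(2) power2_le_imp_le by blast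
qed

lemma l2norm_eq_0_iff:
  assumes "u \<in> L2 M"
  shows "l2norm M u = 0 \<longleftrightarrow> (AE x in M. u x = 0)"
  using integral_nonneg_eq_0_iff_AE[OF L2_integrable[OF assms]] by (simp add: l2norm_def)

lemma l2norm_zero: "l2norm M (\<lambda>x. 0) = 0"
  by (simp add: l2norm_def)

lemma l2norm_scale: "l2norm M (\<lambda>x. c * u x) = cmod c * l2norm M u"
  by (simp add: l2norm_def norm_mult power_mult_distrib real_sqrt_mult)

lemma l2norm_cong_AE:
  assumes "u \<in> L2 M" "v \<in> L2 M" "AE x in M. u x = v x"
  shows "l2norm M u = l2norm M v"
  unfolding l2norm_def using assms(1,2)[THEN L2_measurable]
  by (intro arg_cong[of _ _ sqrt] integral_cong_AE) (use assms(3) in auto)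

lemma Cauchy_Schwarz_ip:
  assumes "u \<in> L2 M" "v \<in> L2 M"
  shows "(LINT x|M. cmod (u x) * cmod (v x)) \<le> l2norm M u * l2norm M v"
    and "cmod (ip M u v) \<le> l2norm M u * l2norm M v"
proof -
  have [measurable]: "u \<in> borel_measurable M" "v \<in> borel_measurable M"
    using assms[THEN L2_measurable] by auto
  have i: "integrable M (\<lambda>x. cmod (u x) * cmod (v x))"
    using integrable_norm[OF ip_integrable[OF assms]] by (simp add: norm_mult)
  let ?I = "LINT x|M. cmod (u x) * cmod (v x)"
  have "(\<integral>\<^sup>+x. ennreal (cmod (u x)) * ennreal (cmod (v x)) \<partial>M) = ennreal ?I"
    using nn_integral_eq_integral[OF i] by (simp only: ennreal_mult norm_ge_zero) simp
  then have "ennreal (?I\<^sup>2) = (\<integral>\<^sup>+x. ennreal (cmod (u x)) * ennreal (cmod (v x)) \<partial>M)\<^sup>2"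
    by (simp add: ennreal_power)
  also have "\<dots> \<le> (\<integral>\<^sup>+x. (ennreal (cmod (u x)))\<^sup>2 \<partial>M) * (\<integral>\<^sup>+x. (ennreal (cmod (v x)))\<^sup>2 \<partial>M)"
    by (rule Cauchy_Schwarz_nn_integral) auto
  also have "\<dots> = ennreal ((l2norm M u * l2norm M v)\<^sup>2)"
    using assms by (simp add: ennreal_power nn_integral_l2norm power_mult_distrib ennreal_mult)
  finally have "?I\<^sup>2 \<le> (l2norm M u * l2norm M v)\<^sup>2" by simp
  then show 1: "?I \<le> l2norm M u * l2norm M v"
    by (rule power2_le_imp_le) (simp add: l2norm_nonneg)
  have "cmod (ip M u v) \<le> (LINT x|M. cmod (u x * cnj (v x)))"
    unfolding ip_def by (rule integral_norm_bound)
  with 1 show "cmod (ip M u v) \<le> l2norm M u * l2norm M v"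
    by (simp add: norm_mult)
qed

lemma l2norm_triangle:
  assumes "u \<in> L2 M" "v \<in> L2 M"
  shows "l2norm M (\<lambda>x. u x + v x) \<le> l2norm M u + l2norm M v"
proof -
  have s: "(\<lambda>x. u x + v x) \<in> L2 M" using assms by (rule L2_add)
  define n where "n = l2norm M (\<lambda>x. u x + v x)"
  have "complex_of_real (n\<^sup>2) = ip M u (\<lambda>x. u x + v x) + ip M v (\<lambda>x. u x + v x)"
    unfolding n_def using assms s by (simp only: ip_add_left flip: ip_self)
  then have "n\<^sup>2 = cmod (ip M u (\<lambda>x. u x + v x) + ip M v (\<lambda>x. u x + v x))"
    by (metis abs_of_nonneg norm_of_real zero_le_power2)
  also have "\<dots> \<le> l2norm M u * n + l2norm M v * n"
    unfolding n_def by (intro norm_triangle_le add_mono Cauchy_Schwarz_ip(2) assms s)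
  finally have "n * n \<le> (l2norm M u + l2norm M v) * n"
    by (simp add: power2_eq_square distrib_right)
  moreover have "0 \<le> n" "0 \<le> l2norm M u + l2norm M v" by (auto simp: n_def l2norm_nonneg)
  ultimately show ?thesis
    unfolding n_def[symmetric] by (cases "n = 0") (auto simp: mult_le_cancel_right)
qed

lemma l2norm_triangle_diff:
  assumes "u \<in> L2 M" "v \<in> L2 M"
  shows "l2norm M (\<lambda>x. u x - v x) \<le> l2norm M u + l2norm M v"
  using l2norm_triangle[OF assms(1) L2_scale[OF assms(2), of "-1"]] l2norm_scale[of M "-1" v] by simp

lemma AE_eq_if_ip_eq:
  assumes "v \<in> L2 M" "v' \<in> L2 M" "\<And>h. h \<in> L2 M \<Longrightarrow> ip M v h = ip M v' h"
  shows "AE s in M. v s = v' s"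
proof -
  have d: "(\<lambda>s. v s - v' s) \<in> L2 M" using assms(1,2) by (rule L2_diff)
  then have "ip M (\<lambda>s. v s - v' s) (\<lambda>s. v s - v' s) = 0"
    using assms by (simp add: ip_diff_left)
  then have "l2norm M (\<lambda>s. v s - v' s) = 0" by (simp add: ip_self)
  then show ?thesis using l2norm_eq_0_iff[OF d] by simp
qed

definition orthonormal :: "'a measure \<Rightarrow> ('a \<Rightarrow> complex) set \<Rightarrow> bool" where
  "orthonormal M E \<longleftrightarrow> E \<subseteq> L2 M \<and> (\<forall>e\<in>E. ip M e e = 1) \<and>
     (\<forall>e\<in>E. \<forall>e'\<in>E. e \<noteq> e' \<longrightarrow> ip M e e' = 0)"

text \<open>Bessel's inequality, indexed by an arbitrary family: expand the square norm of the
  difference between \<open>u\<close> and its projection on the span.\<close>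

lemma Bessel_inequality:
  assumes F: "finite F" and u: "u \<in> L2 M" and e: "\<And>i. i \<in> F \<Longrightarrow> e i \<in> L2 M"
    and orth: "\<And>i j. i \<in> F \<Longrightarrow> j \<in> F \<Longrightarrow> ip M (e i) (e j) = (if i = j then 1 else 0)"
  shows "(\<Sum>i\<in>F. (cmod (ip M u (e i)))\<^sup>2) \<le> (l2norm M u)\<^sup>2"
proof -
  define c where "c i = ip M u (e i)" for i
  define P where "P = (\<lambda>x. \<Sum>i\<in>F. c i * e i x)"
  have P: "P \<in> L2 M" unfolding P_def using e by (intro L2_sum L2_scale)
  have Pe: "ip M P (e j) = c j" if "j \<in> F" for j
  proof -
    have "ip M P (e j) = (\<Sum>i\<in>F. c i * ip M (e i) (e j))"
      unfolding P_def using e that by (subst ip_sum_left) (auto intro: L2_scale simp: ip_scale_left)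
    also have "\<dots> = c j"
      using that F by (simp add: orth if_distrib[of "(*) _"] cong: if_cong)
    finally show ?thesis .
  qed
  have R: "(\<lambda>x. u x - P x) \<in> L2 M" using u P by (rule L2_diff)
  have "ip M P (\<lambda>x. u x - P x) = (\<Sum>i\<in>F. c i * ip M (e i) (\<lambda>x. u x - P x))"
    unfolding P_def using e R[unfolded P_def]
    by (subst ip_sum_left) (auto intro: L2_scale simp: ip_scale_left)
  also have "\<dots> = 0"
  proof (rule sum.neutral, rule ballI)
    fix i assume i: "i \<in> F"
    have "ip M (\<lambda>x. u x - P x) (e i) = 0"
      using u P e[OF i] by (simp add: ip_diff_left Pe[OF i] c_def)
    then show "c i * ip M (e i) (\<lambda>x. u x - P x) = 0" by (metis cnj_ip complex_cnj_zero mult_zero_right)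
  qed
  finally have PR: "ip M P (\<lambda>x. u x - P x) = 0" .
  have "ip M P u = (\<Sum>i\<in>F. complex_of_real ((cmod (c i))\<^sup>2))"
  proof -
    have "ip M P u = (\<Sum>i\<in>F. c i * cnj (c i))"
      unfolding P_def using e u
      by (subst ip_sum_left) (auto intro: L2_scale simp: ip_scale_left c_def cnj_ip)
    then show ?thesis by (simp only: complex_norm_square)
  qed
  then have "cnj (ip M P u) = (\<Sum>i\<in>F. complex_of_real ((cmod (c i))\<^sup>2))"
    by simp
  then have "ip M u P = (\<Sum>i\<in>F. complex_of_real ((cmod (c i))\<^sup>2))"
    by (simp only: cnj_ip)
  moreover have "ip M u u = ip M (\<lambda>x. u x - P x) (\<lambda>x. u x - P x) + ip M u P"
  proof -
    have "ip M (\<lambda>x. u x - P x) (\<lambda>x. u x - P x) = ip M u (\<lambda>x. u x - P x)"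
      using u P R PR by (simp add: ip_diff_left)
    also have "\<dots> = cnj (ip M u u - ip M P u)"
      using u P by (simp add: ip_diff_left flip: cnj_ip[of M "\<lambda>x. u x - P x" u])
    also have "\<dots> = ip M u u - ip M u P" by (simp add: cnj_ip)
    finally show ?thesis by simp
  qed
  ultimately have "complex_of_real ((l2norm M u)\<^sup>2) =
      complex_of_real ((l2norm M (\<lambda>x. u x - P x))\<^sup>2 + (\<Sum>i\<in>F. (cmod (c i))\<^sup>2))"
    by (simp add: ip_self)
  then have "(l2norm M u)\<^sup>2 = (l2norm M (\<lambda>x. u x - P x))\<^sup>2 + (\<Sum>i\<in>F. (cmod (c i))\<^sup>2)"
    using of_real_eq_iff by blast
  then show ?thesis by (simp add: c_def)
qed

text \<open>A maximal orthonormal set is an orthonormal basis: a vector orthogonal to all of it could be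
  normalised and added. Such sets exist by Zorn's lemma.\<close>

lemma orthonormal_extends_to_onb:
  assumes "orthonormal M S"
  obtains E where "onb M E" "S \<subseteq> E"
proof -
  let ?A = "{E. orthonormal M E \<and> S \<subseteq> E}"
  have "\<exists>E\<in>?A. \<forall>X\<in>?A. E \<subseteq> X \<longrightarrow> X = E"
  proof (rule subset_Zorn_nonempty)
    show "?A \<noteq> {}" using assms by auto
  next
    fix C assume C: "C \<noteq> {}" "subset.chain ?A C"
    then have CA: "C \<subseteq> ?A" and tot: "\<And>X Y. X \<in> C \<Longrightarrow> Y \<in> C \<Longrightarrow> X \<subseteq> Y \<or> Y \<subseteq> X"
      by (auto simp: subset_chain_def)
    have "ip M e e' = 0" if "e \<in> \<Union> C" "e' \<in> \<Union> C" "e \<noteq> e'" for e e'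
    proof -
      from that obtain X Y where "X \<in> C" "Y \<in> C" "e \<in> X" "e' \<in> Y" by auto
      with tot[of X Y] obtain Z where "Z \<in> C" "e \<in> Z" "e' \<in> Z" by auto
      with CA that(3) show ?thesis by (auto simp: orthonormal_def)
    qed
    with CA C(1) show "\<Union> C \<in> ?A"
      unfolding orthonormal_def by (auto simp: subset_iff)
  qed
  then obtain E where E: "orthonormal M E" "S \<subseteq> E"
    and max: "\<And>X. orthonormal M X \<Longrightarrow> S \<subseteq> X \<Longrightarrow> E \<subseteq> X \<Longrightarrow> X = E" by auto
  have "AE x in M. u x = 0" if u: "u \<in> L2 M" and orth: "\<forall>e\<in>E. ip M u e = 0" for u
  proof (rule ccontr)
    assume "\<not> (AE x in M. u x = 0)"
    then have n: "l2norm M u \<noteq> 0" using l2norm_eq_0_iff[OF u] by simp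
    define e where "e = (\<lambda>x. complex_of_real (1 / l2norm M u) * u x)"
    have e: "e \<in> L2 M" unfolding e_def using u by (rule L2_scale)
    have ee: "ip M e e = 1"
      unfolding e_def ip_scale_left ip_scale_right ip_self using n by (simp add: field_simps power2_eq_square)
    have eE: "ip M e e' = 0" "ip M e' e = 0" if "e' \<in> E" for e'
    proof -
      show *: "ip M e e' = 0" unfolding e_def ip_scale_left using orth that by simp
      show "ip M e' e = 0" by (metis * cnj_ip complex_cnj_zero)
    qed
    have "orthonormal M (insert e E)"
      using E(1) e ee eE by (auto simp: orthonormal_def)
    then have "insert e E = E" using E(2) by (intro max) auto
    then have "e \<in> E" by blast
    with eE(1)[of e] ee show False by simp
  qed
  with E have "onb M E" by (auto simp: onb_def orthonormal_def)
  with E(2) show thesis using that by blast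
qed

lemma onb_some_onb: "onb M (some_onb M)"
proof -
  have "orthonormal M {}" by (simp add: orthonormal_def)
  then obtain E where "onb M E" by (rule orthonormal_extends_to_onb)
  then show ?thesis unfolding some_onb_def by (rule someI)
qed

section \<open>Rank one operators\<close>

definition rank_one :: "'a measure \<Rightarrow> ('a \<Rightarrow> complex) \<Rightarrow> ('a \<Rightarrow> complex) \<Rightarrow> 'a opr" where
  "rank_one M \<phi> \<psi> = {(u, v). u \<in> L2 M \<and> v \<in> L2 M \<and> (AE x in M. v x = ip M u \<phi> * \<psi> x)}"

lemma rank_oneI: "u \<in> L2 M \<Longrightarrow> \<psi> \<in> L2 M \<Longrightarrow> (u, \<lambda>x. ip M u \<phi> * \<psi> x) \<in> rank_one M \<phi> \<psi>"
  by (simp add: rank_one_def L2_scale)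

lemma l2norm_rank_one:
  assumes "(u, v) \<in> rank_one M \<phi> \<psi>" "\<psi> \<in> L2 M"
  shows "l2norm M v = cmod (ip M u \<phi>) * l2norm M \<psi>"
proof -
  have "l2norm M v = l2norm M (\<lambda>x. ip M u \<phi> * \<psi> x)"
    using assms by (intro l2norm_cong_AE L2_scale) (auto simp: rank_one_def)
  then show ?thesis by (simp add: l2norm_scale)
qed

lemma bounded_opr_rank_one:
  assumes \<phi>: "\<phi> \<in> L2 M" and \<psi>: "\<psi> \<in> L2 M"
  shows "bounded_opr M (rank_one M \<phi> \<psi>)"
  unfolding bounded_opr_def
proof (intro conjI)
  let ?R = "rank_one M \<phi> \<psi>"
  show "linear_opr M ?R"
    unfolding linear_opr_def
  proof (intro conjI)
    show "?R \<subseteq> L2 M \<times> L2 M" by (auto simp: rank_one_def)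
    show "(\<lambda>x. 0, \<lambda>x. 0) \<in> ?R" by (simp add: rank_one_def L2_zero ip_zero_left)
    have "(\<lambda>x. u x + u' x, \<lambda>x. v x + v' x) \<in> ?R" if "(u, v) \<in> ?R" "(u', v') \<in> ?R" for u v u' v'
    proof -
      have L: "u \<in> L2 M" "u' \<in> L2 M" "v \<in> L2 M" "v' \<in> L2 M" using that by (auto simp: rank_one_def)
      have "AE x in M. v x = ip M u \<phi> * \<psi> x" "AE x in M. v' x = ip M u' \<phi> * \<psi> x"
        using that by (auto simp: rank_one_def)
      then have "AE x in M. v x + v' x = ip M (\<lambda>x. u x + u' x) \<phi> * \<psi> x"
        by eventually_elim (simp add: ip_add_left L \<phi> distrib_right)
      with L show ?thesis by (simp add: rank_one_def L2_add)
    qed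
    then show "\<forall>(u, v)\<in>?R. \<forall>(u', v')\<in>?R. (\<lambda>x. u x + u' x, \<lambda>x. v x + v' x) \<in> ?R" by blast
    have "(\<lambda>x. c * u x, \<lambda>x. c * v x) \<in> ?R" if "(u, v) \<in> ?R" for u v c
      using that by (auto simp: rank_one_def L2_scale ip_scale_left)
    then show "\<forall>(u, v)\<in>?R. \<forall>c. (\<lambda>x. c * u x, \<lambda>x. c * v x) \<in> ?R" by blast
    have "(u', v') \<in> ?R"
      if R: "(u, v) \<in> ?R" and u': "u' \<in> L2 M" and v': "v' \<in> L2 M"
        and uu: "AE x in M. u' x = u x" and vv: "AE x in M. v' x = v x" for u v u' v'
    proof -
      have "ip M u' \<phi> = ip M u \<phi>"
        using R u' \<phi> uu by (intro ip_cong_AE) (auto simp: rank_one_def L2_measurable)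
      moreover have "AE x in M. v x = ip M u \<phi> * \<psi> x" using R by (simp add: rank_one_def)
      ultimately have "AE x in M. v' x = ip M u' \<phi> * \<psi> x" using vv by auto
      with u' v' show ?thesis by (simp add: rank_one_def)
    qed
    then show "\<forall>(u, v)\<in>?R. \<forall>u'\<in>L2 M. \<forall>v'\<in>L2 M.
        (AE x in M. u' x = u x) \<longrightarrow> (AE x in M. v' x = v x) \<longrightarrow> (u', v') \<in> ?R" by blast
    have "AE x in M. v x = v' x" if "(u, v) \<in> ?R" "(u, v') \<in> ?R" for u v v'
      using that by (auto simp: rank_one_def)
    then show "\<forall>u v v'. (u, v) \<in> ?R \<longrightarrow> (u, v') \<in> ?R \<longrightarrow> (AE x in M. v x = v' x)" by blast
  qed
  show "Domain ?R = L2 M"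
    using rank_oneI[OF _ \<psi>] by (auto simp: rank_one_def Domain_iff)
  have "l2norm M v \<le> (l2norm M \<phi> * l2norm M \<psi>) * l2norm M u" if R: "(u, v) \<in> ?R" for u v
  proof -
    have "u \<in> L2 M" using R by (simp add: rank_one_def)
    then have "cmod (ip M u \<phi>) * l2norm M \<psi> \<le> (l2norm M u * l2norm M \<phi>) * l2norm M \<psi>"
      using \<phi> by (intro mult_right_mono Cauchy_Schwarz_ip l2norm_nonneg)
    then show ?thesis by (simp add: l2norm_rank_one[OF R \<psi>] ac_simps)
  qed
  then show "norm_bounded M ?R" unfolding norm_bounded_def by blast
qed

text \<open>Restricting a bounded operator to a dense subspace loses nothing: the closure of the restricted
  graph is the whole graph again. This is how the Duflo-Moore factor, which only cuts down the
  domain once it has been absorbed, disappears from Schatten norms.\<close>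

lemma op_closure_rank_one:
  assumes \<phi>: "\<phi> \<in> L2 M" and \<psi>: "\<psi> \<in> L2 M"
    and dense: "\<And>u. u \<in> L2 M \<Longrightarrow> \<exists>un. (\<forall>n::nat. un n \<in> D \<and> un n \<in> L2 M) \<and>
      (\<lambda>n. l2norm M (\<lambda>x. un n x - u x)) \<longlonglongrightarrow> 0"
  shows "op_closure M {(u, v). u \<in> D \<and> (u, v) \<in> rank_one M \<phi> \<psi>} = rank_one M \<phi> \<psi>"
    (is "op_closure M ?A = ?R")
proof (intro subset_antisym subsetI)
  fix z assume "z \<in> op_closure M ?A"
  then obtain u v un vn where z: "z = (u, v)" and u: "u \<in> L2 M" and v: "v \<in> L2 M"
    and A: "\<And>n::nat. (un n, vn n) \<in> ?A"
    and lu: "(\<lambda>n. l2norm M (\<lambda>x. un n x - u x)) \<longlonglongrightarrow> 0"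
    and lv: "(\<lambda>n. l2norm M (\<lambda>x. vn n x - v x)) \<longlonglongrightarrow> 0"
    unfolding op_closure_def by auto
  have un: "un n \<in> L2 M" and vn: "vn n \<in> L2 M" and R: "(un n, vn n) \<in> ?R" for n
    using A[of n] by (auto simp: rank_one_def)
  define w where "w = (\<lambda>x. ip M u \<phi> * \<psi> x)"
  have w: "w \<in> L2 M" unfolding w_def using \<psi> by (rule L2_scale)
  have le: "l2norm M (\<lambda>x. v x - w x) \<le>
     l2norm M (\<lambda>x. vn n x - v x) + l2norm M (\<lambda>x. un n x - u x) * l2norm M \<phi> * l2norm M \<psi>" for n
  proof -
    have d: "(\<lambda>x. vn n x - w x) \<in> L2 M" "(\<lambda>x. vn n x - v x) \<in> L2 M" "(\<lambda>x. un n x - u x) \<in> L2 M"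
      using un vn u v w by (auto intro: L2_diff)
    have "AE x in M. vn n x = ip M (un n) \<phi> * \<psi> x" using R by (simp add: rank_one_def)
    then have "AE x in M. vn n x - w x = ip M (\<lambda>x. un n x - u x) \<phi> * \<psi> x"
      by eventually_elim (simp add: w_def ip_diff_left un u \<phi> left_diff_distrib)
    with d have "(\<lambda>x. un n x - u x, \<lambda>x. vn n x - w x) \<in> ?R" by (simp add: rank_one_def)
    then have "l2norm M (\<lambda>x. vn n x - w x) = cmod (ip M (\<lambda>x. un n x - u x) \<phi>) * l2norm M \<psi>"
      using \<psi> by (rule l2norm_rank_one)
    also have "\<dots> \<le> l2norm M (\<lambda>x. un n x - u x) * l2norm M \<phi> * l2norm M \<psi>"
      using d \<phi> by (intro mult_right_mono Cauchy_Schwarz_ip l2norm_nonneg)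
    finally have "l2norm M (\<lambda>x. vn n x - w x) \<le> \<dots>" .
    moreover have "l2norm M (\<lambda>x. v x - w x) \<le> l2norm M (\<lambda>x. vn n x - w x) + l2norm M (\<lambda>x. vn n x - v x)"
      using l2norm_triangle_diff[OF d(1,2)] by simp
    ultimately show ?thesis by simp
  qed
  have "(\<lambda>n. l2norm M (\<lambda>x. vn n x - v x) + l2norm M (\<lambda>x. un n x - u x) * l2norm M \<phi> * l2norm M \<psi>)
      \<longlonglongrightarrow> 0 + 0 * l2norm M \<phi> * l2norm M \<psi>"
    by (intro tendsto_intros lu lv)
  then have "l2norm M (\<lambda>x. v x - w x) \<le> 0"
    using le by (intro LIMSEQ_le_const) auto
  then have "AE x in M. v x - w x = 0"
    using l2norm_eq_0_iff[OF L2_diff[OF v w]] l2norm_nonneg[of M "\<lambda>x. v x - w x"] by linarith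
  then show "z \<in> ?R" using u v by (simp add: z rank_one_def w_def)
next
  fix z assume "z \<in> ?R"
  then obtain u v where z: "z = (u, v)" and R: "(u, v) \<in> ?R" by (cases z) auto
  then have u: "u \<in> L2 M" and v: "v \<in> L2 M" by (auto simp: rank_one_def)
  from dense[OF u] obtain un where un: "\<And>n::nat. un n \<in> D" "\<And>n. un n \<in> L2 M"
    and lu: "(\<lambda>n. l2norm M (\<lambda>x. un n x - u x)) \<longlonglongrightarrow> 0" by blast
  define vn where "vn n = (\<lambda>x. ip M (un n) \<phi> * \<psi> x)" for n
  have vn: "vn n \<in> L2 M" for n unfolding vn_def using \<psi> by (rule L2_scale)
  have A: "(un n, vn n) \<in> ?A" for n
    using un[of n] rank_oneI[OF _ \<psi>, of "un n" \<phi>] by (simp add: vn_def)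
  have "l2norm M (\<lambda>x. vn n x - v x) \<le> l2norm M (\<lambda>x. un n x - u x) * l2norm M \<phi> * l2norm M \<psi>" for n
  proof -
    have d: "(\<lambda>x. un n x - u x) \<in> L2 M" using un u by (intro L2_diff)
    have "AE x in M. v x = ip M u \<phi> * \<psi> x" using R by (simp add: rank_one_def)
    then have "AE x in M. vn n x - v x = ip M (\<lambda>x. un n x - u x) \<phi> * \<psi> x"
      by eventually_elim (simp add: vn_def ip_diff_left un u \<phi> left_diff_distrib)
    with d v vn have "(\<lambda>x. un n x - u x, \<lambda>x. vn n x - v x) \<in> ?R" by (simp add: rank_one_def L2_diff)
    then have "l2norm M (\<lambda>x. vn n x - v x) = cmod (ip M (\<lambda>x. un n x - u x) \<phi>) * l2norm M \<psi>"
      using \<psi> by (rule l2norm_rank_one)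
    also have "\<dots> \<le> l2norm M (\<lambda>x. un n x - u x) * l2norm M \<phi> * l2norm M \<psi>"
      using d \<phi> by (intro mult_right_mono Cauchy_Schwarz_ip l2norm_nonneg)
    finally show ?thesis .
  qed
  note le = this
  have lim: "(\<lambda>n. l2norm M (\<lambda>x. un n x - u x) * l2norm M \<phi> * l2norm M \<psi>) \<longlonglongrightarrow> 0"
    by (intro tendsto_mult_left_zero lu)
  have lv: "(\<lambda>n. l2norm M (\<lambda>x. vn n x - v x)) \<longlonglongrightarrow> 0"
    by (rule tendsto_sandwich[OF _ _ tendsto_const lim]) (simp_all add: l2norm_nonneg le)
  show "z \<in> op_closure M ?A"
    unfolding op_closure_def z using u v A lu lv by blast
qed

lemma op_adj_rank_one:
  assumes \<phi>: "\<phi> \<in> L2 M" and \<psi>: "\<psi> \<in> L2 M"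
  shows "op_adj M (rank_one M \<phi> \<psi>) = rank_one M \<psi> \<phi>"
proof -
  have "(\<forall>(x, y)\<in>rank_one M \<phi> \<psi>. ip M y u = ip M x v) \<longleftrightarrow> (AE x in M. v x = ip M u \<psi> * \<phi> x)"
    if u: "u \<in> L2 M" and v: "v \<in> L2 M" for u v
  proof -
    define w where "w = (\<lambda>x. ip M u \<psi> * \<phi> x)"
    have w: "w \<in> L2 M" unfolding w_def using \<phi> by (rule L2_scale)
    have y: "ip M y u = ip M x w" if "(x, y) \<in> rank_one M \<phi> \<psi>" for x y
    proof -
      have "ip M y u = ip M (\<lambda>t. ip M x \<phi> * \<psi> t) u"
        using that u by (intro ip_cong_AE L2_measurable L2_scale \<psi>) (auto simp: rank_one_def)
      then show ?thesis
        by (simp add: ip_scale_left w_def ip_scale_right cnj_ip)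
    qed
    show ?thesis
    proof
      assume *: "\<forall>(x, y)\<in>rank_one M \<phi> \<psi>. ip M y u = ip M x v"
      have "ip M v x = ip M w x" if "x \<in> L2 M" for x
        using * y[OF rank_oneI[OF that \<psi>]] rank_oneI[OF that \<psi>, of \<phi>]
        by (intro ip_eq_flip[of M x]) auto
      with v w have "AE x in M. v x = w x" by (rule AE_eq_if_ip_eq)
      then show "AE x in M. v x = ip M u \<psi> * \<phi> x" by (simp add: w_def)
    next
      assume *: "AE x in M. v x = ip M u \<psi> * \<phi> x"
      have "ip M x v = ip M x w" if "x \<in> L2 M" for x
      proof -
        have "ip M v x = ip M w x"
          using * v w that by (intro ip_cong_AE L2_measurable) (auto simp: w_def)
        then show ?thesis by (rule ip_eq_flip)
      qed
      with y show "\<forall>(x, y)\<in>rank_one M \<phi> \<psi>. ip M y u = ip M x v"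
        by (auto simp: rank_one_def)
    qed
  qed
  then show ?thesis
    unfolding op_adj_def rank_one_def[of M \<psi> \<phi>] by blast
qed

lemma rank_one_comp:
  assumes \<phi>: "\<phi> \<in> L2 M" and \<psi>: "\<psi> \<in> L2 M"
  shows "rank_one M \<phi> \<psi> O rank_one M \<psi> \<phi> =
    rank_one M \<phi> (\<lambda>x. complex_of_real ((l2norm M \<psi>)\<^sup>2) * \<phi> x)"
proof -
  have ipv: "ip M v \<psi> = ip M u \<phi> * complex_of_real ((l2norm M \<psi>)\<^sup>2)" if "(u, v) \<in> rank_one M \<phi> \<psi>" for u v
  proof -
    have "ip M v \<psi> = ip M (\<lambda>x. ip M u \<phi> * \<psi> x) \<psi>"
      using that by (intro ip_cong_AE L2_measurable L2_scale \<psi>) (auto simp: rank_one_def)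
    then show ?thesis by (simp add: ip_scale_left ip_self)
  qed
  show ?thesis
  proof (intro subset_antisym subsetI)
    fix z assume "z \<in> rank_one M \<phi> \<psi> O rank_one M \<psi> \<phi>"
    then obtain u v w where "z = (u, w)" "(u, v) \<in> rank_one M \<phi> \<psi>" "(v, w) \<in> rank_one M \<psi> \<phi>" by auto
    with ipv[of u v] show "z \<in> rank_one M \<phi> (\<lambda>x. complex_of_real ((l2norm M \<psi>)\<^sup>2) * \<phi> x)"
      by (auto simp: rank_one_def mult.assoc)
  next
    fix z assume z: "z \<in> rank_one M \<phi> (\<lambda>x. complex_of_real ((l2norm M \<psi>)\<^sup>2) * \<phi> x)"
    then obtain u w where uw: "z = (u, w)" "u \<in> L2 M" "w \<in> L2 M" by (auto simp: rank_one_def)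
    have R: "(u, \<lambda>x. ip M u \<phi> * \<psi> x) \<in> rank_one M \<phi> \<psi>" using uw(2) \<psi> by (rule rank_oneI)
    then have "(\<lambda>x. ip M u \<phi> * \<psi> x, w) \<in> rank_one M \<psi> \<phi>"
      using z uw ipv[OF R] by (auto simp: rank_one_def L2_scale \<psi> mult.assoc)
    with R show "z \<in> rank_one M \<phi> \<psi> O rank_one M \<psi> \<phi>" using uw(1) by blast
  qed
qed

text \<open>An orthonormal basis through the unit vector \<open>\<phi>\<close> diagonalises \<open>\<langle>\<cdot>, \<phi>\<rangle> \<lambda>\<phi>\<close>; on the
  eigenvalue \<open>0\<close> of the orthogonal complement the convention \<open>0 powr t = 0\<close> is what is needed.\<close>

lemma op_power_rank_one:
  assumes \<phi>: "\<phi> \<in> L2 M" and n: "l2norm M \<phi> = 1" and l: "0 \<le> l"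
  shows "op_power M (rank_one M \<phi> (\<lambda>x. complex_of_real l * \<phi> x)) t
    (rank_one M \<phi> (\<lambda>x. complex_of_real (l powr t) * \<phi> x))"
proof -
  have "orthonormal M {\<phi>}" using \<phi> n by (simp add: orthonormal_def ip_self)
  then obtain E where E: "onb M E" "{\<phi>} \<subseteq> E" by (rule orthonormal_extends_to_onb)
  define lam where "lam e = (if e = \<phi> then l else 0)" for e
  have *: "(e, \<lambda>x. complex_of_real (h (lam e)) * e x) \<in> rank_one M \<phi> (\<lambda>x. complex_of_real (h l) * \<phi> x)"
    if e: "e \<in> E" and h: "h 0 = 0" for e and h :: "real \<Rightarrow> real"
  proof -
    have eL: "e \<in> L2 M" using E(1) e by (auto simp: onb_def)
    show ?thesis
    proof (cases "e = \<phi>")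
      case True
      then show ?thesis using n \<phi> by (simp add: rank_one_def lam_def ip_self L2_scale)
    next
      case False
      then have "ip M e \<phi> = 0" using E e by (auto simp: onb_def)
      with False eL h show ?thesis by (simp add: rank_one_def lam_def L2_zero)
    qed
  qed
  have "\<forall>e\<in>E. 0 \<le> lam e \<and>
      (e, \<lambda>x. complex_of_real (lam e) * e x) \<in> rank_one M \<phi> (\<lambda>x. complex_of_real l * \<phi> x) \<and>
      (e, \<lambda>x. complex_of_real (lam e powr t) * e x) \<in>
        rank_one M \<phi> (\<lambda>x. complex_of_real (l powr t) * \<phi> x)"
    using *[where h = "\<lambda>x. x"] *[where h = "\<lambda>x. x powr t"] l by (simp add: lam_def)
  with E(1) show ?thesis
    unfolding op_power_def using bounded_opr_rank_one \<phi> L2_scale by blast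
qed

text \<open>Bessel's inequality bounds the trace in whatever basis it is computed.\<close>

lemma pos_trace_rank_one_le:
  assumes \<phi>: "\<phi> \<in> L2 M" and n: "l2norm M \<phi> = 1" and l: "0 \<le> l"
  shows "pos_trace M (rank_one M \<phi> (\<lambda>x. complex_of_real l * \<phi> x)) \<le> ennreal l"
proof -
  let ?T = "rank_one M \<phi> (\<lambda>x. complex_of_real l * \<phi> x)"
  let ?E = "some_onb M"
  have E: "onb M ?E" by (rule onb_some_onb)
  have diag: "Re (ip M (op_app ?T e) e) = l * (cmod (ip M \<phi> e))\<^sup>2" if e: "e \<in> ?E" for e
  proof -
    have eL: "e \<in> L2 M" using E e by (auto simp: onb_def)
    have "(e, op_app ?T e) \<in> ?T"
      unfolding op_app_def by (rule someI[where P = "\<lambda>v. (e, v) \<in> ?T"]) (rule rank_oneI[OF eL L2_scale[OF \<phi>]])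
    then have "ip M (op_app ?T e) e = ip M (\<lambda>x. (ip M e \<phi> * complex_of_real l) * \<phi> x) e"
      using eL \<phi> by (intro ip_cong_AE L2_measurable L2_scale) (auto simp: rank_one_def mult.assoc)
    also have "\<dots> = complex_of_real l * (ip M \<phi> e * cnj (ip M \<phi> e))"
      by (simp only: ip_scale_left cnj_ip) (simp add: ac_simps)
    also have "\<dots> = complex_of_real (l * (cmod (ip M \<phi> e))\<^sup>2)"
      by (simp only: complex_norm_square of_real_mult)
    finally show ?thesis by simp
  qed
  have "pos_trace M ?T = (\<Sum>\<^sub>\<infinity>e\<in>?E. ennreal (l * (cmod (ip M \<phi> e))\<^sup>2))"
    unfolding pos_trace_def by (intro infsum_cong) (simp add: diag)
  also have "\<dots> \<le> ennreal l"
    unfolding nonneg_infsum_complete[OF zero_le]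
  proof (rule SUP_least)
    fix F assume "F \<in> {F. finite F \<and> F \<subseteq> ?E}"
    then have F: "finite F" "F \<subseteq> ?E" by auto
    have "(\<Sum>e\<in>F. (cmod (ip M \<phi> e))\<^sup>2) \<le> (l2norm M \<phi>)\<^sup>2"
      using F E \<phi> by (intro Bessel_inequality) (auto simp: onb_def subset_iff)
    then have "(\<Sum>e\<in>F. l * (cmod (ip M \<phi> e))\<^sup>2) \<le> l"
      using l mult_left_mono[of "\<Sum>e\<in>F. (cmod (ip M \<phi> e))\<^sup>2" 1 l] by (simp add: n sum_distrib_left)
    then show "(\<Sum>e\<in>F. ennreal (l * (cmod (ip M \<phi> e))\<^sup>2)) \<le> ennreal l"
      using l by (subst sum_ennreal) (auto intro: ennreal_leI)
  qed
  finally show ?thesis .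
qed

text \<open>Here \<open>A\<^sup>*A = \<parallel>\<psi>\<parallel>\<^sup>2 \<langle>\<cdot>, \<phi>\<rangle> \<phi>\<close>, so that an explicit power takes part in the infimum that
  defines the Schatten norm.\<close>

lemma schatten_pow_rank_one_le:
  assumes \<phi>: "\<phi> \<in> L2 M" and n: "l2norm M \<phi> = 1" and \<psi>: "\<psi> \<in> L2 M"
    and A: "op_closure M A = rank_one M \<phi> \<psi>"
  shows "schatten_pow M r A \<le> ennreal (((l2norm M \<psi>)\<^sup>2) powr (r / 2))"
proof -
  let ?l = "(l2norm M \<psi>)\<^sup>2"
  let ?T = "rank_one M \<phi> (\<lambda>x. complex_of_real (?l powr (r / 2)) * \<phi> x)"
  have "op_power M (rank_one M \<phi> \<psi> O op_adj M (rank_one M \<phi> \<psi>)) (r / 2) ?T"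
    using op_power_rank_one[OF \<phi> n, of ?l "r / 2"] by (simp add: op_adj_rank_one rank_one_comp \<phi> \<psi>)
  then have "schatten_pow M r A \<le> pos_trace M ?T"
    unfolding schatten_pow_def Let_def A using bounded_opr_rank_one[OF \<phi> \<psi>]
    by (auto intro!: Inf_lower)
  also have "\<dots> \<le> ennreal (?l powr (r / 2))"
    using \<phi> n by (intro pos_trace_rank_one_le) auto
  finally show ?thesis .
qed

section \<open>Half-lines and the affine group as measure spaces\<close>

lemma half_line_borel [measurable]: "half_line \<rho> \<in> sets borel"
  by (cases \<rho>) auto

lemma borel_measurable_HL: "u \<in> borel_measurable borel \<Longrightarrow> u \<in> borel_measurable (HL \<rho>)"
  unfolding HL_def by (intro measurable_restrict_space1) simp

lemma half_line_mult: "0 < a \<Longrightarrow> a * s \<in> half_line \<rho> \<longleftrightarrow> s \<in> half_line \<rho>"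
  by (cases \<rho>) (auto simp: zero_le_mult_iff mult_le_0_iff)

lemma aff_borel [measurable]: "aff \<in> sets borel"
proof -
  have "open aff"
    unfolding aff_def case_prod_unfold by (intro open_Collect_less continuous_intros)
  then show ?thesis by simp
qed

lemma haar_alt: "haar = density (restrict_space lborel aff) (\<lambda>y. ennreal (1 / (snd y)\<^sup>2))"
  by (simp add: haar_def case_prod_unfold)

lemma snd_weight_measurable: "(\<lambda>y::real \<times> real. 1 / (snd y)\<^sup>2) \<in> borel_measurable borel"
  unfolding borel_prod [symmetric] by measurable

lemma haar_weight_measurable:
  "(\<lambda>y::real \<times> real. ennreal (1 / (snd y)\<^sup>2)) \<in> borel_measurable (restrict_space lborel aff)"
  using snd_weight_measurable by (intro measurable_restrict_space1) simp

lemma space_haar: "space haar = aff"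
  by (simp add: haar_alt space_restrict_space)

lemma borel_measurable_haarI:
  assumes "f' \<in> borel_measurable borel" "\<And>y. y \<in> aff \<Longrightarrow> f y = f' y"
  shows "f \<in> borel_measurable haar"
proof -
  have "f' \<in> borel_measurable haar"
    using assms(1) unfolding haar_alt by (simp add: measurable_restrict_space1)
  then show ?thesis
    using assms(2) by (subst measurable_cong[where g = f']) (auto simp: space_haar)
qed

lemma haar_measurable_iff:
  fixes f :: "real \<times> real \<Rightarrow> complex"
  shows "f \<in> borel_measurable haar \<longleftrightarrow> (\<lambda>y. indicator aff y *\<^sub>R f y) \<in> borel_measurable borel"
  unfolding haar_alt by (simp add: borel_measurable_restrict_space_iff)

lemma integral_haar:
  fixes f :: "real \<times> real \<Rightarrow> complex"
  assumes "f \<in> borel_measurable haar"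
  shows "(LINT y|haar. f y) = (LINT y|lborel. (indicator aff y / (snd y)\<^sup>2) *\<^sub>R f y)"
proof -
  have f: "f \<in> borel_measurable (restrict_space lborel aff)"
    using assms by (simp add: haar_alt)
  have "(\<lambda>y::real \<times> real. 1 / (snd y)\<^sup>2) \<in> borel_measurable (restrict_space lborel aff)"
    using snd_weight_measurable by (simp add: measurable_restrict_space1)
  then have "(LINT y|haar. f y) = (LINT y|restrict_space lborel aff. (1 / (snd y)\<^sup>2) *\<^sub>R f y)"
    unfolding haar_alt using f by (subst integral_density) auto
  also have "\<dots> = (LINT y|lborel. indicator aff y *\<^sub>R (1 / (snd y)\<^sup>2) *\<^sub>R f y)"
    by (subst integral_restrict_space) auto
  finally show ?thesis by (simp add: scaleR_scaleR)
qed

lemma AE_haar: "(AE y in haar. P y) \<longleftrightarrow> (AE y in lborel. y \<in> aff \<longrightarrow> P y)"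
proof -
  have "(AE y in haar. P y) \<longleftrightarrow>
      (AE y in restrict_space lborel aff. 0 < ennreal (1 / (snd y)\<^sup>2) \<longrightarrow> P y)"
    unfolding haar_alt by (rule AE_density[OF haar_weight_measurable])
  also have "\<dots> \<longleftrightarrow> (AE y in lborel. y \<in> aff \<longrightarrow> 0 < ennreal (1 / (snd y)\<^sup>2) \<longrightarrow> P y)"
    by (subst AE_restrict_space_iff) auto
  also have "\<dots> \<longleftrightarrow> (AE y in lborel. y \<in> aff \<longrightarrow> P y)"
    by (intro AE_cong) (auto simp: aff_def)
  finally show ?thesis .
qed

lemma emeasure_haar_le:
  assumes "Q \<in> sets borel" "0 < c" "Q \<subseteq> {y. c \<le> snd y}"
  shows "emeasure haar Q \<le> ennreal (1 / c\<^sup>2) * emeasure lborel Q"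
proof -
  have Qaff: "Q \<subseteq> aff" using assms(2,3) by (auto simp: aff_def)
  then have Q: "Q \<in> sets (restrict_space lborel aff)"
    using assms(1) by (auto simp: sets_restrict_space_iff)
  have "emeasure haar Q = (\<integral>\<^sup>+y. ennreal (1 / (snd y)\<^sup>2) * indicator Q y \<partial>restrict_space lborel aff)"
    unfolding haar_alt by (rule emeasure_density[OF haar_weight_measurable Q])
  also have "\<dots> \<le> (\<integral>\<^sup>+y. ennreal (1 / c\<^sup>2) * indicator Q y \<partial>restrict_space lborel aff)"
  proof (rule nn_integral_mono)
    fix y
    have "ennreal (1 / (snd y)\<^sup>2) \<le> ennreal (1 / c\<^sup>2)" if "y \<in> Q"
      using that assms(2,3) by (intro ennreal_leI frac_le power_mono) auto
    then show "ennreal (1 / (snd y)\<^sup>2) * indicator Q y \<le> ennreal (1 / c\<^sup>2) * indicator Q y"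
      by (auto simp: indicator_def)
  qed
  also have "\<dots> = ennreal (1 / c\<^sup>2) * emeasure (restrict_space lborel aff) Q"
    using Q by (rule nn_integral_cmult_indicator)
  also have "emeasure (restrict_space lborel aff) Q = emeasure lborel Q"
    using Qaff by (intro emeasure_restrict_space) auto
  finally show ?thesis .
qed

section \<open>Rank one symbols\<close>

lemma powr_HL_measurable: "(\<lambda>s. complex_of_real (\<bar>s\<bar> powr r)) \<in> borel_measurable (HL \<rho>)"
  by (intro borel_measurable_HL) measurable

text \<open>Truncation to \<open>\<bar>s\<bar> \<le> n\<close> makes multiplication by \<open>\<bar>s\<bar>\<^bsup>r\<^esup>\<close> bounded.\<close>

lemma Domain_K_dense:
  assumes r: "0 \<le> r" and u: "u \<in> L2 (HL \<rho>)"
  shows "\<exists>un. (\<forall>n::nat. un n \<in> Domain (K \<rho> r) \<and> un n \<in> L2 (HL \<rho>)) \<and>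
    (\<lambda>n. l2norm (HL \<rho>) (\<lambda>s. un n s - u s)) \<longlonglongrightarrow> 0"
proof -
  define un where "un n = (\<lambda>s. indicator {s. \<bar>s\<bar> \<le> real n} s * u s)" for n
  have um: "u \<in> borel_measurable (HL \<rho>)" using u by (rule L2_measurable)
  have im: "(\<lambda>s. indicator {s. \<bar>s\<bar> \<le> real n} s :: complex) \<in> borel_measurable (HL \<rho>)" for n
    by (intro borel_measurable_HL) measurable
  have unm: "un n \<in> borel_measurable (HL \<rho>)" for n
    unfolding un_def using um im by (intro borel_measurable_times)
  have un: "un n \<in> L2 (HL \<rho>)" for n
    using u unm by (rule L2_dominated[where C = 1]) (auto simp: un_def indicator_def)
  have "un n \<in> Domain (K \<rho> r)" for n
  proof -
    let ?v = "\<lambda>s. complex_of_real (\<bar>s\<bar> powr r) * un n s"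
    have "?v \<in> L2 (HL \<rho>)"
      using u
    proof (rule L2_dominated[where C = "real n powr r"])
      show "?v \<in> borel_measurable (HL \<rho>)"
        using powr_HL_measurable unm by (intro borel_measurable_times)
      fix s
      have "\<bar>s\<bar> powr r \<le> real n powr r" if "\<bar>s\<bar> \<le> real n"
        using that r by (intro powr_mono2) auto
      then show "cmod (?v s) \<le> real n powr r * cmod (u s)"
        by (auto simp: un_def norm_mult indicator_def intro: mult_right_mono)
    qed
    then have "(un n, ?v) \<in> K \<rho> r" using un by (simp add: K_def)
    then show ?thesis by blast
  qed
  moreover have "(\<lambda>n. l2norm (HL \<rho>) (\<lambda>s. un n s - u s)) \<longlonglongrightarrow> 0"
  proof -
    have "(\<lambda>n. LINT s|HL \<rho>. (cmod (un n s - u s))\<^sup>2) \<longlonglongrightarrow> (LINT s|HL \<rho>. 0)"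
    proof (rule integral_dominated_convergence[where w = "\<lambda>s. (cmod (u s))\<^sup>2"])
      show "(\<lambda>s. (cmod (un n s - u s))\<^sup>2) \<in> borel_measurable (HL \<rho>)" for n
        using unm um by measurable
      show "integrable (HL \<rho>) (\<lambda>s. (cmod (u s))\<^sup>2)" using u by (rule L2_integrable)
      have "(\<lambda>n. (cmod (un n s - u s))\<^sup>2) \<longlonglongrightarrow> 0" for s
      proof (rule tendsto_eventually)
        obtain N :: nat where N: "\<bar>s\<bar> \<le> real N" using real_arch_simple by blast
        then have "\<bar>s\<bar> \<le> real n" if "n \<ge> N" for n using that by linarith
        then show "\<forall>\<^sub>F n in sequentially. (cmod (un n s - u s))\<^sup>2 = 0"
          by (intro eventually_sequentiallyI[of N]) (simp add: un_def)
      qed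
      then show "AE s in HL \<rho>. (\<lambda>n. (cmod (un n s - u s))\<^sup>2) \<longlonglongrightarrow> 0" by simp
      show "AE s in HL \<rho>. norm ((cmod (un n s - u s))\<^sup>2) \<le> (cmod (u s))\<^sup>2" for n
        by (auto simp: un_def indicator_def)
    qed simp
    then show ?thesis
      unfolding l2norm_def using tendsto_real_sqrt by fastforce
  qed
  ultimately show ?thesis using un by blast
qed

lemma schatten_pow_K_rank_one_le:
  assumes "0 \<le> e" "\<phi> \<in> L2 (HL \<rho>)" "l2norm (HL \<rho>) \<phi> = 1" "\<psi> \<in> L2 (HL \<rho>)"
  shows "schatten_pow (HL \<rho>) r {(u, v). u \<in> Domain (K \<rho> e) \<and> (u, v) \<in> rank_one (HL \<rho>) \<phi> \<psi>}
    \<le> ennreal (((l2norm (HL \<rho>) \<psi>)\<^sup>2) powr (r / 2))"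
proof (rule schatten_pow_rank_one_le)
  show "op_closure (HL \<rho>) {(u, v). u \<in> Domain (K \<rho> e) \<and> (u, v) \<in> rank_one (HL \<rho>) \<phi> \<psi>} =
      rank_one (HL \<rho>) \<phi> \<psi>"
    using Domain_K_dense[OF assms(1)] by (rule op_closure_rank_one[OF assms(2,4)])
qed (use assms in auto)

text \<open>Multiplying the analysing vector by \<open>|s|\<^bsup>e\<^esup>\<close> absorbs the Duflo-Moore factor: \<open>\<langle>K\<^bsup>e\<^esup>u, \<phi>'\<rangle> = \<langle>u, K\<^bsup>e\<^esup>\<phi>'\<rangle>\<close>.\<close>

lemma K_comp_rank_one:
  assumes \<phi>: "\<phi> \<in> L2 (HL \<rho>)" "\<phi>' \<in> L2 (HL \<rho>)"
    and eq: "\<And>s. \<phi> s = complex_of_real (\<bar>s\<bar> powr e) * \<phi>' s"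
  shows "K \<rho> e O rank_one (HL \<rho>) \<phi>' \<psi> =
    {(u, v). u \<in> Domain (K \<rho> e) \<and> (u, v) \<in> rank_one (HL \<rho>) \<phi> \<psi>}"
proof -
  have *: "ip (HL \<rho>) w \<phi>' = ip (HL \<rho>) u \<phi>" if "(u, w) \<in> K \<rho> e" for u w
  proof -
    have u: "u \<in> borel_measurable (HL \<rho>)" using that by (auto simp: K_def L2_measurable)
    have "ip (HL \<rho>) w \<phi>' = ip (HL \<rho>) (\<lambda>s. complex_of_real (\<bar>s\<bar> powr e) * u s) \<phi>'"
      using that \<phi>(2) powr_HL_measurable u
      by (intro ip_cong_AE borel_measurable_times) (auto simp: K_def L2_measurable)
    also have "\<dots> = ip (HL \<rho>) u \<phi>"
      by (simp add: ip_def eq ac_simps)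
    finally show ?thesis .
  qed
  show ?thesis
  proof (intro subset_antisym subsetI)
    fix z assume "z \<in> K \<rho> e O rank_one (HL \<rho>) \<phi>' \<psi>"
    then obtain u w v where "z = (u, v)" "(u, w) \<in> K \<rho> e" "(w, v) \<in> rank_one (HL \<rho>) \<phi>' \<psi>" by auto
    with *[of u w] show "z \<in> {(u, v). u \<in> Domain (K \<rho> e) \<and> (u, v) \<in> rank_one (HL \<rho>) \<phi> \<psi>}"
      by (auto simp: rank_one_def K_def)
  next
    fix z assume "z \<in> {(u, v). u \<in> Domain (K \<rho> e) \<and> (u, v) \<in> rank_one (HL \<rho>) \<phi> \<psi>}"
    then obtain u w v where z: "z = (u, v)" and w: "(u, w) \<in> K \<rho> e" and v: "(u, v) \<in> rank_one (HL \<rho>) \<phi> \<psi>"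
      by auto
    have "(w, v) \<in> rank_one (HL \<rho>) \<phi>' \<psi>"
      using v w *[OF w] by (auto simp: rank_one_def K_def)
    with w show "z \<in> K \<rho> e O rank_one (HL \<rho>) \<phi>' \<psi>" unfolding z by blast
  qed
qed

text \<open>The field is constant on \<open>Q\<close> and vanishes elsewhere, so its norm is controlled by
  the Schatten norms of two rank one operators and the measure of \<open>Q\<close>. The vector \<open>\<phi>'\<close> carries the
  inverse Duflo-Moore factor, which makes \<open>\<sigma> K\<^bsup>1/p\<^esup>\<close> bounded.\<close>

lemma rank_one_field_in_Lp_op:
  fixes \<phi> \<phi>' \<psi> :: "dual \<Rightarrow> real \<Rightarrow> complex"
  assumes p: "0 < p" and \<phi>: "\<And>\<rho>. \<phi> \<rho> \<in> L2 (HL \<rho>)" "\<And>\<rho>. \<phi>' \<rho> \<in> L2 (HL \<rho>)"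
    and n: "\<And>\<rho>. l2norm (HL \<rho>) (\<phi> \<rho>) = 1"
    and eq: "\<And>\<rho> s. \<phi> \<rho> s = complex_of_real (\<bar>s\<bar> powr (1 / p)) * \<phi>' \<rho> s"
    and \<psi>: "\<And>\<rho>. \<psi> \<rho> \<in> L2 (HL \<rho>)"
    and Q: "Q \<in> sets borel" "Q \<subseteq> aff" "emeasure haar Q < \<infinity>"
  shows "(\<lambda>x \<rho>. rank_one (HL \<rho>) (\<phi>' \<rho>) (\<lambda>s. indicator Q x * \<psi> \<rho> s)) \<in> Lp_op p" (is "?\<sigma> \<in> _")
proof -
  have \<psi>Q: "(\<lambda>s. indicator Q x * \<psi> \<rho> s) \<in> L2 (HL \<rho>)" for x \<rho> by (intro L2_scale \<psi>)
  have b: "bounded_opr (HL \<rho>) (?\<sigma> x \<rho>)" for x \<rho> by (intro bounded_opr_rank_one \<phi> \<psi>Q)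
  have comp: "K \<rho> (1 / p) O ?\<sigma> x \<rho> =
      {(u, v). u \<in> Domain (K \<rho> (1 / p)) \<and>
        (u, v) \<in> rank_one (HL \<rho>) (\<phi> \<rho>) (\<lambda>s. indicator Q x * \<psi> \<rho> s)}" for x \<rho>
    using \<phi> eq by (intro K_comp_rank_one)
  have "op_field p ?\<sigma>"
    unfolding op_field_def
  proof (intro conjI allI ballI)
    fix \<rho> x
    show "linear_opr (HL \<rho>) (?\<sigma> x \<rho>)" using b by (simp add: bounded_opr_def)
    have "Domain (?\<sigma> x \<rho>) = L2 (HL \<rho>)" using b by (simp add: bounded_opr_def)
    then show "Range (K \<rho> (1 / p)) \<subseteq> Domain (?\<sigma> x \<rho>)" by (auto simp: K_def)
    have "norm_bounded (HL \<rho>) (rank_one (HL \<rho>) (\<phi> \<rho>) (\<lambda>s. indicator Q x * \<psi> \<rho> s))"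
      using bounded_opr_rank_one[OF \<phi>(1) \<psi>Q] by (simp add: bounded_opr_def)
    then show "norm_bounded (HL \<rho>) (K \<rho> (1 / p) O ?\<sigma> x \<rho>)"
      unfolding comp norm_bounded_def by blast
  next
    fix \<rho> u v assume u: "u \<in> Range (K \<rho> (1 / p))" and v: "v \<in> L2 (HL \<rho>)"
    have uL: "u \<in> L2 (HL \<rho>)" using u by (auto simp: K_def)
    have "ip (HL \<rho>) (op_app (?\<sigma> x \<rho>) u) v =
        indicator Q x * (ip (HL \<rho>) u (\<phi>' \<rho>) * ip (HL \<rho>) (\<psi> \<rho>) v)" for x
    proof -
      have "(u, op_app (?\<sigma> x \<rho>) u) \<in> ?\<sigma> x \<rho>"
        unfolding op_app_def
        by (rule someI[where P = "\<lambda>v. (u, v) \<in> ?\<sigma> x \<rho>"]) (rule rank_oneI[OF uL \<psi>Q])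
      then have "ip (HL \<rho>) (op_app (?\<sigma> x \<rho>) u) v =
          ip (HL \<rho>) (\<lambda>s. (ip (HL \<rho>) u (\<phi>' \<rho>) * indicator Q x) * \<psi> \<rho> s) v"
        using v \<psi> by (intro ip_cong_AE L2_measurable L2_scale) (auto simp: rank_one_def mult.assoc)
      then show ?thesis by (simp only: ip_scale_left) (simp add: ac_simps)
    qed
    then show "(\<lambda>x. ip (HL \<rho>) (op_app (?\<sigma> x \<rho>) u) v) \<in> borel_measurable haar"
      using Q(1) by (intro borel_measurable_haarI[where f' =
        "\<lambda>x. indicator Q x * (ip (HL \<rho>) u (\<phi>' \<rho>) * ip (HL \<rho>) (\<psi> \<rho>) v)"]) auto
  qed
  moreover have "Lp_norm_pow p ?\<sigma> < \<infinity>"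
  proof -
    have "(\<integral>\<^sup>+x. schatten_pow (HL \<rho>) p (K \<rho> (1 / p) O ?\<sigma> x \<rho>) \<partial>haar) < \<infinity>" for \<rho>
    proof -
      let ?c = "ennreal (((l2norm (HL \<rho>) (\<psi> \<rho>))\<^sup>2) powr (p / 2))"
      have "(\<integral>\<^sup>+x. schatten_pow (HL \<rho>) p (K \<rho> (1 / p) O ?\<sigma> x \<rho>) \<partial>haar)
          \<le> (\<integral>\<^sup>+x. ?c * indicator Q x \<partial>haar)"
      proof (rule nn_integral_mono)
        fix x
        have "schatten_pow (HL \<rho>) p (K \<rho> (1 / p) O ?\<sigma> x \<rho>)
            \<le> ennreal (((l2norm (HL \<rho>) (\<lambda>s. indicator Q x * \<psi> \<rho> s))\<^sup>2) powr (p / 2))"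
          unfolding comp using p by (intro schatten_pow_K_rank_one_le \<phi> n \<psi>Q) auto
        also have "\<dots> = ?c * indicator Q x"
          by (cases "x \<in> Q") (auto simp: l2norm_zero)
        finally show "schatten_pow (HL \<rho>) p (K \<rho> (1 / p) O ?\<sigma> x \<rho>) \<le> ?c * indicator Q x" .
      qed
      also have "\<dots> = ?c * emeasure haar Q"
        using Q(1,2) by (intro nn_integral_cmult_indicator) (auto simp: haar_alt sets_restrict_space_iff)
      also have "\<dots> < \<infinity>" using Q(3) by (simp add: ennreal_mult_less_top)
      finally show ?thesis .
    qed
    then show ?thesis unfolding Lp_norm_pow_def by simp
  qed
  ultimately show ?thesis by (simp add: Lp_op_def)
qed

section \<open>The integrated representation as an integral operator\<close>

text \<open>Extension by zero to the whole line, which turns integrals over a half-line into integrals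
  over \<open>\<real>\<close>.\<close>

definition ext :: "dual \<Rightarrow> (real \<Rightarrow> complex) \<Rightarrow> real \<Rightarrow> complex" where
  "ext \<rho> u s = indicator (half_line \<rho>) s *\<^sub>R u s"

lemma ext_measurable: "u \<in> borel_measurable (HL \<rho>) \<longleftrightarrow> ext \<rho> u \<in> borel_measurable borel"
  unfolding HL_def ext_def [abs_def] by (simp add: borel_measurable_restrict_space_iff)

lemma nn_integral_ext:
  "(\<integral>\<^sup>+s. ennreal ((cmod (u s))\<^sup>2) \<partial>HL \<rho>) = (\<integral>\<^sup>+s. ennreal ((cmod (ext \<rho> u s))\<^sup>2) \<partial>lborel)"
  unfolding HL_def by (subst nn_integral_restrict_space)
    (auto simp: ext_def indicator_def intro!: nn_integral_cong)

lemma ip_ext: "ip (HL \<rho>) u v = (LINT s|lborel. ext \<rho> u s * cnj (ext \<rho> v s))"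
  unfolding ip_def HL_def by (subst integral_restrict_space)
    (auto simp: ext_def indicator_def intro!: Bochner_Integration.integral_cong)

lemma nn_integral_ext_l2norm:
  "u \<in> L2 (HL \<rho>) \<Longrightarrow>
    (\<integral>\<^sup>+s. ennreal ((cmod (ext \<rho> u s))\<^sup>2) \<partial>lborel) = ennreal ((l2norm (HL \<rho>) u)\<^sup>2)"
  by (simp add: nn_integral_l2norm flip: nn_integral_ext)

lemma ext_rep:
  "0 < a \<Longrightarrow> ext \<rho> (rep (b, a) u) s =
    complex_of_real (a powr (1/2)) * exp (- \<i> * complex_of_real (b * s)) * ext \<rho> u (a * s)"
  by (simp add: ext_def rep_def half_line_mult indicator_def)

text \<open>A Borel measurable version, on all of \<open>\<real>\<^sup>2\<close>, of the matrix coefficient \<open>\<langle>\<rho>(y) u, h\<rangle>\<close>.\<close>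

definition matrix_coeff :: "dual \<Rightarrow> (real \<Rightarrow> complex) \<Rightarrow> (real \<Rightarrow> complex) \<Rightarrow> real \<times> real \<Rightarrow> complex" where
  "matrix_coeff \<rho> u h y = (LINT s|lborel. complex_of_real (snd y powr (1/2)) *
      exp (- \<i> * complex_of_real (fst y * s)) * ext \<rho> u (snd y * s) * cnj (ext \<rho> h s))"

lemma ip_rep: "y \<in> aff \<Longrightarrow> ip (HL \<rho>) (rep y u) h = matrix_coeff \<rho> u h y"
  by (cases y) (simp add: ip_ext matrix_coeff_def ext_rep aff_def)

lemma matrix_coeff_measurable:
  assumes "u \<in> L2 (HL \<rho>)" "h \<in> L2 (HL \<rho>)"
  shows "matrix_coeff \<rho> u h \<in> borel_measurable (borel \<Otimes>\<^sub>M borel)"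
proof -
  have [measurable]: "ext \<rho> u \<in> borel_measurable borel" "ext \<rho> h \<in> borel_measurable borel"
    using assms ext_measurable L2_measurable by blast+
  have [measurable]: "cnj \<in> borel_measurable borel"
    by (intro borel_measurable_continuous_onI continuous_intros)
  show ?thesis unfolding matrix_coeff_def [abs_def] by measurable
qed

text \<open>Fixing \<open>x\<close>, the Wigner transform at \<open>x\<close> is \<open>\<integral> k(y) \<rho>(y) d\<mu>(y)\<close> with \<open>k(y) = f(y) g(y\<inverse>x)\<close>.
  Everything in this section only uses that \<open>k\<close> is bounded, with support in a box.\<close>

locale box_kernel =
  fixes k :: "real \<times> real \<Rightarrow> complex" and R a0 a1 C :: real
  assumes k_measurable [measurable]: "k \<in> borel_measurable (borel \<Otimes>\<^sub>M borel)"
    and k_bound: "cmod (k y) \<le> C"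
    and k_supp: "k (b, a) \<noteq> 0 \<Longrightarrow> \<bar>b\<bar> \<le> R \<and> a0 \<le> a \<and> a \<le> a1"
    and a0: "0 < a0" "a0 \<le> a1" and R: "0 < R"
begin

lemma C_nonneg: "0 \<le> C"
  using k_bound[of undefined] norm_ge_zero order_trans by blast

text \<open>The partial Fourier transform of \<open>k\<close> in its first variable.\<close>

definition ft :: "real \<Rightarrow> real \<Rightarrow> complex" where
  "ft s a = (LINT b|lborel. k (b, a) * exp (- \<i> * complex_of_real (b * s)))"

text \<open>The factor \<open>a\<^bsup>1/2\<^esup>\<close> of the representation times the density \<open>a\<^bsup>-2\<^esup>\<close> of Haar measure.\<close>

definition weight :: "real \<Rightarrow> real" where
  "weight a = a powr (1/2) / a\<^sup>2"

text \<open>Carrying out the integral over \<open>b\<close> first, \<open>\<integral> k(y) \<rho>(y) d\<mu>(y)\<close> becomes this integral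
  operator on the half-line.\<close>

definition int_op :: "dual \<Rightarrow> (real \<Rightarrow> complex) \<Rightarrow> real \<Rightarrow> complex" where
  "int_op \<rho> u s = (LINT a|lborel. complex_of_real (weight a) * ext \<rho> u (a * s) * ft s a)"

text \<open>The integrand of \<open>\<integral> k(y) \<langle>\<rho>(y) u, h\<rangle> d\<mu>(y)\<close> as a function of \<open>y\<close> and the variable \<open>s\<close> of the inner
  product, with respect to Lebesgue measure. Its double integral, computed in the two possible
  orders, gives the weak integral of the representation and the integral operator above.\<close>

definition int_density :: "dual \<Rightarrow> (real \<Rightarrow> complex) \<Rightarrow> (real \<Rightarrow> complex) \<Rightarrow> real \<times> real \<Rightarrow> real \<Rightarrow> complex" where
  "int_density \<rho> u h = (\<lambda>(b, a) s. k (b, a) * (complex_of_real (weight a) *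
     exp (- \<i> * complex_of_real (b * s)) * ext \<rho> u (a * s)) * cnj (ext \<rho> h s))"

definition int_form :: "dual \<Rightarrow> (real \<Rightarrow> complex) \<Rightarrow> (real \<Rightarrow> complex) \<Rightarrow> complex" where
  "int_form \<rho> u h = (LINT z|(lborel \<Otimes>\<^sub>M lborel). int_density \<rho> u h (fst z) (snd z))"

lemma weight_measurable [measurable]: "weight \<in> borel_measurable borel"
  unfolding weight_def [abs_def] by measurable

lemma weight_nonneg: "0 \<le> weight a"
  by (simp add: weight_def)

lemma ft_measurable [measurable (raw)]:
  assumes [measurable]: "p \<in> borel_measurable N" "q \<in> borel_measurable N"
  shows "(\<lambda>x. ft (p x) (q x)) \<in> borel_measurable N"
  unfolding ft_def by measurable

lemma ft_zero: "\<not> (a0 \<le> a \<and> a \<le> a1) \<Longrightarrow> ft s a = 0"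
proof -
  assume "\<not> (a0 \<le> a \<and> a \<le> a1)"
  then have "k (b, a) = 0" for b using k_supp[of b a] by blast
  then show ?thesis by (simp add: ft_def)
qed

lemma box_integrable: "integrable lborel (\<lambda>b. C * indicator {-R..R} b)"
  by (intro integrable_mult_right integrable_real_indicator) (auto simp: emeasure_lborel_Icc_eq)

lemma k_integrable: "integrable lborel (\<lambda>b. k (b, a) * exp (- \<i> * complex_of_real (b * s)))"
proof (rule Bochner_Integration.integrable_bound)
  show "integrable lborel (\<lambda>b. C * indicator {-R..R} b)" by (rule box_integrable)
  show "(\<lambda>b. k (b, a) * exp (- \<i> * complex_of_real (b * s))) \<in> borel_measurable lborel" by measurable
  have "cmod (k (b, a) * exp (- \<i> * complex_of_real (b * s))) \<le> C * indicator {-R..R} b" for b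
    using k_bound[of "(b, a)"] k_supp[of b a] by (cases "k (b, a) = 0") (auto simp: norm_mult C_nonneg indicator_def)
  then show "AE b in lborel. norm (k (b, a) * exp (- \<i> * complex_of_real (b * s))) \<le> norm (C * indicator {-R..R} b)"
    by (auto simp: C_nonneg)
qed

lemma ft_bound: "cmod (ft s a) \<le> 2 * R * C"
proof -
  have "cmod (ft s a) \<le> (LINT b|lborel. cmod (k (b, a) * exp (- \<i> * complex_of_real (b * s))))"
    unfolding ft_def by (rule integral_norm_bound)
  also have "\<dots> \<le> (LINT b|lborel. C * indicator {-R..R} b)"
  proof (rule integral_mono)
    show "integrable lborel (\<lambda>b. cmod (k (b, a) * exp (- \<i> * complex_of_real (b * s))))"
      using k_integrable by (rule integrable_norm)
    show "integrable lborel (\<lambda>b. C * indicator {-R..R} b)" by (rule box_integrable)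
    show "cmod (k (b, a) * exp (- \<i> * complex_of_real (b * s))) \<le> C * indicator {-R..R} b" for b
      using k_bound[of "(b, a)"] k_supp[of b a]
      by (cases "k (b, a) = 0") (auto simp: norm_mult C_nonneg indicator_def)
  qed
  also have "\<dots> = 2 * R * C" using R by simp
  finally show ?thesis .
qed

lemma nn_integral_dilate:
  assumes "u \<in> L2 (HL \<rho>)" "c \<noteq> 0"
  shows "(\<integral>\<^sup>+s. ennreal (\<bar>c\<bar> * (cmod (ext \<rho> u (c * s)))\<^sup>2) \<partial>lborel) = ennreal ((l2norm (HL \<rho>) u)\<^sup>2)"
proof -
  have [measurable]: "ext \<rho> u \<in> borel_measurable borel"
    using assms(1) ext_measurable L2_measurable by blast
  show ?thesis
    unfolding nn_integral_ext_l2norm[OF assms(1), symmetric]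
    using nn_integral_real_affine[of "\<lambda>s. ennreal ((cmod (ext \<rho> u s))\<^sup>2)" c 0] assms(2)
    by (simp add: ennreal_mult nn_integral_cmult)
qed

lemma int_density_measurable:
  assumes "u \<in> L2 (HL \<rho>)" "h \<in> L2 (HL \<rho>)"
  shows "(\<lambda>z. int_density \<rho> u h (fst z) (snd z)) \<in> borel_measurable (lborel \<Otimes>\<^sub>M lborel)"
proof -
  have [measurable]: "ext \<rho> u \<in> borel_measurable borel" "ext \<rho> h \<in> borel_measurable borel"
    using assms ext_measurable L2_measurable by blast+
  have [measurable]: "cnj \<in> borel_measurable borel"
    by (intro borel_measurable_continuous_onI continuous_intros)
  have "(\<lambda>z. int_density \<rho> u h (fst z) (snd z)) \<in> borel_measurable ((borel \<Otimes>\<^sub>M borel) \<Otimes>\<^sub>M borel)"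
    unfolding int_density_def case_prod_unfold prod.collapse by measurable
  then show ?thesis
    by (simp add: borel_prod lborel_prod)
qed

text \<open>The elementary bound \<open>2pq \<le> p\<^sup>2 + q\<^sup>2\<close> estimates the inner integral over \<open>s\<close> uniformly in \<open>y\<close>
  in the box, because dilations preserve the norm up to the factor \<open>a\<^bsup>1/2\<^esup>\<close> of the
  representation.\<close>

lemma int_density_integrable:
  assumes u: "u \<in> L2 (HL \<rho>)" and h: "h \<in> L2 (HL \<rho>)"
  shows "integrable (lborel \<Otimes>\<^sub>M lborel) (\<lambda>z. int_density \<rho> u h (fst z) (snd z))"
proof (rule integrableI_bounded)
  show m: "(\<lambda>z. int_density \<rho> u h (fst z) (snd z)) \<in> borel_measurable (lborel \<Otimes>\<^sub>M lborel)"
    using assms by (rule int_density_measurable)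
  let ?N = "ennreal (C / a0\<^sup>2) * ennreal ((l2norm (HL \<rho>) u)\<^sup>2 + (l2norm (HL \<rho>) h)\<^sup>2)"
  let ?B = "cbox (-R, a0) (R, a1)"
  have hm[measurable]: "ext \<rho> h \<in> borel_measurable borel" "ext \<rho> u \<in> borel_measurable borel"
    using u h ext_measurable L2_measurable by blast+
  have le: "(\<integral>\<^sup>+s. norm (int_density \<rho> u h y s) \<partial>lborel) \<le> ?N * indicator ?B y" for y
  proof (cases "k y = 0")
    case True
    then show ?thesis by (simp add: int_density_def case_prod_unfold)
  next
    case False
    obtain b a where y: "y = (b, a)" by (cases y)
    have ba: "\<bar>b\<bar> \<le> R" "a0 \<le> a" "a \<le> a1" using k_supp[of b a] False y by auto
    then have a: "0 < a" using a0 by simp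
    have "norm (int_density \<rho> u h y s) \<le> C / a0\<^sup>2 * (\<bar>a\<bar> * (cmod (ext \<rho> u (a * s)))\<^sup>2 + (cmod (ext \<rho> h s))\<^sup>2)" for s
    proof -
      let ?p = "sqrt a * cmod (ext \<rho> u (a * s))" and ?q = "cmod (ext \<rho> h s)"
      have "?p * ?q \<le> 2 * ?p * ?q" using a by simp
      also have "\<dots> \<le> ?p\<^sup>2 + ?q\<^sup>2" by (rule sum_squares_bound)
      finally have pq: "?p * ?q \<le> \<bar>a\<bar> * (cmod (ext \<rho> u (a * s)))\<^sup>2 + ?q\<^sup>2"
        using a by (simp add: power_mult_distrib)
      have "norm (int_density \<rho> u h y s) = (cmod (k y) / a\<^sup>2) * (?p * ?q)"
        using a by (simp add: int_density_def y norm_mult norm_divide norm_power weight_def powr_half_sqrt)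
      also have "\<dots> \<le> (C / a0\<^sup>2) * (\<bar>a\<bar> * (cmod (ext \<rho> u (a * s)))\<^sup>2 + ?q\<^sup>2)"
        using pq ba a0 a k_bound[of y] by (intro mult_mono frac_le power_mono) (auto simp: C_nonneg)
      finally show ?thesis .
    qed
    then have "(\<integral>\<^sup>+s. norm (int_density \<rho> u h y s) \<partial>lborel) \<le>
        (\<integral>\<^sup>+s. ennreal (C / a0\<^sup>2) * (ennreal (\<bar>a\<bar> * (cmod (ext \<rho> u (a * s)))\<^sup>2) + ennreal ((cmod (ext \<rho> h s))\<^sup>2)) \<partial>lborel)"
      using C_nonneg by (intro nn_integral_mono) (simp flip: ennreal_plus ennreal_mult)
    also have "\<dots> = ?N"
      using a nn_integral_dilate[OF u, of a] nn_integral_ext_l2norm[OF h]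
      by (simp add: nn_integral_cmult nn_integral_add)
    moreover have "y \<in> ?B" using ba y by (auto simp: abs_le_iff)
    ultimately show ?thesis by simp
  qed
  have "(\<integral>\<^sup>+z. norm (int_density \<rho> u h (fst z) (snd z)) \<partial>(lborel \<Otimes>\<^sub>M lborel)) =
      (\<integral>\<^sup>+y. \<integral>\<^sup>+s. norm (int_density \<rho> u h y s) \<partial>lborel \<partial>lborel)"
    using m by (subst lborel.nn_integral_fst [symmetric]) auto
  also have "\<dots> \<le> (\<integral>\<^sup>+y. ?N * indicator ?B y \<partial>lborel)"
    by (intro nn_integral_mono le)
  also have "\<dots> = ?N * emeasure lborel ?B" by (rule nn_integral_cmult_indicator) simp
  also have "\<dots> < \<infinity>"
    using emeasure_lborel_cbox_finite[of "(-R, a0)" "(R, a1)"]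
    by (auto simp: ennreal_mult_less_top)
  finally show "(\<integral>\<^sup>+z. norm (int_density \<rho> u h (fst z) (snd z)) \<partial>(lborel \<Otimes>\<^sub>M lborel)) < \<infinity>" .
qed

lemma int_form_add:
  assumes "u \<in> L2 (HL \<rho>)" "u' \<in> L2 (HL \<rho>)" "h \<in> L2 (HL \<rho>)"
  shows "int_form \<rho> (\<lambda>s. u s + u' s) h = int_form \<rho> u h + int_form \<rho> u' h"
proof -
  have "int_density \<rho> (\<lambda>s. u s + u' s) h y s = int_density \<rho> u h y s + int_density \<rho> u' h y s" for y s
    by (simp add: int_density_def ext_def case_prod_unfold algebra_simps)
  then show ?thesis
    unfolding int_form_def using assms by (simp add: int_density_integrable)
qed

lemma int_form_scale: "int_form \<rho> (\<lambda>s. c * u s) h = c * int_form \<rho> u h"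
proof -
  have "int_density \<rho> (\<lambda>s. c * u s) h y s = c * int_density \<rho> u h y s" for y s
    by (simp add: int_density_def ext_def case_prod_unfold algebra_simps)
  then show ?thesis unfolding int_form_def by simp
qed

lemma integral_haar_rep:
  assumes u: "u \<in> L2 (HL \<rho>)" and h: "h \<in> L2 (HL \<rho>)"
  shows "(LINT y|haar. k y * ip (HL \<rho>) (rep y u) h) = int_form \<rho> u h"
proof -
  have [measurable]: "ext \<rho> u \<in> borel_measurable borel" "ext \<rho> h \<in> borel_measurable borel"
    using u h ext_measurable L2_measurable by blast+
  have [measurable]: "cnj \<in> borel_measurable borel"
    by (intro borel_measurable_continuous_onI continuous_intros)
  define q where "q = matrix_coeff \<rho> u h"
  note q = ip_rep [of _ \<rho> u h, folded q_def]
  have "q \<in> borel_measurable (borel \<Otimes>\<^sub>M borel)"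
    unfolding q_def using u h by (rule matrix_coeff_measurable)
  then have "(\<lambda>y. k y * q y) \<in> borel_measurable (borel \<Otimes>\<^sub>M borel)" by measurable
  then have "(\<lambda>y. k y * ip (HL \<rho>) (rep y u) h) \<in> borel_measurable haar"
    by (intro borel_measurable_haarI[where f' = "\<lambda>y. k y * q y"]) (simp_all add: borel_prod q)
  then have "(LINT y|haar. k y * ip (HL \<rho>) (rep y u) h) =
      (LINT y|lborel. (indicator aff y / (snd y)\<^sup>2) *\<^sub>R (k y * ip (HL \<rho>) (rep y u) h))"
    by (rule integral_haar)
  also have "\<dots> = (LINT y|lborel. (LINT s|lborel. int_density \<rho> u h y s))"
  proof (rule Bochner_Integration.integral_cong[OF refl])
    fix y :: "real \<times> real"
    obtain b a where y: "y = (b, a)" by (cases y)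
    show "(indicator aff y / (snd y)\<^sup>2) *\<^sub>R (k y * ip (HL \<rho>) (rep y u) h) = (LINT s|lborel. int_density \<rho> u h y s)"
    proof (cases "k y = 0")
      case True
      then show ?thesis by (simp add: int_density_def y)
    next
      case False
      then have a: "0 < a" using k_supp[of b a] a0 y by auto
      then have "(indicator aff y / (snd y)\<^sup>2) *\<^sub>R (k y * ip (HL \<rho>) (rep y u) h) =
          (k y * complex_of_real (1 / a\<^sup>2)) * q y"
        using q[of y] by (simp add: y aff_def scaleR_conv_of_real)
      also have "\<dots> = (LINT s|lborel. int_density \<rho> u h y s)"
        unfolding q_def matrix_coeff_def integral_mult_right_zero[symmetric]
        by (intro Bochner_Integration.integral_cong refl) (simp add: int_density_def y weight_def)
      finally show ?thesis .
    qed
  qed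
  also have "\<dots> = int_form \<rho> u h"
    unfolding int_form_def using lborel_pair.integral_fst'[OF int_density_integrable[OF u h]] by simp
  finally show ?thesis .
qed

lemma int_form_eq_integral_int_op:
  assumes u: "u \<in> L2 (HL \<rho>)" and h: "h \<in> L2 (HL \<rho>)"
  shows "int_form \<rho> u h = (LINT s|lborel. int_op \<rho> u s * cnj (ext \<rho> h s))"
proof -
  have [measurable]: "ext \<rho> u \<in> borel_measurable borel" "ext \<rho> h \<in> borel_measurable borel"
    using u h ext_measurable L2_measurable by blast+
  have [measurable]: "cnj \<in> borel_measurable borel"
    by (intro borel_measurable_continuous_onI continuous_intros)
  have int: "integrable (lborel \<Otimes>\<^sub>M lborel) (case_prod (int_density \<rho> u h))"
    using int_density_integrable[OF u h] by (simp add: case_prod_unfold)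
  have "int_form \<rho> u h = (LINT s|lborel. (LINT y|lborel. int_density \<rho> u h y s))"
    unfolding int_form_def using lborel_pair.integral_snd[OF int] by (simp add: case_prod_unfold)
  also have "\<dots> = (LINT s|lborel. int_op \<rho> u s * cnj (ext \<rho> h s))"
  proof (rule integral_cong_AE)
    have m1: "(\<lambda>z. int_density \<rho> u h (snd z) (fst z)) \<in> borel_measurable (borel \<Otimes>\<^sub>M lborel)"
      using measurable_compose[OF measurable_pair_swap' int_density_measurable[OF u h]]
      by (simp add: case_prod_unfold cong: measurable_cong_sets)
    show "(\<lambda>s. LINT y|lborel. int_density \<rho> u h y s) \<in> borel_measurable lborel"
      using lborel.borel_measurable_lebesgue_integral[of "\<lambda>s y. int_density \<rho> u h y s" borel] m1
      by (simp add: case_prod_unfold)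
    show "(\<lambda>s. int_op \<rho> u s * cnj (ext \<rho> h s)) \<in> borel_measurable lborel"
      unfolding int_op_def by measurable
    have "AE s in lborel. integrable lborel (\<lambda>y. int_density \<rho> u h y s)"
      using lborel_pair.AE_integrable_snd[OF int] .
    then show "AE s in lborel. (LINT y|lborel. int_density \<rho> u h y s) = int_op \<rho> u s * cnj (ext \<rho> h s)"
    proof eventually_elim
      case (elim s)
      then have i: "integrable (lborel \<Otimes>\<^sub>M lborel) (case_prod (\<lambda>b a. int_density \<rho> u h (b, a) s))"
        by (simp add: lborel_prod case_prod_unfold)
      have "(LINT y|lborel. int_density \<rho> u h y s) = (LINT a|lborel. (LINT b|lborel. int_density \<rho> u h (b, a) s))"
        unfolding lborel_pair.integral_snd[OF i] by (simp add: lborel_prod case_prod_unfold)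
      also have "\<dots> = (LINT a|lborel. (complex_of_real (weight a) * ext \<rho> u (a * s) * ft s a) * cnj (ext \<rho> h s))"
      proof (rule Bochner_Integration.integral_cong[OF refl])
        fix a
        have "(LINT b|lborel. int_density \<rho> u h (b, a) s) = (LINT b|lborel.
            (complex_of_real (weight a) * ext \<rho> u (a * s) * cnj (ext \<rho> h s)) *
            (k (b, a) * exp (- \<i> * complex_of_real (b * s))))"
          by (intro Bochner_Integration.integral_cong refl) (simp add: int_density_def ac_simps)
        then show "(LINT b|lborel. int_density \<rho> u h (b, a) s) =
            (complex_of_real (weight a) * ext \<rho> u (a * s) * ft s a) * cnj (ext \<rho> h s)"
          by (simp add: ft_def)
      qed
      finally show ?case by (simp add: int_op_def)
    qed
  qed
  finally show ?thesis .
qed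

end

section \<open>Plancherel's inequality\<close>

lemma integral_exp_period:
  assumes R: "0 < R" and l: "l \<noteq> (0::int)"
  shows "(LINT b|lborel. indicator {-R..R} b *\<^sub>R exp (\<i> * complex_of_real (l * pi / R * b))) = 0"
proof -
  define z where "z = \<i> * complex_of_real (l * pi / R)"
  have z: "z \<noteq> 0" using R l by (simp add: z_def)
  have "(LINT b|lborel. indicator {-R..R} b *\<^sub>R exp (z * complex_of_real b)) =
      exp (z * complex_of_real R) / z - exp (z * complex_of_real (-R)) / z"
  proof (rule has_bochner_integral_integral_eq, rule has_bochner_integral_FTC_Icc)
    fix b :: real assume "-R \<le> b" "b \<le> R"
    show "((\<lambda>b. exp (z * complex_of_real b) / z) has_vector_derivative exp (z * complex_of_real b))
        (at b within {-R..R})"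
      using z by (intro has_vector_derivative_real_field) (auto intro!: derivative_eq_intros)
  qed (use R in \<open>auto intro!: continuous_intros\<close>)
  also have "exp (z * complex_of_real R) = exp (z * complex_of_real (-R))"
  proof -
    have "z * complex_of_real R = z * complex_of_real (-R) + complex_of_real (of_int (2 * l) * pi) * \<i>"
      using R by (simp add: z_def field_simps)
    then show ?thesis unfolding exp_eq by blast
  qed
  finally show ?thesis by (simp add: z_def mult.assoc)
qed

text \<open>The exponentials of frequencies \<open>s + n \<pi>/R\<close> are orthogonal on \<open>[-R, R]\<close>, so Bessel's
  inequality bounds the sum of \<open>\<bar>\<kappa>^(s + n \<pi>/R)\<bar>\<^sup>2\<close> over \<open>n\<close>; integrating over a period in \<open>s\<close>
  covers the line.\<close>

lemma Plancherel_inequality: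
  fixes \<kappa> :: "real \<Rightarrow> complex"
  assumes \<kappa>: "\<kappa> \<in> L2 lborel" and supp: "\<And>b. \<kappa> b \<noteq> 0 \<Longrightarrow> \<bar>b\<bar> \<le> R" and R: "0 < R"
  shows "(\<integral>\<^sup>+s. ennreal ((cmod (LINT b|lborel. \<kappa> b * exp (- \<i> * complex_of_real (b * s))))\<^sup>2) \<partial>lborel)
    \<le> ennreal (2 * pi * (l2norm lborel \<kappa>)\<^sup>2)"
proof -
  \<comment> \<open>\<open>int_decode\<close> enumerates the integers, which turns the family of all periods into a sequence.\<close>
  define w where "w = pi / R"
  define M where "M = restrict_space lborel {-R..R}"
  define F where "F s = (LINT b|lborel. \<kappa> b * exp (- \<i> * complex_of_real (b * s)))" for s
  define e where "e s n = (\<lambda>b. complex_of_real (1 / sqrt (2 * R)) *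
      exp (\<i> * complex_of_real (b * (s + int_decode n * w))))" for s n
  have w: "0 < w" using R by (simp add: w_def)
  have [measurable]: "\<kappa> \<in> borel_measurable borel" using L2_measurable[OF \<kappa>] by simp
  have \<kappa>_ind: "indicator {-R..R} b *\<^sub>R \<kappa> b = \<kappa> b" for b
    using supp[of b] by (cases "\<kappa> b = 0") (auto simp: indicator_def)
  have \<kappa>M: "\<kappa> \<in> borel_measurable M" by (simp add: M_def measurable_restrict_space1)
  have "(\<integral>\<^sup>+b. ennreal ((cmod (\<kappa> b))\<^sup>2) \<partial>M) = (\<integral>\<^sup>+b. ennreal ((cmod (\<kappa> b))\<^sup>2) \<partial>lborel)"
  proof -
    have "\<kappa> b = 0" if "b \<notin> {-R..R}" for b using supp[of b] that by (cases "\<kappa> b = 0") auto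
    then show ?thesis
      unfolding M_def by (subst nn_integral_restrict_space) (auto intro!: nn_integral_cong simp: indicator_def)
  qed
  then have L2M: "\<kappa> \<in> L2 M" "l2norm M \<kappa> \<le> l2norm lborel \<kappa>"
    using l2norm_le[OF \<kappa>M l2norm_nonneg[of lborel \<kappa>]] nn_integral_l2norm[OF \<kappa>] by simp_all
  have fin: "emeasure M (space M) < \<infinity>"
    by (simp add: M_def emeasure_restrict_space space_restrict_space emeasure_lborel_Icc_eq)
  have e: "e s n \<in> L2 M" for s n
  proof -
    have m: "e s n \<in> borel_measurable M"
      unfolding M_def e_def by (intro measurable_restrict_space1) simp
    have "(\<integral>\<^sup>+b. ennreal ((cmod (e s n b))\<^sup>2) \<partial>M) = (\<integral>\<^sup>+b. ennreal (1 / (2 * R)) \<partial>M)"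
      using R by (intro nn_integral_cong) (simp add: e_def norm_mult norm_divide power_divide)
    also have "\<dots> < \<infinity>" using fin by (simp add: ennreal_mult_less_top)
    finally show ?thesis using m by (simp add: L2_iff_nn_integral)
  qed
  have orth: "ip M (e s n) (e s m) = (if n = m then 1 else 0)" for s n m
  proof -
    have "ip M (e s n) (e s m) = (LINT b|lborel. indicator {-R..R} b *\<^sub>R (e s n b * cnj (e s m b)))"
      unfolding ip_def M_def by (subst integral_restrict_space) auto
    also have "\<dots> = (LINT b|lborel. complex_of_real (1 / (2 * R)) * (indicator {-R..R} b *\<^sub>R
        exp (\<i> * complex_of_real ((int_decode n - int_decode m) * pi / R * b))))"
    proof (rule Bochner_Integration.integral_cong[OF refl])
      fix b
      have "exp (\<i> * complex_of_real (b * (s + int_decode n * w))) *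
          exp (- (\<i> * complex_of_real (b * (s + int_decode m * w)))) =
          exp (\<i> * complex_of_real ((int_decode n - int_decode m) * pi / R * b))"
        unfolding exp_add [symmetric] using R by (intro arg_cong[of _ _ exp]) (simp add: w_def field_simps)
      moreover have "complex_of_real (1 / sqrt (2 * R)) * complex_of_real (1 / sqrt (2 * R)) =
          complex_of_real (1 / (2 * R))"
        using R by (simp flip: of_real_mult)
      ultimately have "e s n b * cnj (e s m b) = complex_of_real (1 / (2 * R)) *
          exp (\<i> * complex_of_real ((int_decode n - int_decode m) * pi / R * b))"
        unfolding e_def by (simp add: exp_cnj)
      then show "indicator {-R..R} b *\<^sub>R (e s n b * cnj (e s m b)) =
          complex_of_real (1 / (2 * R)) * (indicator {-R..R} b *\<^sub>R
          exp (\<i> * complex_of_real ((int_decode n - int_decode m) * pi / R * b)))"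
        by simp
    qed
    also have "\<dots> = complex_of_real (1 / (2 * R)) * (LINT b|lborel. indicator {-R..R} b *\<^sub>R
        exp (\<i> * complex_of_real ((int_decode n - int_decode m) * pi / R * b)))"
      by (rule integral_mult_right_zero)
    also have "\<dots> = (if n = m then 1 else 0)"
    proof (cases "n = m")
      case True
      have "(LINT b|lborel. indicator {-R..R} b *\<^sub>R (1::complex)) = complex_of_real (2 * R)"
        using R by (simp add: scaleR_conv_of_real)
      with True R show ?thesis by simp
    next
      case False
      then have "int_decode n - int_decode m \<noteq> 0" by (simp add: int_decode_eq)
      from integral_exp_period[OF R this] False show ?thesis by simp
    qed
    finally show ?thesis .
  qed
  have ipe: "ip M \<kappa> (e s n) = complex_of_real (1 / sqrt (2 * R)) * F (s + int_decode n * w)" for s n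
  proof -
    have "ip M \<kappa> (e s n) = (LINT b|lborel. indicator {-R..R} b *\<^sub>R (\<kappa> b * cnj (e s n b)))"
      unfolding ip_def M_def by (subst integral_restrict_space) auto
    also have "\<dots> = (LINT b|lborel. complex_of_real (1 / sqrt (2 * R)) *
        (\<kappa> b * exp (- \<i> * complex_of_real (b * (s + int_decode n * w)))))"
    proof (rule Bochner_Integration.integral_cong[OF refl])
      fix b
      have "indicator {-R..R} b *\<^sub>R (\<kappa> b * cnj (e s n b)) = \<kappa> b * cnj (e s n b)"
        using \<kappa>_ind[of b] by (metis mult_scaleR_left)
      then show "indicator {-R..R} b *\<^sub>R (\<kappa> b * cnj (e s n b)) = complex_of_real (1 / sqrt (2 * R)) *
          (\<kappa> b * exp (- \<i> * complex_of_real (b * (s + int_decode n * w))))"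
        by (simp add: e_def exp_cnj ac_simps)
    qed
    finally show ?thesis unfolding F_def by simp
  qed
  have Bessel: "(\<Sum>n<N. (cmod (F (s + int_decode n * w)))\<^sup>2) \<le> 2 * R * (l2norm lborel \<kappa>)\<^sup>2" for s N
  proof -
    have "(\<Sum>n<N. (cmod (F (s + int_decode n * w)))\<^sup>2) = 2 * R * (\<Sum>n<N. (cmod (ip M \<kappa> (e s n)))\<^sup>2)"
      using R by (simp add: ipe norm_mult norm_divide power_mult_distrib power_divide sum_distrib_left)
    also have "\<dots> \<le> 2 * R * (l2norm M \<kappa>)\<^sup>2"
      using R by (intro mult_left_mono Bessel_inequality L2M e orth) auto
    also have "\<dots> \<le> 2 * R * (l2norm lborel \<kappa>)\<^sup>2"
      using R L2M(2) l2norm_nonneg[of M \<kappa>] by (intro mult_left_mono power_mono) auto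
    finally show ?thesis .
  qed
  have Fm[measurable]: "F \<in> borel_measurable borel" unfolding F_def by measurable
  define I where "I n = {int_decode n * w ..< (int_decode n + 1) * w}" for n
  have I_iff: "s \<in> I n \<longleftrightarrow> n = int_encode \<lfloor>s / w\<rfloor>" for s n
  proof -
    have "s \<in> I n \<longleftrightarrow> \<lfloor>s / w\<rfloor> = int_decode n"
      using w by (auto simp: I_def floor_eq_iff field_simps)
    then show ?thesis by (metis int_decode_inverse int_encode_inverse)
  qed
  have "(\<integral>\<^sup>+s. ennreal ((cmod (F s))\<^sup>2) \<partial>lborel) = (\<integral>\<^sup>+s. (\<Sum>n. ennreal ((cmod (F s))\<^sup>2) * indicator (I n) s) \<partial>lborel)"
  proof (rule nn_integral_cong)
    fix s
    have "disjoint_family I" by (auto simp: disjoint_family_on_def I_iff)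
    then have "(\<Sum>n. indicator (I n) s :: ennreal) = indicator (\<Union>n. I n) s"
      by (rule suminf_indicator)
    also have "\<dots> = 1" by (simp add: I_iff)
    finally show "ennreal ((cmod (F s))\<^sup>2) = (\<Sum>n. ennreal ((cmod (F s))\<^sup>2) * indicator (I n) s)"
      by simp
  qed
  also have "\<dots> = (\<Sum>n. \<integral>\<^sup>+s. ennreal ((cmod (F s))\<^sup>2) * indicator (I n) s \<partial>lborel)"
    unfolding I_def by (rule nn_integral_suminf) measurable
  also have "\<dots> = (\<Sum>n. \<integral>\<^sup>+s. ennreal ((cmod (F (s + int_decode n * w)))\<^sup>2) * indicator {0..<w} s \<partial>lborel)"
  proof (rule suminf_cong)
    fix n
    have "(\<integral>\<^sup>+s. ennreal ((cmod (F s))\<^sup>2) * indicator (I n) s \<partial>lborel) =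
        (\<integral>\<^sup>+s. ennreal ((cmod (F (int_decode n * w + 1 * s)))\<^sup>2) * indicator (I n) (int_decode n * w + 1 * s) \<partial>lborel)"
      unfolding I_def by (subst nn_integral_real_affine[where c = 1 and t = "int_decode n * w"]) auto
    also have "\<dots> = (\<integral>\<^sup>+s. ennreal ((cmod (F (s + int_decode n * w)))\<^sup>2) * indicator {0..<w} s \<partial>lborel)"
      by (intro nn_integral_cong) (auto simp: I_def indicator_def algebra_simps)
    finally show "(\<integral>\<^sup>+s. ennreal ((cmod (F s))\<^sup>2) * indicator (I n) s \<partial>lborel) = \<dots>" .
  qed
  also have "\<dots> = (\<integral>\<^sup>+s. (\<Sum>n. ennreal ((cmod (F (s + int_decode n * w)))\<^sup>2) * indicator {0..<w} s) \<partial>lborel)"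
    by (rule nn_integral_suminf [symmetric]) measurable
  also have "\<dots> \<le> (\<integral>\<^sup>+s. ennreal (2 * R * (l2norm lborel \<kappa>)\<^sup>2) * indicator {0..<w} s \<partial>lborel)"
  proof (rule nn_integral_mono)
    fix s
    have "(\<Sum>n. ennreal ((cmod (F (s + int_decode n * w)))\<^sup>2)) \<le> ennreal (2 * R * (l2norm lborel \<kappa>)\<^sup>2)"
    proof (rule suminf_le_const)
      fix N
      show "(\<Sum>n<N. ennreal ((cmod (F (s + int_decode n * w)))\<^sup>2)) \<le> ennreal (2 * R * (l2norm lborel \<kappa>)\<^sup>2)"
        using Bessel by (subst sum_ennreal) (auto intro: ennreal_leI)
    qed simp
    then show "(\<Sum>n. ennreal ((cmod (F (s + int_decode n * w)))\<^sup>2) * indicator {0..<w} s)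
        \<le> ennreal (2 * R * (l2norm lborel \<kappa>)\<^sup>2) * indicator {0..<w} s"
      by (simp add: mult_right_mono)
  qed
  also have "\<dots> = ennreal (2 * R * (l2norm lborel \<kappa>)\<^sup>2) * ennreal w"
    using w by (subst nn_integral_cmult_indicator) auto
  also have "\<dots> = ennreal (2 * pi * (l2norm lborel \<kappa>)\<^sup>2)"
    using R by (simp add: w_def flip: ennreal_mult)
  finally show ?thesis unfolding F_def .
qed

section \<open>Boundedness of the integrated representation\<close>

context box_kernel
begin

lemma int_op_measurable:
  assumes "u \<in> borel_measurable (HL \<rho>)"
  shows "int_op \<rho> u \<in> borel_measurable borel"
proof -
  have [measurable]: "ext \<rho> u \<in> borel_measurable borel" using assms by (simp add: ext_measurable)
  show ?thesis unfolding int_op_def [abs_def] by measurable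
qed

text \<open>Cauchy-Schwarz in the dilation variable. The splitting of the integrand into \<open>f\<close> and \<open>g\<close> is left
  open: boundedness of \<open>W(f, g)(x)\<close> only needs that the partial Fourier transform is bounded,
  whereas \<open>W(f, g)(x) K\<^bsup>1/2\<^esup>\<close> requires it to be square integrable.\<close>

lemma int_op_sq_le:
  assumes le: "\<And>a. weight a * cmod (ext \<rho> u (a * s)) * cmod (ft s a) \<le> f a * g a"
    and [measurable]: "f \<in> borel_measurable borel" "g \<in> borel_measurable borel"
    and nonneg: "\<And>a. 0 \<le> f a" "\<And>a. 0 \<le> g a"
  shows "ennreal ((cmod (int_op \<rho> u s))\<^sup>2) \<le>
    (\<integral>\<^sup>+a. ennreal ((f a)\<^sup>2) \<partial>lborel) * (\<integral>\<^sup>+a. ennreal ((g a)\<^sup>2) \<partial>lborel)"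
proof -
  let ?q = "\<lambda>a. complex_of_real (weight a) * ext \<rho> u (a * s) * ft s a"
  have "ennreal (cmod (int_op \<rho> u s)) \<le> (\<integral>\<^sup>+a. ennreal (cmod (?q a)) \<partial>lborel)"
  proof (cases "integrable lborel ?q")
    case True
    then show ?thesis unfolding int_op_def by (rule integral_norm_bound_ennreal)
  next
    case False
    then show ?thesis unfolding int_op_def by (simp add: not_integrable_integral_eq)
  qed
  also have "\<dots> \<le> (\<integral>\<^sup>+a. ennreal (f a) * ennreal (g a) \<partial>lborel)"
    using le nonneg by (intro nn_integral_mono)
      (simp add: norm_mult weight_nonneg abs_of_nonneg ennreal_leI flip: ennreal_mult)
  finally have "(ennreal (cmod (int_op \<rho> u s)))\<^sup>2 \<le> (\<integral>\<^sup>+a. ennreal (f a) * ennreal (g a) \<partial>lborel)\<^sup>2"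
    by (intro power_mono) auto
  also have "\<dots> \<le> (\<integral>\<^sup>+a. (ennreal (f a))\<^sup>2 \<partial>lborel) * (\<integral>\<^sup>+a. (ennreal (g a))\<^sup>2 \<partial>lborel)"
    by (rule Cauchy_Schwarz_nn_integral) auto
  finally show ?thesis using nonneg by (simp add: ennreal_power)
qed

lemma int_op_L2:
  assumes u: "u \<in> borel_measurable (HL \<rho>)" and c: "0 \<le> c"
    and le: "(\<integral>\<^sup>+s. ennreal ((cmod (int_op \<rho> u s))\<^sup>2) \<partial>lborel) \<le> ennreal (c\<^sup>2)"
  shows "int_op \<rho> u \<in> L2 (HL \<rho>)" "l2norm (HL \<rho>) (int_op \<rho> u) \<le> c"
proof -
  have "(\<integral>\<^sup>+s. ennreal ((cmod (int_op \<rho> u s))\<^sup>2) \<partial>HL \<rho>) \<le> (\<integral>\<^sup>+s. ennreal ((cmod (int_op \<rho> u s))\<^sup>2) \<partial>lborel)"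
    unfolding nn_integral_ext by (intro nn_integral_mono) (auto simp: ext_def indicator_def)
  also note le
  finally show "int_op \<rho> u \<in> L2 (HL \<rho>)" "l2norm (HL \<rho>) (int_op \<rho> u) \<le> c"
    using l2norm_le[OF borel_measurable_HL[OF int_op_measurable[OF u]] c] by blast+
qed

lemma int_op_bounded:
  assumes u: "u \<in> L2 (HL \<rho>)"
  defines "D \<equiv> (2 * R * C / a0\<^sup>2) * (a1 - a0)"
  shows "int_op \<rho> u \<in> L2 (HL \<rho>)" "l2norm (HL \<rho>) (int_op \<rho> u) \<le> D * l2norm (HL \<rho>) u"
proof -
  have [measurable]: "ext \<rho> u \<in> borel_measurable borel"
    using u ext_measurable L2_measurable by blast
  let ?A = "indicator {a0..a1} :: real \<Rightarrow> real"
  define D0 where "D0 = 2 * R * C / a0\<^sup>2"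
  have D0: "0 \<le> D0" using R C_nonneg by (simp add: D0_def)
  let ?f = "\<lambda>a. D0 * ?A a" and ?g = "\<lambda>s a. ?A a * (sqrt \<bar>a\<bar> * cmod (ext \<rho> u (a * s)))"
  have f2: "(\<integral>\<^sup>+a. ennreal ((?f a)\<^sup>2) \<partial>lborel) = ennreal (D0\<^sup>2 * (a1 - a0))"
  proof -
    have "(\<integral>\<^sup>+a. ennreal ((?f a)\<^sup>2) \<partial>lborel) = (\<integral>\<^sup>+a. ennreal (D0\<^sup>2) * indicator {a0..a1} a \<partial>lborel)"
      by (intro nn_integral_cong) (simp add: indicator_def)
    also have "\<dots> = ennreal (D0\<^sup>2) * ennreal (a1 - a0)"
      using a0 by (subst nn_integral_cmult_indicator) auto
    finally show ?thesis using a0 by (simp add: ennreal_mult)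
  qed
  have le: "ennreal ((cmod (int_op \<rho> u s))\<^sup>2) \<le>
      ennreal (D0\<^sup>2 * (a1 - a0)) * (\<integral>\<^sup>+a. ennreal ((?g s a)\<^sup>2) \<partial>lborel)" for s
    unfolding f2 [symmetric]
  proof (rule int_op_sq_le)
    fix a
    show "weight a * cmod (ext \<rho> u (a * s)) * cmod (ft s a) \<le> ?f a * ?g s a"
    proof (cases "a0 \<le> a \<and> a \<le> a1")
      case True
      then have a: "0 < a" using a0 by simp
      have "weight a * cmod (ft s a) \<le> (sqrt a / a0\<^sup>2) * (2 * R * C)"
        unfolding weight_def powr_half_sqrt[OF less_imp_le[OF a]]
        using True a a0 ft_bound by (intro mult_mono frac_le power_mono) auto
      then have "weight a * cmod (ft s a) * cmod (ext \<rho> u (a * s)) \<le>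
          (sqrt a / a0\<^sup>2) * (2 * R * C) * cmod (ext \<rho> u (a * s))"
        by (intro mult_right_mono) auto
      then show ?thesis using True a by (simp add: D0_def ac_simps)
    qed (auto simp: ft_zero)
  qed (use D0 in auto)
  have "(\<integral>\<^sup>+s. ennreal ((cmod (int_op \<rho> u s))\<^sup>2) \<partial>lborel) \<le>
      (\<integral>\<^sup>+s. ennreal (D0\<^sup>2 * (a1 - a0)) * (\<integral>\<^sup>+a. ennreal ((?g s a)\<^sup>2) \<partial>lborel) \<partial>lborel)"
    by (intro nn_integral_mono le)
  also have "\<dots> = ennreal (D0\<^sup>2 * (a1 - a0)) * (\<integral>\<^sup>+s. (\<integral>\<^sup>+a. ennreal ((?g s a)\<^sup>2) \<partial>lborel) \<partial>lborel)"
    by (rule nn_integral_cmult) measurable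
  also have "(\<integral>\<^sup>+s. (\<integral>\<^sup>+a. ennreal ((?g s a)\<^sup>2) \<partial>lborel) \<partial>lborel) =
      (\<integral>\<^sup>+a. (\<integral>\<^sup>+s. ennreal ((?g s a)\<^sup>2) \<partial>lborel) \<partial>lborel)"
    by (rule lborel_pair.Fubini') measurable
  also have "\<dots> = (\<integral>\<^sup>+a. ennreal ((l2norm (HL \<rho>) u)\<^sup>2) * indicator {a0..a1} a \<partial>lborel)"
  proof (rule nn_integral_cong)
    fix a
    show "(\<integral>\<^sup>+s. ennreal ((?g s a)\<^sup>2) \<partial>lborel) = ennreal ((l2norm (HL \<rho>) u)\<^sup>2) * indicator {a0..a1} a"
    proof (cases "a \<in> {a0..a1}")
      case True
      then have "a \<noteq> 0" using a0 by auto
      from nn_integral_dilate[OF u this] True show ?thesis by (simp add: power_mult_distrib)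
    qed simp
  qed
  also have "\<dots> = ennreal ((l2norm (HL \<rho>) u)\<^sup>2) * ennreal (a1 - a0)"
    using a0 by (subst nn_integral_cmult_indicator) auto
  also have "ennreal (D0\<^sup>2 * (a1 - a0)) * \<dots> = ennreal ((D * l2norm (HL \<rho>) u)\<^sup>2)"
  proof -
    have "(D * l2norm (HL \<rho>) u)\<^sup>2 = D0\<^sup>2 * (a1 - a0) * ((l2norm (HL \<rho>) u)\<^sup>2 * (a1 - a0))"
      unfolding D_def D0_def [symmetric] by (simp add: power_mult_distrib power2_eq_square)
    then show ?thesis using a0 by (simp add: ennreal_mult)
  qed
  finally have *: "(\<integral>\<^sup>+s. ennreal ((cmod (int_op \<rho> u s))\<^sup>2) \<partial>lborel) \<le> ennreal ((D * l2norm (HL \<rho>) u)\<^sup>2)" .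
  have "0 \<le> D * l2norm (HL \<rho>) u"
    using R C_nonneg a0 by (auto simp: D_def intro!: mult_nonneg_nonneg divide_nonneg_nonneg l2norm_nonneg)
  from int_op_L2[OF L2_measurable[OF u] this *]
  show "int_op \<rho> u \<in> L2 (HL \<rho>)" "l2norm (HL \<rho>) (int_op \<rho> u) \<le> D * l2norm (HL \<rho>) u" .
qed

lemma nn_integral_ft_sq:
  "(\<integral>\<^sup>+s. (\<integral>\<^sup>+a. ennreal ((cmod (ft s a))\<^sup>2) \<partial>lborel) \<partial>lborel) \<le> ennreal (4 * pi * R * C\<^sup>2 * (a1 - a0))"
proof -
  have "(\<integral>\<^sup>+s. (\<integral>\<^sup>+a. ennreal ((cmod (ft s a))\<^sup>2) \<partial>lborel) \<partial>lborel) =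
      (\<integral>\<^sup>+a. (\<integral>\<^sup>+s. ennreal ((cmod (ft s a))\<^sup>2) \<partial>lborel) \<partial>lborel)"
    by (rule lborel_pair.Fubini') measurable
  also have "\<dots> \<le> (\<integral>\<^sup>+a. ennreal (4 * pi * R * C\<^sup>2) * indicator {a0..a1} a \<partial>lborel)"
  proof (rule nn_integral_mono)
    fix a
    show "(\<integral>\<^sup>+s. ennreal ((cmod (ft s a))\<^sup>2) \<partial>lborel) \<le> ennreal (4 * pi * R * C\<^sup>2) * indicator {a0..a1} a"
    proof (cases "a0 \<le> a \<and> a \<le> a1")
      case True
      have m: "(\<lambda>b. k (b, a)) \<in> borel_measurable lborel" by measurable
      have "(\<integral>\<^sup>+b. ennreal ((cmod (k (b, a)))\<^sup>2) \<partial>lborel) \<le> (\<integral>\<^sup>+b. ennreal (C\<^sup>2) * indicator {-R..R} b \<partial>lborel)"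
      proof (rule nn_integral_mono)
        fix b
        show "ennreal ((cmod (k (b, a)))\<^sup>2) \<le> ennreal (C\<^sup>2) * indicator {-R..R} b"
          using k_bound[of "(b, a)"] k_supp[of b a]
          by (cases "k (b, a) = 0") (auto simp: indicator_def intro!: ennreal_leI power_mono)
      qed
      also have "\<dots> = ennreal (C\<^sup>2) * ennreal (2 * R)"
        using R by (subst nn_integral_cmult_indicator) auto
      also have "\<dots> = ennreal ((sqrt (2 * R * C\<^sup>2))\<^sup>2)"
        using R by (simp add: ennreal_mult ac_simps flip: ennreal_mult)
      finally have *: "(\<lambda>b. k (b, a)) \<in> L2 lborel" "l2norm lborel (\<lambda>b. k (b, a)) \<le> sqrt (2 * R * C\<^sup>2)"
        using R l2norm_le[OF m, of "sqrt (2 * R * C\<^sup>2)"] by auto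
      have "(\<integral>\<^sup>+s. ennreal ((cmod (ft s a))\<^sup>2) \<partial>lborel) \<le> ennreal (2 * pi * (l2norm lborel (\<lambda>b. k (b, a)))\<^sup>2)"
        unfolding ft_def using *(1) k_supp R by (intro Plancherel_inequality) auto
      also have "\<dots> \<le> ennreal (2 * pi * (sqrt (2 * R * C\<^sup>2))\<^sup>2)"
        using *(2) by (intro ennreal_leI mult_left_mono power_mono) (auto simp: l2norm_nonneg)
      also have "\<dots> = ennreal (4 * pi * R * C\<^sup>2)" using R by (simp add: ac_simps)
      finally show ?thesis using True by simp
    next
      case False
      then show ?thesis by (simp add: ft_zero)
    qed
  qed
  also have "\<dots> = ennreal (4 * pi * R * C\<^sup>2) * ennreal (a1 - a0)"
    using a0 by (subst nn_integral_cmult_indicator) auto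
  finally show ?thesis using R a0 by (simp add: ennreal_mult)
qed

text \<open>This is the Hilbert-Schmidt bound for \<open>W(f, g)(x) K\<^bsup>1/2\<^esup>\<close> in disguise: the exponent \<open>1/2\<close> is
  exactly the one for which the Duflo-Moore factor cancels the Jacobian of the dilation, so that
  square integrability of the partial Fourier transform suffices.\<close>

lemma int_op_Duflo_Moore_bounded:
  assumes u: "u \<in> L2 (HL \<rho>)"
  defines "D \<equiv> sqrt (4 * pi * R * C\<^sup>2 * (a1 - a0)) / a0"
  shows "l2norm (HL \<rho>) (int_op \<rho> (\<lambda>s. complex_of_real (\<bar>s\<bar> powr (1/2)) * u s)) \<le> D * l2norm (HL \<rho>) u"
proof -
  let ?u = "\<lambda>s. complex_of_real (\<bar>s\<bar> powr (1/2)) * u s"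
  have um: "u \<in> borel_measurable (HL \<rho>)" using u by (rule L2_measurable)
  then have [measurable]: "ext \<rho> u \<in> borel_measurable borel" by (simp add: ext_measurable)
  have u1m: "?u \<in> borel_measurable (HL \<rho>)" using powr_HL_measurable um by (rule borel_measurable_times)
  have ext_u: "ext \<rho> ?u t = complex_of_real (sqrt \<bar>t\<bar>) * ext \<rho> u t" for t
    by (simp add: ext_def powr_half_sqrt)
  let ?n = "(l2norm (HL \<rho>) u)\<^sup>2"
  let ?f = "\<lambda>s a. sqrt \<bar>s\<bar> * cmod (ext \<rho> u (s * a)) / a0"
  have f2: "(\<integral>\<^sup>+a. ennreal ((?f s a)\<^sup>2) \<partial>lborel) \<le> ennreal (?n / a0\<^sup>2)" for s
  proof (cases "s = 0")
    case False
    have "(\<integral>\<^sup>+a. ennreal ((?f s a)\<^sup>2) \<partial>lborel) =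
        (\<integral>\<^sup>+a. ennreal (1 / a0\<^sup>2) * ennreal (\<bar>s\<bar> * (cmod (ext \<rho> u (s * a)))\<^sup>2) \<partial>lborel)"
      by (intro nn_integral_cong) (simp add: power_divide power_mult_distrib flip: ennreal_mult)
    also have "\<dots> = ennreal (1 / a0\<^sup>2) * ennreal ?n"
      by (subst nn_integral_cmult) (use nn_integral_dilate[OF u False] in auto)
    also have "\<dots> = ennreal (?n / a0\<^sup>2)" by (simp flip: ennreal_mult)
    finally show ?thesis by simp
  qed simp
  have le: "ennreal ((cmod (int_op \<rho> ?u s))\<^sup>2) \<le> ennreal (?n / a0\<^sup>2) * (\<integral>\<^sup>+a. ennreal ((cmod (ft s a))\<^sup>2) \<partial>lborel)" for s
  proof -
    have "ennreal ((cmod (int_op \<rho> ?u s))\<^sup>2) \<le>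
        (\<integral>\<^sup>+a. ennreal ((?f s a)\<^sup>2) \<partial>lborel) * (\<integral>\<^sup>+a. ennreal ((cmod (ft s a))\<^sup>2) \<partial>lborel)"
    proof (rule int_op_sq_le)
      fix a
      show "weight a * cmod (ext \<rho> ?u (a * s)) * cmod (ft s a) \<le> ?f s a * cmod (ft s a)"
      proof (cases "a0 \<le> a \<and> a \<le> a1")
        case True
        then have a: "0 < a" using a0 by simp
        have "weight a * cmod (ext \<rho> ?u (a * s)) = (sqrt a * sqrt a) * (sqrt \<bar>s\<bar> * cmod (ext \<rho> u (s * a))) / a\<^sup>2"
          unfolding ext_u weight_def
          using a by (simp add: powr_half_sqrt norm_mult abs_mult real_sqrt_mult ac_simps)
        also have "\<dots> = sqrt \<bar>s\<bar> * cmod (ext \<rho> u (s * a)) / a"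
          using a by (simp add: power2_eq_square)
        also have "\<dots> \<le> ?f s a"
          using True a0 by (intro divide_left_mono) auto
        finally show ?thesis by (rule mult_right_mono) simp
      qed (simp add: ft_zero)
    qed (use a0 in auto)
    also have "\<dots> \<le> ennreal (?n / a0\<^sup>2) * (\<integral>\<^sup>+a. ennreal ((cmod (ft s a))\<^sup>2) \<partial>lborel)"
      by (intro mult_right_mono f2) simp
    finally show ?thesis .
  qed
  have "(\<integral>\<^sup>+s. ennreal ((cmod (int_op \<rho> ?u s))\<^sup>2) \<partial>lborel) \<le>
      (\<integral>\<^sup>+s. ennreal (?n / a0\<^sup>2) * (\<integral>\<^sup>+a. ennreal ((cmod (ft s a))\<^sup>2) \<partial>lborel) \<partial>lborel)"
    by (intro nn_integral_mono le)
  also have "\<dots> = ennreal (?n / a0\<^sup>2) * (\<integral>\<^sup>+s. (\<integral>\<^sup>+a. ennreal ((cmod (ft s a))\<^sup>2) \<partial>lborel) \<partial>lborel)"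
    by (rule nn_integral_cmult) measurable
  also have "\<dots> \<le> ennreal (?n / a0\<^sup>2) * ennreal (4 * pi * R * C\<^sup>2 * (a1 - a0))"
    by (intro mult_left_mono nn_integral_ft_sq) simp
  also have "\<dots> = ennreal ((D * l2norm (HL \<rho>) u)\<^sup>2)"
  proof -
    have nonneg: "0 \<le> 4 * pi * R * C\<^sup>2 * (a1 - a0)" using R a0 by simp
    then have "(D * l2norm (HL \<rho>) u)\<^sup>2 = (?n / a0\<^sup>2) * (4 * pi * R * C\<^sup>2 * (a1 - a0))"
      unfolding D_def by (simp add: power_mult_distrib power_divide)
    then show ?thesis using nonneg by (simp only: ennreal_mult zero_le_power2 divide_nonneg_nonneg)
  qed
  finally have *: "(\<integral>\<^sup>+s. ennreal ((cmod (int_op \<rho> ?u s))\<^sup>2) \<partial>lborel) \<le> ennreal ((D * l2norm (HL \<rho>) u)\<^sup>2)" .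
  have "0 \<le> D * l2norm (HL \<rho>) u"
    using R a0 by (simp add: D_def l2norm_nonneg)
  from int_op_L2(2)[OF u1m this *] show ?thesis .
qed

end

section \<open>The Wigner transform of compactly supported functions\<close>

lemma linear_opr_cong_AE:
  "linear_opr M A \<Longrightarrow> (u, v) \<in> A \<Longrightarrow> u' \<in> L2 M \<Longrightarrow> v' \<in> L2 M \<Longrightarrow>
    (AE x in M. u' x = u x) \<Longrightarrow> (AE x in M. v' x = v x) \<Longrightarrow> (u', v') \<in> A"
  unfolding linear_opr_def by blast

context box_kernel
begin

text \<open>The defining formula of the pointwise Wigner transform, for an arbitrary kernel
  (\<open>wigner_Cc_eq\<close>).\<close>

definition weak_integral :: "dual \<Rightarrow> real opr" where
  "weak_integral \<rho> = {(u, v). u \<in> L2 (HL \<rho>) \<and> v \<in> L2 (HL \<rho>) \<and>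
      (\<forall>h\<in>L2 (HL \<rho>). ip (HL \<rho>) v h = (LINT y|haar. k y * ip (HL \<rho>) (rep y u) h))}"

lemma ip_int_op:
  assumes "u \<in> L2 (HL \<rho>)" "h \<in> L2 (HL \<rho>)"
  shows "ip (HL \<rho>) (int_op \<rho> u) h = int_form \<rho> u h"
  unfolding int_form_eq_integral_int_op[OF assms] ip_ext
  by (intro Bochner_Integration.integral_cong refl) (simp add: ext_def indicator_def)

lemma weak_integral_iff:
  "(u, v) \<in> weak_integral \<rho> \<longleftrightarrow> u \<in> L2 (HL \<rho>) \<and> v \<in> L2 (HL \<rho>) \<and>
    (\<forall>h\<in>L2 (HL \<rho>). ip (HL \<rho>) v h = int_form \<rho> u h)"
  by (auto simp: weak_integral_def integral_haar_rep)

lemma int_op_in_weak_integral: "u \<in> L2 (HL \<rho>) \<Longrightarrow> (u, int_op \<rho> u) \<in> weak_integral \<rho>"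
  by (simp add: weak_integral_iff int_op_bounded(1) ip_int_op)

lemma linear_opr_weak_integral: "linear_opr (HL \<rho>) (weak_integral \<rho>)"
  unfolding linear_opr_def
proof (intro conjI)
  let ?W = "weak_integral \<rho>"
  show "?W \<subseteq> L2 (HL \<rho>) \<times> L2 (HL \<rho>)" by (auto simp: weak_integral_iff)
  show "(\<lambda>x. 0, \<lambda>x. 0) \<in> ?W"
    using int_form_scale[of \<rho> 0 "\<lambda>x. 0"] by (simp add: weak_integral_iff L2_zero ip_zero_left)
  show "\<forall>(u, v)\<in>?W. \<forall>(u', v')\<in>?W. (\<lambda>x. u x + u' x, \<lambda>x. v x + v' x) \<in> ?W"
    by (auto simp: weak_integral_iff L2_add ip_add_left int_form_add)
  show "\<forall>(u, v)\<in>?W. \<forall>c. (\<lambda>x. c * u x, \<lambda>x. c * v x) \<in> ?W"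
    by (auto simp: weak_integral_iff L2_scale ip_scale_left int_form_scale)
  \<comment> \<open>Invariance under change on null sets: the integral operator is bounded, so it annihilates the
    difference of two representatives.\<close>
  have "(u', v') \<in> ?W"
    if W: "(u, v) \<in> ?W" and u': "u' \<in> L2 (HL \<rho>)" and v': "v' \<in> L2 (HL \<rho>)"
      and uu: "AE x in HL \<rho>. u' x = u x" and vv: "AE x in HL \<rho>. v' x = v x" for u v u' v'
  proof -
    have u: "u \<in> L2 (HL \<rho>)" and v: "v \<in> L2 (HL \<rho>)" using W by (auto simp: weak_integral_iff)
    have d: "(\<lambda>x. u' x - u x) \<in> L2 (HL \<rho>)" using u' u by (rule L2_diff)
    have "l2norm (HL \<rho>) (\<lambda>x. u' x - u x) = 0" using l2norm_eq_0_iff[OF d] uu by simp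
    then have n: "l2norm (HL \<rho>) (int_op \<rho> (\<lambda>x. u' x - u x)) = 0"
      using int_op_bounded(2)[OF d] l2norm_nonneg[of "HL \<rho>"] by (metis mult_zero_right order_antisym)
    have "ip (HL \<rho>) v' h = int_form \<rho> u' h" if h: "h \<in> L2 (HL \<rho>)" for h
    proof -
      have "cmod (int_form \<rho> (\<lambda>x. u' x - u x) h) \<le> 0"
        using Cauchy_Schwarz_ip(2)[OF int_op_bounded(1)[OF d] h] by (simp add: n ip_int_op d h)
      moreover have "int_form \<rho> u' h = int_form \<rho> (\<lambda>x. u' x - u x) h + int_form \<rho> u h"
        using int_form_add[OF d u h] by simp
      moreover have "ip (HL \<rho>) v' h = ip (HL \<rho>) v h"
        using v v' h vv by (intro ip_cong_AE L2_measurable)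
      ultimately show ?thesis using W h by (simp add: weak_integral_iff)
    qed
    with u' v' show ?thesis by (simp add: weak_integral_iff)
  qed
  then show "\<forall>(u, v)\<in>?W. \<forall>u'\<in>L2 (HL \<rho>). \<forall>v'\<in>L2 (HL \<rho>). (AE x in HL \<rho>. u' x = u x) \<longrightarrow>
      (AE x in HL \<rho>. v' x = v x) \<longrightarrow> (u', v') \<in> ?W" by blast
  show "\<forall>u v v'. (u, v) \<in> ?W \<longrightarrow> (u, v') \<in> ?W \<longrightarrow> (AE x in HL \<rho>. v x = v' x)"
    by (auto simp: weak_integral_iff intro!: AE_eq_if_ip_eq)
qed

lemma Domain_weak_integral: "Domain (weak_integral \<rho>) = L2 (HL \<rho>)"
proof
  show "Domain (weak_integral \<rho>) \<subseteq> L2 (HL \<rho>)" by (auto simp: weak_integral_iff)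
  show "L2 (HL \<rho>) \<subseteq> Domain (weak_integral \<rho>)" using int_op_in_weak_integral by blast
qed

lemma norm_bounded_K_half_weak_integral: "norm_bounded (HL \<rho>) (K \<rho> (1/2) O weak_integral \<rho>)"
proof -
  have "l2norm (HL \<rho>) v \<le> sqrt (4 * pi * R * C\<^sup>2 * (a1 - a0)) / a0 * l2norm (HL \<rho>) u"
    if K: "(u, w) \<in> K \<rho> (1/2)" and W: "(w, v) \<in> weak_integral \<rho>" for u w v
  proof -
    let ?u = "\<lambda>s. complex_of_real (\<bar>s\<bar> powr (1/2)) * u s"
    have L: "u \<in> L2 (HL \<rho>)" "w \<in> L2 (HL \<rho>)" "v \<in> L2 (HL \<rho>)"
      using K W by (auto simp: K_def weak_integral_iff)
    have ae: "AE s in HL \<rho>. ?u s = w s" using K by (auto simp: K_def)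
    have u1: "?u \<in> L2 (HL \<rho>)"
      using L(2) powr_HL_measurable L2_measurable[OF L(1)] ae
      by (intro L2_cong_AE[OF L(2)] borel_measurable_times) auto
    have "(?u, v) \<in> weak_integral \<rho>"
      using ae by (intro linear_opr_cong_AE[OF linear_opr_weak_integral W u1 L(3)]) auto
    then have "AE s in HL \<rho>. v s = int_op \<rho> ?u s"
      using int_op_in_weak_integral[OF u1] by (auto simp: weak_integral_iff intro!: AE_eq_if_ip_eq)
    then have "l2norm (HL \<rho>) v = l2norm (HL \<rho>) (int_op \<rho> ?u)"
      using L(3) int_op_bounded(1)[OF u1] by (intro l2norm_cong_AE)
    with int_op_Duflo_Moore_bounded[OF L(1)] show ?thesis by simp
  qed
  then show ?thesis unfolding norm_bounded_def by blast
qed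

end

lemma Cc_bounds:
  assumes "f \<in> Cc"
  obtains R a0 a1 C where "0 < R" "0 < a0" "a0 \<le> a1" "\<And>y. y \<in> aff \<Longrightarrow> cmod (f y) \<le> C"
    "\<And>b a. (b, a) \<in> aff \<Longrightarrow> f (b, a) \<noteq> 0 \<Longrightarrow> \<bar>b\<bar> \<le> R \<and> a0 \<le> a \<and> a \<le> a1"
proof -
  from assms obtain S where cont: "continuous_on aff f" and S: "compact S" "S \<subseteq> aff"
    and zero: "\<And>x. x \<in> aff - S \<Longrightarrow> f x = 0" by (auto simp: Cc_def)
  have "compact (f ` S)" using cont S by (intro compact_continuous_image continuous_on_subset[OF cont])
  then obtain C where C: "\<And>y. y \<in> S \<Longrightarrow> cmod (f y) \<le> C"
    using compact_imp_bounded bounded_iff by (metis imageI)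
  obtain B where B: "\<And>y. y \<in> S \<Longrightarrow> norm y \<le> B"
    using compact_imp_bounded[OF S(1)] bounded_iff by metis
  have "\<exists>a0>0. \<forall>y\<in>S. a0 \<le> snd y"
  proof (cases "S = {}")
    case True
    then show ?thesis by (intro exI[of _ 1]) auto
  next
    case False
    have "continuous_on S snd" by (intro continuous_intros)
    from continuous_attains_inf[OF S(1) False this] obtain z where "z \<in> S" "\<forall>y\<in>S. snd z \<le> snd y" by blast
    with S(2) show ?thesis by (intro exI[of _ "snd z"]) (auto simp: aff_def)
  qed
  then obtain a0 where a0: "0 < a0" "\<And>y. y \<in> S \<Longrightarrow> a0 \<le> snd y" by blast
  show thesis
  proof (rule that[of "max 1 B" a0 "max a0 B" "max C 0"])
    show "cmod (f y) \<le> max C 0" if "y \<in> aff" for y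
      using C[of y] zero[of y] that by (cases "y \<in> S") auto
    show "\<bar>b\<bar> \<le> max 1 B \<and> a0 \<le> a \<and> a \<le> max a0 B" if "(b, a) \<in> aff" "f (b, a) \<noteq> 0" for b a
    proof -
      have "(b, a) \<in> S" using zero[of "(b, a)"] that by blast
      then show ?thesis
        using B[of "(b, a)"] a0(2)[of "(b, a)"] norm_fst_le[of b a] norm_snd_le[of a b] by auto
    qed
  qed (use a0 in auto)
qed

lemma Cc_L2:
  assumes f: "f \<in> Cc"
  shows "f \<in> L2 haar"
proof -
  obtain R a0 a1 C where C: "0 < R" "0 < a0" "a0 \<le> a1" "\<And>y. y \<in> aff \<Longrightarrow> cmod (f y) \<le> C"
    "\<And>b a. (b, a) \<in> aff \<Longrightarrow> f (b, a) \<noteq> 0 \<Longrightarrow> \<bar>b\<bar> \<le> R \<and> a0 \<le> a \<and> a \<le> a1"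
    by (rule Cc_bounds[OF f], rule that)
  let ?B = "cbox (-R, a0) (R, a1)"
  have B: "?B \<subseteq> aff" using C(2) by (auto simp: aff_def)
  have m: "f \<in> borel_measurable haar"
    unfolding haar_measurable_iff
    using f by (intro borel_measurable_continuous_on_indicator) (auto simp: Cc_def)
  have "(\<integral>\<^sup>+y. ennreal ((cmod (f y))\<^sup>2) \<partial>haar) \<le> (\<integral>\<^sup>+y. ennreal (C\<^sup>2) * indicator ?B y \<partial>haar)"
  proof (rule nn_integral_mono)
    fix y assume "y \<in> space haar"
    then have y: "y \<in> aff" by (simp add: space_haar)
    show "ennreal ((cmod (f y))\<^sup>2) \<le> ennreal (C\<^sup>2) * indicator ?B y"
    proof (cases "f y = 0")
      case False
      obtain b a where ba: "y = (b, a)" by (cases y)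
      have "\<bar>b\<bar> \<le> R \<and> a0 \<le> a \<and> a \<le> a1" using C(5)[of b a] False y ba by simp
      then have "y \<in> ?B" by (auto simp: ba)
      with C(4)[OF y] show ?thesis by (simp add: ennreal_leI power_mono)
    qed simp
  qed
  also have "\<dots> = ennreal (C\<^sup>2) * emeasure haar ?B"
    using B by (intro nn_integral_cmult_indicator) (auto simp: haar_alt sets_restrict_space_iff)
  also have "\<dots> \<le> ennreal (C\<^sup>2) * (ennreal (1 / a0\<^sup>2) * emeasure lborel ?B)"
    using C(2) by (intro mult_left_mono emeasure_haar_le) auto
  also have "\<dots> < \<infinity>"
    using emeasure_lborel_cbox_finite[of "(-R, a0)" "(R, a1)"] by (auto simp: ennreal_mult_less_top)
  finally show ?thesis using m by (simp add: L2_iff_nn_integral)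
qed

text \<open>Functions in \<open>Cc\<close> are arbitrary outside of the group; the indicators make the kernel jointly
  measurable on all of \<open>\<real>\<^sup>2 \<times> \<real>\<^sup>2\<close>.\<close>

definition aff_kernel :: "(real \<times> real \<Rightarrow> complex) \<Rightarrow> (real \<times> real \<Rightarrow> complex) \<Rightarrow>
    real \<times> real \<Rightarrow> real \<times> real \<Rightarrow> complex" where
  "aff_kernel f g x y = (indicator aff y *\<^sub>R f y) *
     (indicator aff (aff_mult (aff_inv y) x) *\<^sub>R g (aff_mult (aff_inv y) x))"

lemma aff_kernel_eq:
  "x \<in> aff \<Longrightarrow> y \<in> aff \<Longrightarrow> aff_kernel f g x y = f y * g (aff_mult (aff_inv y) x)"
  by (auto simp: aff_kernel_def aff_def aff_mult_def aff_inv_def)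

lemma Cc_measurable: "f \<in> Cc \<Longrightarrow> (\<lambda>y. indicator aff y *\<^sub>R f y) \<in> borel_measurable (borel \<Otimes>\<^sub>M borel)"
  unfolding borel_prod by (intro borel_measurable_continuous_on_indicator) (auto simp: Cc_def)

lemma aff_kernel_measurable:
  assumes "f \<in> Cc" "g \<in> Cc"
  shows "(\<lambda>z. aff_kernel f g (fst z) (snd z)) \<in>
    borel_measurable ((borel \<Otimes>\<^sub>M borel) \<Otimes>\<^sub>M (borel \<Otimes>\<^sub>M borel))"
proof -
  note [measurable] = assms[THEN Cc_measurable]
  have [measurable]: "(\<lambda>z. aff_mult (aff_inv (snd z)) (fst z)) \<in>
      ((borel \<Otimes>\<^sub>M borel) \<Otimes>\<^sub>M (borel \<Otimes>\<^sub>M borel)) \<rightarrow>\<^sub>M (borel \<Otimes>\<^sub>M borel)"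
    unfolding aff_mult_def aff_inv_def case_prod_unfold by simp
  have 1: "(\<lambda>z. indicator aff (snd z) *\<^sub>R f (snd z)) \<in>
      borel_measurable ((borel \<Otimes>\<^sub>M borel) \<Otimes>\<^sub>M (borel \<Otimes>\<^sub>M borel))"
    by (rule measurable_compose[OF measurable_snd Cc_measurable[OF assms(1)]])
  have 2: "(\<lambda>z. indicator aff (aff_mult (aff_inv (snd z)) (fst z)) *\<^sub>R g (aff_mult (aff_inv (snd z)) (fst z))) \<in>
      borel_measurable ((borel \<Otimes>\<^sub>M borel) \<Otimes>\<^sub>M (borel \<Otimes>\<^sub>M borel))"
    by (rule measurable_compose[OF _ Cc_measurable[OF assms(2)]]) fact
  show ?thesis unfolding aff_kernel_def using 1 2 by (rule borel_measurable_times)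
qed

lemma box_kernel_aff_kernel:
  assumes f: "f \<in> Cc" and g: "g \<in> Cc" and x: "x \<in> aff"
  obtains R a0 a1 C where "box_kernel (aff_kernel f g x) R a0 a1 C"
proof -
  obtain R a0 a1 C where C: "0 < R" "0 < a0" "a0 \<le> a1" "\<And>y. y \<in> aff \<Longrightarrow> cmod (f y) \<le> C"
    "\<And>b a. (b, a) \<in> aff \<Longrightarrow> f (b, a) \<noteq> 0 \<Longrightarrow> \<bar>b\<bar> \<le> R \<and> a0 \<le> a \<and> a \<le> a1"
    by (rule Cc_bounds[OF f], rule that)
  obtain C' where C': "\<And>y. y \<in> aff \<Longrightarrow> cmod (g y) \<le> C'"
    by (rule Cc_bounds[OF g], rule that)
  have "(0, 1) \<in> aff" by (simp add: aff_def)
  from C(4)[OF this] C'[OF this] have nonneg: "0 \<le> C" "0 \<le> C'"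
    using norm_ge_zero order_trans by blast+
  have "box_kernel (aff_kernel f g x) R a0 a1 (C * C')"
  proof
    show "aff_kernel f g x \<in> borel_measurable (borel \<Otimes>\<^sub>M borel)"
      using measurable_compose[OF measurable_Pair1' aff_kernel_measurable[OF f g], of x]
      by (simp add: space_pair_measure)
    have "cmod (indicator aff y *\<^sub>R f y) \<le> C" "cmod (indicator aff y *\<^sub>R g y) \<le> C'" for y
      using C(4) C' nonneg by (auto simp: indicator_def)
    then show "cmod (aff_kernel f g x y) \<le> C * C'" for y
      unfolding aff_kernel_def norm_mult using nonneg by (intro mult_mono) auto
    show "\<bar>b\<bar> \<le> R \<and> a0 \<le> a \<and> a \<le> a1" if "aff_kernel f g x (b, a) \<noteq> 0" for b a
      using that C(5)[of b a] by (auto simp: aff_kernel_def indicator_def split: if_splits)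
  qed (use C in auto)
  then show thesis using that by blast
qed

lemma wigner_Cc_eq:
  assumes "box_kernel (aff_kernel f g x) R a0 a1 C" "x \<in> aff"
  shows "wigner_Cc f g x \<rho> = box_kernel.weak_integral (aff_kernel f g x) \<rho>"
proof -
  have "(LINT y|haar. f y * g (aff_mult (aff_inv y) x) * ip (HL \<rho>) (rep y u) h) =
      (LINT y|haar. aff_kernel f g x y * ip (HL \<rho>) (rep y u) h)" for u h
    using assms(2) by (intro Bochner_Integration.integral_cong refl) (simp add: space_haar aff_kernel_eq)
  then show ?thesis
    unfolding wigner_Cc_def box_kernel.weak_integral_def[OF assms(1)] by simp
qed

lemma op_field_wigner_Cc:
  assumes f: "f \<in> Cc" and g: "g \<in> Cc"
  shows "op_field 2 (wigner_Cc f g)"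
  unfolding op_field_def
proof (intro conjI allI ballI)
  fix \<rho> x assume x: "x \<in> aff"
  from box_kernel_aff_kernel[OF f g x]
  obtain R a0 a1 C where bk: "box_kernel (aff_kernel f g x) R a0 a1 C" .
  note eq = wigner_Cc_eq[OF bk x]
  show "linear_opr (HL \<rho>) (wigner_Cc f g x \<rho>)"
    unfolding eq by (rule box_kernel.linear_opr_weak_integral[OF bk])
  show "Range (K \<rho> (1 / 2)) \<subseteq> Domain (wigner_Cc f g x \<rho>)"
    unfolding eq box_kernel.Domain_weak_integral[OF bk] by (auto simp: K_def)
  show "norm_bounded (HL \<rho>) (K \<rho> (1 / 2) O wigner_Cc f g x \<rho>)"
    unfolding eq by (rule box_kernel.norm_bounded_K_half_weak_integral[OF bk])
next
  fix \<rho> u v assume u: "u \<in> Range (K \<rho> (1 / 2))" and v: "v \<in> L2 (HL \<rho>)"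
  have uL: "u \<in> L2 (HL \<rho>)" using u by (auto simp: K_def)
  define q where "q = matrix_coeff \<rho> u v"
  note q = ip_rep [of _ \<rho> u v, folded q_def]
  have qm[measurable]: "q \<in> borel_measurable (borel \<Otimes>\<^sub>M borel)"
    unfolding q_def using uL v by (rule matrix_coeff_measurable)
  note [measurable] = aff_kernel_measurable[OF f g]
  have eq: "ip (HL \<rho>) (op_app (wigner_Cc f g x \<rho>) u) v =
      (LINT y|lborel. (indicator aff y / (snd y)\<^sup>2) *\<^sub>R (aff_kernel f g x y * q y))" if x: "x \<in> aff" for x
  proof -
    from box_kernel_aff_kernel[OF f g x]
    obtain R a0 a1 C where bk: "box_kernel (aff_kernel f g x) R a0 a1 C" .
    have "(u, op_app (wigner_Cc f g x \<rho>) u) \<in> wigner_Cc f g x \<rho>"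
      unfolding op_app_def wigner_Cc_eq[OF bk x]
      by (rule someI[where P = "\<lambda>v. (u, v) \<in> box_kernel.weak_integral (aff_kernel f g x) \<rho>"])
        (rule box_kernel.int_op_in_weak_integral[OF bk uL])
    then have "ip (HL \<rho>) (op_app (wigner_Cc f g x \<rho>) u) v =
        (LINT y|haar. aff_kernel f g x y * ip (HL \<rho>) (rep y u) v)"
      using v unfolding wigner_Cc_eq[OF bk x] box_kernel.weak_integral_def[OF bk] by blast
    also have "\<dots> = (LINT y|haar. aff_kernel f g x y * q y)"
      by (intro Bochner_Integration.integral_cong refl) (simp add: space_haar q)
    also have "\<dots> = (LINT y|lborel. (indicator aff y / (snd y)\<^sup>2) *\<^sub>R (aff_kernel f g x y * q y))"
    proof (rule integral_haar, rule borel_measurable_haarI)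
      have [measurable]: "aff_kernel f g x \<in> borel_measurable (borel \<Otimes>\<^sub>M borel)"
        using bk by (rule box_kernel.k_measurable)
      show "(\<lambda>y. aff_kernel f g x y * q y) \<in> borel_measurable borel"
        unfolding borel_prod [symmetric] by measurable
    qed simp
    finally show ?thesis .
  qed
  have aff2[measurable]: "aff \<in> sets (borel \<Otimes>\<^sub>M borel)" unfolding borel_prod by (rule aff_borel)
  have "(\<lambda>z. (indicator aff (snd z) / (snd (snd z))\<^sup>2) *\<^sub>R (aff_kernel f g (fst z) (snd z) * q (snd z)))
      \<in> borel_measurable ((borel \<Otimes>\<^sub>M borel) \<Otimes>\<^sub>M (borel \<Otimes>\<^sub>M borel))"
    by measurable
  then have "(\<lambda>z. (indicator aff (snd z) / (snd (snd z))\<^sup>2) *\<^sub>R (aff_kernel f g (fst z) (snd z) * q (snd z)))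
      \<in> borel_measurable (borel \<Otimes>\<^sub>M lborel)"
    unfolding measurable_cong_sets[OF sets_pair_measure_cong[OF refl sets_lborel] refl] borel_prod .
  then have "(\<lambda>x. LINT y|lborel. (indicator aff y / (snd y)\<^sup>2) *\<^sub>R (aff_kernel f g x y * q y)) \<in> borel_measurable borel"
    by (intro lborel.borel_measurable_lebesgue_integral) (simp add: case_prod_unfold)
  then show "(\<lambda>x. ip (HL \<rho>) (op_app (wigner_Cc f g x \<rho>) u) v) \<in> borel_measurable haar"
    using eq by (rule borel_measurable_haarI)
qed

definition unit_bump :: "real \<Rightarrow> complex" where
  "unit_bump s = indicator {s. 1 \<le> \<bar>s\<bar> \<and> \<bar>s\<bar> \<le> 2} s"

lemma unit_bump: "unit_bump \<in> L2 (HL \<rho>)" "l2norm (HL \<rho>) unit_bump = 1"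
proof -
  have m: "unit_bump \<in> borel_measurable (HL \<rho>)"
    unfolding unit_bump_def [abs_def] by (intro borel_measurable_HL) measurable
  define I :: "real set" where "I = (if \<rho> = rho_plus then {1..2} else {-2..-1})"
  have "(\<integral>\<^sup>+s. ennreal ((cmod (unit_bump s))\<^sup>2) \<partial>HL \<rho>) = (\<integral>\<^sup>+s. indicator I s \<partial>lborel)"
    unfolding HL_def
    by (subst nn_integral_restrict_space, simp, rule nn_integral_cong, cases \<rho>)
      (auto simp: unit_bump_def indicator_def I_def)
  also have "\<dots> = 1" by (simp add: I_def)
  finally have *: "(\<integral>\<^sup>+s. ennreal ((cmod (unit_bump s))\<^sup>2) \<partial>HL \<rho>) = 1" .
  then show L: "unit_bump \<in> L2 (HL \<rho>)" using m by (simp add: L2_iff_nn_integral)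
  have "(l2norm (HL \<rho>) unit_bump)\<^sup>2 = 1"
    using nn_integral_l2norm[OF L] * by simp
  then show "l2norm (HL \<rho>) unit_bump = 1"
    using l2norm_nonneg[of "HL \<rho>" unit_bump] by (simp add: power2_eq_1_iff)
qed

text \<open>A difference \<open>A - A\<close> is the relation between all \<open>u\<close> in the domain and all null functions, which
  is a rank one operator with second vector \<open>0\<close>.\<close>

lemma schatten_pow_diff_self:
  assumes lin: "linear_opr (HL \<rho>) A" and dom: "Domain A = L2 (HL \<rho>)" and e: "0 \<le> e"
  shows "schatten_pow (HL \<rho>) r (K \<rho> e O op_diff A A) = 0"
proof -
  have eq: "K \<rho> e O op_diff A A =
      {(u, z). u \<in> Domain (K \<rho> e) \<and> (u, z) \<in> rank_one (HL \<rho>) unit_bump (\<lambda>s. 0)}"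
  proof (intro subset_antisym subsetI)
    fix t assume "t \<in> K \<rho> e O op_diff A A"
    then obtain u w v v' where t: "t = (u, \<lambda>x. v x - v' x)" and K: "(u, w) \<in> K \<rho> e"
      and A: "(w, v) \<in> A" "(w, v') \<in> A" by (auto simp: op_diff_def)
    have L: "v \<in> L2 (HL \<rho>)" "v' \<in> L2 (HL \<rho>)" "AE x in HL \<rho>. v x = v' x"
      using lin A unfolding linear_opr_def by blast+
    then show "t \<in> {(u, z). u \<in> Domain (K \<rho> e) \<and> (u, z) \<in> rank_one (HL \<rho>) unit_bump (\<lambda>s. 0)}"
      using K by (auto simp: t rank_one_def K_def L2_diff)
  next
    fix t assume "t \<in> {(u, z). u \<in> Domain (K \<rho> e) \<and> (u, z) \<in> rank_one (HL \<rho>) unit_bump (\<lambda>s. 0)}"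
    then obtain u z w where t: "t = (u, z)" and K: "(u, w) \<in> K \<rho> e" and z: "z \<in> L2 (HL \<rho>)"
      "AE x in HL \<rho>. z x = 0" by (auto simp: rank_one_def)
    have w: "w \<in> L2 (HL \<rho>)" using K by (simp add: K_def)
    then obtain v where A: "(w, v) \<in> A" using dom by blast
    have v: "v \<in> L2 (HL \<rho>)" using lin A unfolding linear_opr_def by blast
    define v' where "v' = (\<lambda>x. v x - z x)"
    have v': "v' \<in> L2 (HL \<rho>)" unfolding v'_def using v z(1) by (rule L2_diff)
    have "AE x in HL \<rho>. v' x = v x" using z(2) by eventually_elim (simp add: v'_def)
    then have "(w, v') \<in> A"
      using v' by (intro linear_opr_cong_AE[OF lin A w]) auto
    moreover have "z = (\<lambda>x. v x - v' x)" by (simp add: v'_def)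
    ultimately have "(w, z) \<in> op_diff A A" using A unfolding op_diff_def by blast
    with K show "t \<in> K \<rho> e O op_diff A A" unfolding t by blast
  qed
  have "schatten_pow (HL \<rho>) r (K \<rho> e O op_diff A A) \<le>
      ennreal (((l2norm (HL \<rho>) (\<lambda>s. 0))\<^sup>2) powr (r / 2))"
    unfolding eq using e by (intro schatten_pow_K_rank_one_le unit_bump L2_zero)
  then show ?thesis by (simp add: l2norm_zero)
qed

text \<open>Constant sequences serve as approximations of \<open>f\<close> and \<open>g\<close>.\<close>

lemma is_wigner_wigner_Cc:
  assumes f: "f \<in> Cc" and g: "g \<in> Cc"
  shows "is_wigner f g (wigner_Cc f g)"
proof -
  have "schatten_pow (HL \<rho>) 2 (K \<rho> (1/2) O op_diff (wigner_Cc f g x \<rho>) (wigner_Cc f g x \<rho>)) = 0"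
    if x: "x \<in> aff" for x \<rho>
  proof -
    from box_kernel_aff_kernel[OF f g x]
    obtain R a0 a1 C where bk: "box_kernel (aff_kernel f g x) R a0 a1 C" .
    show ?thesis
      unfolding wigner_Cc_eq[OF bk x]
      by (intro schatten_pow_diff_self box_kernel.linear_opr_weak_integral[OF bk]
        box_kernel.Domain_weak_integral[OF bk]) simp
  qed
  then have "(\<integral>\<^sup>+x. schatten_pow (HL \<rho>) 2 (K \<rho> (1/2) O op_diff (wigner_Cc f g x \<rho>) (wigner_Cc f g x \<rho>)) \<partial>haar)
      = (\<integral>\<^sup>+x. 0 \<partial>haar)" for \<rho>
    by (intro nn_integral_cong) (simp add: space_haar)
  then have "Lp_norm_pow 2 (\<lambda>x \<rho>. op_diff (wigner_Cc f g x \<rho>) (wigner_Cc f g x \<rho>)) = 0"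
    unfolding Lp_norm_pow_def by simp
  then show ?thesis
    unfolding is_wigner_def using op_field_wigner_Cc[OF f g] f g
    by (intro conjI exI[of _ "\<lambda>n::nat. f"] exI[of _ "\<lambda>n::nat. g"]) (simp_all add: l2norm_zero)
qed

section \<open>The symbol and the two functions\<close>

text \<open>A trapezoid of slope \<open>1\<close> on \<open>[l, r]\<close>; \<open>tent (-1) 1\<close> is the triangle \<open>1 - \<bar>x\<bar>\<close>.\<close>

definition tent :: "real \<Rightarrow> real \<Rightarrow> real \<Rightarrow> real" where
  "tent l r x = max 0 (min 1 (min (x - l) (r - x)))"

lemma tent_bounds: "0 \<le> tent l r x" "tent l r x \<le> 1"
  by (auto simp: tent_def)

lemma tent_supp: "tent l r x \<noteq> 0 \<Longrightarrow> l < x \<and> x < r"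
  by (auto simp: tent_def max_def min_def split: if_splits)

lemma tent_one: "l + 1 \<le> x \<Longrightarrow> x \<le> r - 1 \<Longrightarrow> tent l r x = 1"
  by (simp add: tent_def)

lemma continuous_tent [continuous_intros]: "continuous_on S h \<Longrightarrow> continuous_on S (\<lambda>x. tent l r (h x))"
  unfolding tent_def by (intro continuous_intros)

lemma tent_measurable [measurable]: "tent l r \<in> borel_measurable borel"
  unfolding tent_def [abs_def] by measurable

text \<open>A Weierstrass function: continuous because its coefficients are summable, but with less
  smoothness than any prescribed positive order once \<open>M\<close> is large.\<close>

definition lacunary :: "real \<Rightarrow> real \<Rightarrow> complex" where
  "lacunary M b = (\<Sum>j. complex_of_real ((1/2) ^ j) * exp (\<i> * complex_of_real (M ^ j * b)))"

lemma continuous_lacunary: "continuous_on UNIV (lacunary M)"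
proof -
  let ?t = "\<lambda>j b. complex_of_real ((1/2) ^ j) * exp (\<i> * complex_of_real (M ^ j * b))"
  have "uniform_limit UNIV (\<lambda>n b. \<Sum>j<n. ?t j b) (\<lambda>b. \<Sum>j. ?t j b) sequentially"
    by (rule Weierstrass_m_test[where M = "\<lambda>j. (1/2) ^ j"])
      (auto simp: norm_mult norm_power norm_divide summable_geometric)
  moreover have "\<forall>\<^sub>F n in sequentially. continuous_on UNIV (\<lambda>b. \<Sum>j<n. ?t j b)"
    by (intro always_eventually allI continuous_intros)
  ultimately show ?thesis
    unfolding lacunary_def [abs_def] by (intro uniform_limit_theorem) auto
qed

definition wild :: "real \<Rightarrow> real \<times> real \<Rightarrow> complex" where
  "wild M y = complex_of_real (tent 1 5 (snd y) * tent (-1) 1 (fst y)) * lacunary M (fst y)"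

definition plateau :: "real \<times> real \<Rightarrow> complex" where
  "plateau y = complex_of_real (tent (-3) 3 (fst y) * tent 1 21 (snd y))"

lemma CcI:
  assumes "continuous_on UNIV f" "0 < c" "\<And>y. f y \<noteq> 0 \<Longrightarrow> y \<in> cbox (l, c) (r, d)"
  shows "f \<in> Cc"
proof -
  have "cbox (l, c) (r, d) \<subseteq> aff" using assms(2) by (auto simp: aff_def)
  moreover have "\<forall>x\<in>aff - cbox (l, c) (r, d). f x = 0" using assms(3) by blast
  moreover have "continuous_on aff f" by (rule continuous_on_subset[OF assms(1) subset_UNIV])
  ultimately show ?thesis
    unfolding Cc_def mem_Collect_eq by (intro conjI exI[of _ "cbox (l, c) (r, d)"] compact_cbox)
qed

lemma wild_Cc: "wild M \<in> Cc"
proof (rule CcI)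
  show "continuous_on UNIV (wild M)"
    unfolding wild_def [abs_def]
    by (intro continuous_intros continuous_on_compose2[OF continuous_lacunary]) auto
  show "y \<in> cbox (-1, 1) (1, 5)" if "wild M y \<noteq> 0" for y
    using that tent_supp[of 1 5 "snd y"] tent_supp[of "-1" 1 "fst y"] by (cases y) (auto simp: wild_def)
qed simp

lemma plateau_Cc: "plateau \<in> Cc"
proof (rule CcI)
  show "continuous_on UNIV plateau"
    unfolding plateau_def [abs_def] by (intro continuous_intros)
  show "y \<in> cbox (-3, 1) (3, 21)" if "plateau y \<noteq> 0" for y
    using that tent_supp[of 1 21 "snd y"] tent_supp[of "-3" 3 "fst y"] by (cases y) (auto simp: plateau_def)
qed simp

definition Q :: "(real \<times> real) set" where
  "Q = cbox (-1, 10) (1, 20)"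

lemma Q_aff: "x \<in> Q \<Longrightarrow> x \<in> aff"
  by (cases x) (auto simp: Q_def aff_def)

text \<open>For \<open>x = (B, A) \<in> Q\<close> and \<open>(b, a)\<close> in the support of \<open>wild M\<close> the point \<open>(b, a)\<inverse>x =
  ((B - b)/a, A/a)\<close> satisfies \<open>\<bar>B - b\<bar>/a \<le> 2\<close> and \<open>2 \<le> A/a \<le> 20\<close>, where \<open>plateau\<close> is \<open>1\<close>.\<close>

lemma aff_kernel_wild:
  assumes x: "x \<in> Q"
  shows "aff_kernel (wild M) plateau x y = wild M y"
proof (cases "wild M y = 0")
  case True
  then show ?thesis by (simp add: aff_kernel_def)
next
  case False
  obtain b a where y: "y = (b, a)" by (cases y)
  obtain B A where xBA: "x = (B, A)" by (cases x)
  have ba: "1 < a" "a < 5" "-1 < b" "b < 1"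
    using False tent_supp[of 1 5 a] tent_supp[of "-1" 1 b] by (auto simp: y wild_def)
  have BA: "-1 \<le> B" "B \<le> 1" "10 \<le> A" "A \<le> 20" using x by (auto simp: xBA Q_def)
  have yaff: "y \<in> aff" using ba by (simp add: y aff_def)
  have "aff_mult (aff_inv y) x = ((B - b) / a, A / a)"
    using ba by (simp add: y xBA aff_mult_def aff_inv_def field_simps)
  moreover have "tent (-3) 3 ((B - b) / a) = 1"
    using ba BA by (intro tent_one) (auto simp: field_simps)
  moreover have "tent 1 21 (A / a) = 1"
    using ba BA by (intro tent_one) (auto simp: field_simps)
  ultimately have "plateau (aff_mult (aff_inv y) x) = 1" by (simp add: plateau_def)
  then show ?thesis using aff_kernel_eq[OF Q_aff[OF x] yaff, of "wild M" plateau] by simp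
qed

section \<open>The Fourier transform of a lacunary bump\<close>

text \<open>The Fourier transform of the triangle; the value at \<open>0\<close> stays the integral that it is, as
  its sign is evident.\<close>

definition triangle_ft :: "real \<Rightarrow> real" where
  "triangle_ft \<xi> = (if \<xi> = 0 then LINT b|lborel. tent (-1) 1 b else (2 - 2 * cos \<xi>) / \<xi>\<^sup>2)"

lemma tent_integrable: "integrable lborel (tent l r)"
proof (rule Bochner_Integration.integrable_bound)
  show "integrable lborel (indicator {l..r} :: real \<Rightarrow> real)"
    by (intro integrable_real_indicator) (auto simp: emeasure_lborel_Icc_eq)
  have "norm (tent l r x) \<le> norm (indicator {l..r} x :: real)" for x
    using tent_bounds[of l r x] tent_supp[of l r x] by (cases "tent l r x = 0") auto
  then show "AE x in lborel. norm (tent l r x) \<le> norm (indicator {l..r} x :: real)" by simp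
qed simp

text \<open>On each of the intervals \<open>[-1, 0]\<close> and \<open>[0, 1]\<close> the integrand has an elementary
  antiderivative.\<close>

lemma integral_triangle_exp:
  "(LINT b|lborel. complex_of_real (tent (-1) 1 b) * exp (- \<i> * complex_of_real (b * \<xi>))) =
    complex_of_real (triangle_ft \<xi>)"
proof (cases "\<xi> = 0")
  case True
  then show ?thesis by (simp add: triangle_ft_def)
next
  case False
  define z where "z = - \<i> * complex_of_real \<xi>"
  have z: "z \<noteq> 0" using False by (simp add: z_def)
  have 1: "has_bochner_integral lborel (\<lambda>b. indicator {0..1} b *\<^sub>R ((1 - complex_of_real b) * exp (z * complex_of_real b)))
      ((1 - complex_of_real 1) * exp (z * complex_of_real 1) / z + exp (z * complex_of_real 1) / z\<^sup>2 -
       ((1 - complex_of_real 0) * exp (z * complex_of_real 0) / z + exp (z * complex_of_real 0) / z\<^sup>2))"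
  proof (rule has_bochner_integral_FTC_Icc)
    fix b :: real
    have "((\<lambda>w. (1 - w) * exp (z * w) / z + exp (z * w) / z\<^sup>2) has_field_derivative
        (1 - complex_of_real b) * exp (z * complex_of_real b)) (at (complex_of_real b))"
      using z by (auto intro!: derivative_eq_intros simp: field_simps power2_eq_square)
    then show "((\<lambda>b. (1 - complex_of_real b) * exp (z * complex_of_real b) / z +
        exp (z * complex_of_real b) / z\<^sup>2) has_vector_derivative
        (1 - complex_of_real b) * exp (z * complex_of_real b)) (at b within {0..1})"
      by (rule has_vector_derivative_real_field)
  qed (auto intro!: continuous_intros)
  have 2: "has_bochner_integral lborel (\<lambda>b. indicator {-1..0} b *\<^sub>R ((1 + complex_of_real b) * exp (z * complex_of_real b)))
      ((1 + complex_of_real 0) * exp (z * complex_of_real 0) / z - exp (z * complex_of_real 0) / z\<^sup>2 -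
       ((1 + complex_of_real (-1)) * exp (z * complex_of_real (-1)) / z - exp (z * complex_of_real (-1)) / z\<^sup>2))"
  proof (rule has_bochner_integral_FTC_Icc)
    fix b :: real
    have "((\<lambda>w. (1 + w) * exp (z * w) / z - exp (z * w) / z\<^sup>2) has_field_derivative
        (1 + complex_of_real b) * exp (z * complex_of_real b)) (at (complex_of_real b))"
      using z by (auto intro!: derivative_eq_intros simp: field_simps power2_eq_square)
    then show "((\<lambda>b. (1 + complex_of_real b) * exp (z * complex_of_real b) / z -
        exp (z * complex_of_real b) / z\<^sup>2) has_vector_derivative
        (1 + complex_of_real b) * exp (z * complex_of_real b)) (at b within {-1..0})"
      by (rule has_vector_derivative_real_field)
  qed (auto intro!: continuous_intros)
  let ?p = "\<lambda>b. indicator {0..1} b *\<^sub>R ((1 - complex_of_real b) * exp (z * complex_of_real b))"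
  let ?q = "\<lambda>b. indicator {-1..0} b *\<^sub>R ((1 + complex_of_real b) * exp (z * complex_of_real b))"
  have "(LINT b|lborel. complex_of_real (tent (-1) 1 b) * exp (- \<i> * complex_of_real (b * \<xi>))) =
      (LINT b|lborel. ?p b + ?q b)"
  proof (rule integral_cong_AE)
    have "AE b in lborel. b \<noteq> (0::real)" by (rule AE_lborel_singleton)
    then show "AE b in lborel. complex_of_real (tent (-1) 1 b) * exp (- \<i> * complex_of_real (b * \<xi>)) = ?p b + ?q b"
    proof eventually_elim
      case (elim b)
      have "- \<i> * complex_of_real (b * \<xi>) = z * complex_of_real b" by (simp add: z_def)
      moreover have "complex_of_real (tent (-1) 1 b) =
          indicator {0..1} b *\<^sub>R (1 - complex_of_real b) + indicator {-1..0} b *\<^sub>R (1 + complex_of_real b)"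
        using elim by (auto simp: tent_def indicator_def max_def min_def)
      ultimately show ?case by (simp add: distrib_right)
    qed
  qed simp_all
  also note has_bochner_integral_integral_eq[OF has_bochner_integral_add[OF 1 2]]
  also have "(1 - complex_of_real 1) * exp (z * complex_of_real 1) / z + exp (z * complex_of_real 1) / z\<^sup>2 -
      ((1 - complex_of_real 0) * exp (z * complex_of_real 0) / z + exp (z * complex_of_real 0) / z\<^sup>2) +
      ((1 + complex_of_real 0) * exp (z * complex_of_real 0) / z - exp (z * complex_of_real 0) / z\<^sup>2 -
       ((1 + complex_of_real (-1)) * exp (z * complex_of_real (-1)) / z - exp (z * complex_of_real (-1)) / z\<^sup>2)) =
      (exp z + exp (- z) - 2) / z\<^sup>2"
    using z by (simp add: field_simps power2_eq_square)
  also have "exp z + exp (- z) = complex_of_real (2 * cos \<xi>)"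
    by (simp add: z_def cos_exp_eq flip: cos_of_real)
  also have "z\<^sup>2 = - complex_of_real (\<xi>\<^sup>2)" by (simp add: z_def power_mult_distrib)
  finally show ?thesis using False by (simp add: triangle_ft_def field_simps)
qed

lemma triangle_ft_nonneg: "0 \<le> triangle_ft \<xi>"
  by (auto simp: triangle_ft_def tent_bounds intro!: integral_nonneg_AE divide_nonneg_nonneg)

lemma triangle_ft_le: "triangle_ft \<xi> \<le> (LINT b|lborel. tent (-1) 1 b)"
proof -
  have "triangle_ft \<xi> = cmod (LINT b|lborel. complex_of_real (tent (-1) 1 b) * exp (- \<i> * complex_of_real (b * \<xi>)))"
    unfolding integral_triangle_exp by (simp add: triangle_ft_nonneg)
  also have "\<dots> \<le> (LINT b|lborel. cmod (complex_of_real (tent (-1) 1 b) * exp (- \<i> * complex_of_real (b * \<xi>))))"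
    by (rule integral_norm_bound)
  finally show ?thesis by (simp add: norm_mult tent_bounds)
qed

lemma triangle_ft_ge:
  assumes "1 \<le> \<xi>" "\<xi> \<le> 2"
  shows "(1 - cos 1) / 2 \<le> triangle_ft \<xi>"
proof -
  have "cos \<xi> \<le> cos 1" using assms pi_gt3 by (intro cos_monotone_0_pi_le) auto
  moreover have "\<xi>\<^sup>2 \<le> 2\<^sup>2" using assms by (intro power_mono) auto
  ultimately have "(2 - 2 * cos 1) / 4 \<le> (2 - 2 * cos \<xi>) / \<xi>\<^sup>2"
    using assms by (intro frac_le) auto
  moreover have "triangle_ft \<xi> = (2 - 2 * cos \<xi>) / \<xi>\<^sup>2" "(1 - cos 1) / 2 = (2 - 2 * cos 1) / (4::real)"
    using assms by (simp_all add: triangle_ft_def)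
  ultimately show ?thesis by (simp only:)
qed

definition lacunary_ft :: "real \<Rightarrow> real \<Rightarrow> real" where
  "lacunary_ft M s = (\<Sum>j. (1/2) ^ j * triangle_ft (s - M ^ j))"

lemma summable_lacunary_ft: "summable (\<lambda>j. (1/2) ^ j * triangle_ft (s - M ^ j))"
proof (rule summable_comparison_test)
  show "summable (\<lambda>j. (1/2) ^ j * (LINT b|lborel. tent (-1) 1 b))"
    by (intro summable_mult2 summable_geometric) simp
  show "\<exists>N. \<forall>n\<ge>N. norm ((1/2) ^ n * triangle_ft (s - M ^ n)) \<le> (1/2) ^ n * (LINT b|lborel. tent (-1) 1 b)"
    using triangle_ft_le triangle_ft_nonneg by (auto simp: norm_mult intro!: mult_left_mono)
qed

lemma lacunary_ft_nonneg: "0 \<le> lacunary_ft M s"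
  unfolding lacunary_ft_def by (intro suminf_nonneg summable_lacunary_ft mult_nonneg_nonneg triangle_ft_nonneg) simp

text \<open>Positivity of the Fourier transform of the triangle makes every frequency contribute with
  the same sign.\<close>

lemma lacunary_ft_ge:
  assumes "M ^ k + 1 \<le> s" "s \<le> M ^ k + 2"
  shows "(1/2) ^ k * ((1 - cos 1) / 2) \<le> lacunary_ft M s"
proof -
  have "(1/2) ^ k * ((1 - cos 1) / 2) \<le> (1/2) ^ k * triangle_ft (s - M ^ k)"
    using assms by (intro mult_left_mono triangle_ft_ge) auto
  also have "\<dots> \<le> lacunary_ft M s"
    unfolding lacunary_ft_def using sum_le_suminf[OF summable_lacunary_ft, of "{k}" s M]
    by (simp add: triangle_ft_nonneg)
  finally show ?thesis .
qed

lemma integral_wild_exp: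
  "(LINT b|lborel. wild M (b, a) * exp (- \<i> * complex_of_real (b * s))) =
    complex_of_real (tent 1 5 a * lacunary_ft M s)"
proof -
  let ?t = "\<lambda>j b. complex_of_real ((1/2) ^ j) * (complex_of_real (tent (-1) 1 b) * exp (- \<i> * complex_of_real (b * (s - M ^ j))))"
  have n: "norm (?t j b) = (1/2) ^ j * tent (-1) 1 b" for j b
    by (simp add: norm_mult norm_power norm_divide tent_bounds)
  have int: "integrable lborel (?t j)" for j
    by (rule Bochner_Integration.integrable_bound[OF integrable_mult_right[OF tent_integrable[of "-1" 1], of "(1/2) ^ j"]])
      (use n in \<open>auto simp: norm_mult norm_power norm_divide tent_bounds\<close>)
  have sm: "summable (\<lambda>j. norm (?t j b))" for b
    unfolding n by (intro summable_mult2 summable_geometric) simp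
  have "wild M (b, a) * exp (- \<i> * complex_of_real (b * s)) = complex_of_real (tent 1 5 a) * (\<Sum>j. ?t j b)" for b
  proof -
    let ?e = "\<lambda>j. complex_of_real ((1/2) ^ j) * exp (\<i> * complex_of_real (M ^ j * b))"
    have "summable ?e"
      by (rule summable_norm_cancel) (simp add: norm_mult norm_power norm_divide summable_geometric)
    then have "lacunary M b * (complex_of_real (tent (-1) 1 b) * exp (- \<i> * complex_of_real (b * s))) =
        (\<Sum>j. ?e j * (complex_of_real (tent (-1) 1 b) * exp (- \<i> * complex_of_real (b * s))))"
      unfolding lacunary_def by (rule suminf_mult2)
    also have "\<dots> = (\<Sum>j. ?t j b)"
    proof (rule suminf_cong)
      fix j
      have "exp (\<i> * complex_of_real (M ^ j * b)) * exp (- \<i> * complex_of_real (b * s)) =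
          exp (- \<i> * complex_of_real (b * (s - M ^ j)))"
        unfolding exp_add [symmetric] by (rule arg_cong[of _ _ exp]) (simp add: algebra_simps)
      then show "?e j * (complex_of_real (tent (-1) 1 b) * exp (- \<i> * complex_of_real (b * s))) = ?t j b"
        by (metis (no_types, lifting) mult.assoc mult.left_commute)
    qed
    finally show ?thesis by (simp add: wild_def ac_simps)
  qed
  then have "(LINT b|lborel. wild M (b, a) * exp (- \<i> * complex_of_real (b * s))) =
      complex_of_real (tent 1 5 a) * (LINT b|lborel. (\<Sum>j. ?t j b))"
    by simp
  also have "(LINT b|lborel. (\<Sum>j. ?t j b)) = (\<Sum>j. LINT b|lborel. ?t j b)"
  proof (rule integral_suminf[OF int])
    show "AE b in lborel. summable (\<lambda>j. norm (?t j b))" using sm by simp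
    have "summable (\<lambda>j. (1/2) ^ j * (LINT b|lborel. tent (-1) 1 b))"
      by (intro summable_mult2 summable_geometric) simp
    then show "summable (\<lambda>j. LINT b|lborel. norm (?t j b))" unfolding n by simp
  qed
  also have "\<dots> = (\<Sum>j. complex_of_real ((1/2) ^ j * triangle_ft (s - M ^ j)))"
    by (intro suminf_cong) (simp only: integral_mult_right_zero integral_triangle_exp, simp only: of_real_mult)
  also have "\<dots> = complex_of_real (lacunary_ft M s)"
    unfolding lacunary_ft_def by (rule suminf_of_real[OF summable_lacunary_ft, symmetric])
  finally show ?thesis by simp
qed

section \<open>Unboundedness of the product\<close>

text \<open>The vector spanning the range of the symbol. Its spikes sit next to the frequencies \<open>M\<^sup>k\<close>, at a
  distance between \<open>1\<close> and \<open>2\<close>, where \<open>triangle_ft_ge\<close> bounds the Fourier transform of the triangle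
  from below.\<close>

definition spikes :: "real \<Rightarrow> real \<Rightarrow> real" where
  "spikes M s = (\<Sum>k. (1/2) ^ k * indicator {M ^ k + 1..M ^ k + 2} s)"

lemma summable_spikes: "summable (\<lambda>k. (1/2) ^ k * indicator {M ^ k + 1..M ^ k + 2} s :: real)"
  by (rule summable_comparison_test[where g = "\<lambda>k. (1/2) ^ k"])
    (auto simp: indicator_def summable_geometric)

lemma spikes_nonneg: "0 \<le> spikes M s"
  unfolding spikes_def by (intro suminf_nonneg summable_spikes) simp

lemma spikes_ge: "M ^ k + 1 \<le> s \<Longrightarrow> s \<le> M ^ k + 2 \<Longrightarrow> (1/2) ^ k \<le> spikes M s"
  unfolding spikes_def using sum_le_suminf[OF summable_spikes, of "{k}" M s] by simp

lemma spikes_le: "spikes M s \<le> 2"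
proof -
  have "spikes M s \<le> (\<Sum>k. (1/2) ^ k)"
    unfolding spikes_def by (intro suminf_le summable_spikes) (auto simp: indicator_def summable_geometric)
  also have "\<dots> = 2" by (simp add: suminf_geometric)
  finally show ?thesis .
qed

text \<open>The vector is square integrable, as its spikes have unit width and summable heights.\<close>

lemma spikes_L2: "(\<lambda>s. complex_of_real (spikes M s)) \<in> L2 (HL \<rho>)"
proof -
  have [measurable]: "spikes M \<in> borel_measurable borel" unfolding spikes_def [abs_def] by measurable
  have "(\<integral>\<^sup>+s. ennreal ((cmod (complex_of_real (spikes M s)))\<^sup>2) \<partial>HL \<rho>) \<le>
      (\<integral>\<^sup>+s. ennreal ((cmod (complex_of_real (spikes M s)))\<^sup>2) \<partial>lborel)"
    unfolding nn_integral_ext by (intro nn_integral_mono) (auto simp: ext_def indicator_def)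
  also have "\<dots> \<le> (\<integral>\<^sup>+s. 2 * (\<Sum>k. ennreal ((1/2) ^ k) * indicator {M ^ k + 1..M ^ k + 2} s) \<partial>lborel)"
  proof (rule nn_integral_mono)
    fix s
    have "(spikes M s)\<^sup>2 \<le> 2 * spikes M s"
      unfolding power2_eq_square by (intro mult_right_mono spikes_le spikes_nonneg)
    then have "ennreal ((cmod (complex_of_real (spikes M s)))\<^sup>2) \<le> 2 * ennreal (spikes M s)"
      by (simp add: ennreal_leI flip: ennreal_mult' ennreal_numeral)
    also have "ennreal (spikes M s) = (\<Sum>k. ennreal ((1/2) ^ k * indicator {M ^ k + 1..M ^ k + 2} s))"
      unfolding spikes_def by (intro suminf_ennreal2[symmetric] summable_spikes) simp
    also have "\<dots> = (\<Sum>k. ennreal ((1/2) ^ k) * indicator {M ^ k + 1..M ^ k + 2} s)"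
      by (intro suminf_cong) (simp add: indicator_def)
    finally show "ennreal ((cmod (complex_of_real (spikes M s)))\<^sup>2) \<le>
        2 * (\<Sum>k. ennreal ((1/2) ^ k) * indicator {M ^ k + 1..M ^ k + 2} s)" .
  qed
  also have "\<dots> = 2 * (\<Sum>k. \<integral>\<^sup>+s. ennreal ((1/2) ^ k) * indicator {M ^ k + 1..M ^ k + 2} s \<partial>lborel)"
    by (simp add: nn_integral_cmult nn_integral_suminf)
  also have "\<dots> = 2 * (\<Sum>k. ennreal ((1/2) ^ k))"
    by (intro arg_cong[of _ _ "(*) 2"] suminf_cong) (simp add: nn_integral_cmult_indicator)
  also have "(\<Sum>k. ennreal ((1/2) ^ k)) = ennreal (\<Sum>k. (1/2) ^ k)"
    by (intro suminf_ennreal2) (auto simp: summable_geometric)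
  finally have "(\<integral>\<^sup>+s. ennreal ((cmod (complex_of_real (spikes M s)))\<^sup>2) \<partial>HL \<rho>) < \<infinity>"
    by (rule le_less_trans) (simp add: ennreal_mult_less_top)
  moreover have "(\<lambda>s. complex_of_real (spikes M s)) \<in> borel_measurable (HL \<rho>)"
    by (intro borel_measurable_HL) measurable
  ultimately show ?thesis by (simp add: L2_iff_nn_integral)
qed

text \<open>The result of applying \<open>K\<^bsup>r\<^esup>\<close> to the indicator of \<open>[2N, 12N]\<close>.\<close>

definition test_fun :: "real \<Rightarrow> real \<Rightarrow> real \<Rightarrow> real" where
  "test_fun N r s = \<bar>s\<bar> powr r * indicator {2 * N..12 * N} s"

lemma test_fun_nonneg: "0 \<le> test_fun N r s"
  by (simp add: test_fun_def)

lemma test_fun_le: "1 \<le> N \<Longrightarrow> 0 \<le> r \<Longrightarrow> test_fun N r s \<le> (12 * N) powr r"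
  by (auto simp: test_fun_def indicator_def intro: powr_mono2)

lemma test_fun_measurable [measurable]: "test_fun N r \<in> borel_measurable borel"
  unfolding test_fun_def [abs_def] by measurable

lemma test_fun_L2:
  assumes "1 \<le> N" "0 \<le> r"
  shows "(\<lambda>s. complex_of_real (test_fun N r s)) \<in> L2 (HL \<rho>)"
proof -
  have m: "(\<lambda>s. complex_of_real (test_fun N r s)) \<in> borel_measurable (HL \<rho>)"
    by (intro borel_measurable_HL) measurable
  have "(\<integral>\<^sup>+s. ennreal ((cmod (complex_of_real (test_fun N r s)))\<^sup>2) \<partial>HL \<rho>) \<le>
      (\<integral>\<^sup>+s. ennreal ((cmod (complex_of_real (test_fun N r s)))\<^sup>2) \<partial>lborel)"
    unfolding nn_integral_ext by (intro nn_integral_mono) (auto simp: ext_def indicator_def)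
  also have "\<dots> \<le> (\<integral>\<^sup>+s. ennreal (((12 * N) powr r)\<^sup>2) * indicator {2 * N..12 * N} s \<partial>lborel)"
  proof (rule nn_integral_mono)
    fix s
    have "(test_fun N r s)\<^sup>2 \<le> ((12 * N) powr r)\<^sup>2"
      using assms by (intro power_mono test_fun_le test_fun_nonneg)
    then show "ennreal ((cmod (complex_of_real (test_fun N r s)))\<^sup>2) \<le>
        ennreal (((12 * N) powr r)\<^sup>2) * indicator {2 * N..12 * N} s"
      by (cases "s \<in> {2 * N..12 * N}") (auto simp: ennreal_leI, simp_all add: test_fun_def)
  qed
  also have "\<dots> < \<infinity>"
    by (subst nn_integral_cmult_indicator) (auto simp: ennreal_mult_less_top emeasure_lborel_Icc_eq)
  finally show ?thesis using m by (simp add: L2_iff_nn_integral)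
qed

lemma l2norm_test_fun:
  assumes N: "1 \<le> N"
  shows "l2norm (HL \<rho>) (\<lambda>s. complex_of_real (test_fun N 0 s)) \<le> sqrt (10 * N)"
proof (rule l2norm_le(2))
  show "(\<lambda>s. complex_of_real (test_fun N 0 s)) \<in> borel_measurable (HL \<rho>)"
    using test_fun_L2[OF N order_refl] by (rule L2_measurable)
  have "(\<integral>\<^sup>+s. ennreal ((cmod (complex_of_real (test_fun N 0 s)))\<^sup>2) \<partial>HL \<rho>) \<le>
      (\<integral>\<^sup>+s. ennreal ((cmod (complex_of_real (test_fun N 0 s)))\<^sup>2) \<partial>lborel)"
    unfolding nn_integral_ext by (intro nn_integral_mono) (auto simp: ext_def indicator_def)
  also have "\<dots> \<le> (\<integral>\<^sup>+s. indicator {2 * N..12 * N} s \<partial>lborel)"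
    using N by (intro nn_integral_mono) (auto simp: test_fun_def indicator_def)
  also have "\<dots> = ennreal ((sqrt (10 * N))\<^sup>2)" using N by simp
  finally show "(\<integral>\<^sup>+s. ennreal ((cmod (complex_of_real (test_fun N 0 s)))\<^sup>2) \<partial>HL \<rho>) \<le> ennreal ((sqrt (10 * N))\<^sup>2)" .
qed (use N in simp)

lemma test_fun_K:
  assumes "1 \<le> N" "0 \<le> r"
  shows "(\<lambda>s. complex_of_real (test_fun N 0 s), \<lambda>s. complex_of_real (test_fun N r s)) \<in> K \<rho> r"
proof -
  have eq: "complex_of_real (test_fun N r s) =
      complex_of_real (\<bar>s\<bar> powr r) * complex_of_real (test_fun N 0 s)" for s
    using assms(1) by (auto simp: test_fun_def indicator_def)
  show ?thesis
    unfolding K_def mem_Collect_eq prod.case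
    by (intro conjI test_fun_L2 assms order_refl AE_I2 eq)
qed

text \<open>For \<open>s\<close> in the spike at \<open>N = M\<^sup>k\<close> and \<open>2 \<le> a \<le> 4\<close> the point \<open>as\<close> lies between \<open>2N\<close> and \<open>4(N + 2) \<le> 12N\<close>,
  in the support of the test function; there the integrand is at least \<open>N\<^bsup>r\<^esup>/16\<close>.\<close>

lemma dilated_mass_ge:
  fixes k :: nat
  assumes M: "1 \<le> M" and r: "0 \<le> r" and s: "M ^ k + 1 \<le> s" "s \<le> M ^ k + 2"
  defines "N \<equiv> M ^ k"
  shows "N powr r / 8 \<le> (LINT a|lborel. a powr (1/2) / a\<^sup>2 * test_fun N r (a * s) * tent 1 5 a)"
    (is "_ \<le> (LINT a|lborel. ?h a)")
proof -
  have N: "1 \<le> N" unfolding N_def using M by (rule one_le_power)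
  have le: "?h a \<le> (sqrt 5 * (12 * N) powr r) * indicator {1..5} a" for a
  proof (cases "1 < a \<and> a < 5")
    case True
    have "1 \<le> a\<^sup>2" using True by (simp add: one_le_power)
    then have "a powr (1/2) / a\<^sup>2 \<le> sqrt 5 / 1"
      using True by (intro frac_le) (auto simp: powr_half_sqrt)
    then have "a powr (1/2) / a\<^sup>2 * test_fun N r (a * s) * tent 1 5 a \<le> sqrt 5 * (12 * N) powr r * 1"
      using N r by (intro mult_mono tent_bounds test_fun_le) (auto simp: test_fun_nonneg tent_bounds)
    then show ?thesis using True by simp
  next
    case False
    then have "tent 1 5 a = 0" using tent_supp[of 1 5 a] by blast
    then show ?thesis by simp
  qed
  have nonneg: "0 \<le> ?h a" for a by (simp add: test_fun_nonneg tent_bounds)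
  have int: "integrable lborel ?h"
  proof (rule Bochner_Integration.integrable_bound)
    show "integrable lborel (\<lambda>a::real. (sqrt 5 * (12 * N) powr r) * indicator {1..5} a)"
      by (intro integrable_mult_right integrable_real_indicator) auto
    show "AE a in lborel. norm (?h a) \<le> norm ((sqrt 5 * (12 * N) powr r) * indicator {1..5} a)"
    proof (rule AE_I2)
      fix a
      have "norm (?h a) = ?h a" using nonneg[of a] by (simp only: real_norm_def abs_of_nonneg)
      also note le[of a]
      finally show "norm (?h a) \<le> norm ((sqrt 5 * (12 * N) powr r) * indicator {1..5} a)" by simp
    qed
  qed measurable
  have ge: "N powr r / 16 * indicator {2..4} a \<le> ?h a" for a
  proof (cases "a \<in> {2..4}")
    case True
    have a: "2 \<le> a" "a \<le> 4" using True by auto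
    have "2 * N \<le> a * s" using a s N by (intro mult_mono) (auto simp: N_def)
    moreover have "a * s \<le> 4 * (N + 2)" using a s N by (intro mult_mono) (auto simp: N_def)
    ultimately have "test_fun N r (a * s) = (a * s) powr r"
      using N by (auto simp: test_fun_def indicator_def)
    moreover have "N powr r \<le> (a * s) powr r"
      using \<open>2 * N \<le> a * s\<close> N r by (intro powr_mono2) auto
    moreover have "tent 1 5 a = 1" using a by (intro tent_one) auto
    moreover have "1 / 16 \<le> a powr (1/2) / a\<^sup>2"
      using a power_mono[of a 4 2] by (intro frac_le) (auto simp: powr_half_sqrt)
    ultimately have "1 / 16 * N powr r \<le> ?h a"
      using mult_mono[of "1/16" "a powr (1/2) / a\<^sup>2" "N powr r" "(a * s) powr r"] by simp
    then show ?thesis using True by simp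
  qed (use nonneg in simp)
  have "N powr r / 8 = (LINT a|lborel. N powr r / 16 * indicator {2..4::real} a)" by simp
  also have "\<dots> \<le> (LINT a|lborel. ?h a)"
    using ge by (intro integral_mono int integrable_mult_right integrable_real_indicator) auto
  finally show ?thesis .
qed

text \<open>All factors of the integrand are nonnegative, so restricting the integral to the \<open>k\<close>-th spike
  gives a lower bound. Both the Fourier coefficient and the height of the spike contribute
  \<open>2\<^bsup>-k\<^esup>\<close>.\<close>

lemma wigner_coefficient_ge:
  fixes k :: nat
  assumes M: "1 \<le> M" and r: "0 \<le> r" and x: "x \<in> Q"
    and w: "((\<lambda>s. complex_of_real (test_fun (M ^ k) r s)), w) \<in> wigner_Cc (wild M) plateau x rho_plus"
  shows "(1/4) ^ k * (M ^ k) powr r * ((1 - cos 1) / 16) \<le>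
    cmod (ip (HL rho_plus) w (\<lambda>s. complex_of_real (spikes M s)))"
proof -
  define N where "N = M ^ k"
  have N: "1 \<le> N" unfolding N_def using M by (rule one_le_power)
  let ?HL = "HL rho_plus"
  let ?v = "\<lambda>s. complex_of_real (test_fun N r s)" and ?\<psi> = "\<lambda>s. complex_of_real (spikes M s)"
  from box_kernel_aff_kernel[OF wild_Cc[of M] plateau_Cc Q_aff[OF x]]
  obtain R a0 a1 C where "box_kernel (aff_kernel (wild M) plateau x) R a0 a1 C" .
  moreover have keq: "aff_kernel (wild M) plateau x = wild M" using aff_kernel_wild[OF x] by blast
  ultimately interpret box_kernel "wild M" R a0 a1 C by simp
  have v: "?v \<in> L2 ?HL" using N r by (rule test_fun_L2)
  have W: "(?v, w) \<in> weak_integral rho_plus"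
    using w wigner_Cc_eq[of "wild M" plateau x R a0 a1 C rho_plus] box_kernel_axioms x
    by (simp add: keq Q_aff N_def)
  define m where "m s = (LINT a|lborel. weight a * test_fun N r (a * s) * tent 1 5 a)" for s
  have int_op: "int_op rho_plus ?v s = complex_of_real (lacunary_ft M s * m s)" for s
  proof -
    have "ext rho_plus ?v t = ?v t" for t
      using N by (auto simp: ext_def test_fun_def indicator_def)
    then have "int_op rho_plus ?v s = (LINT a|lborel. complex_of_real (lacunary_ft M s) *
        complex_of_real (weight a * test_fun N r (a * s) * tent 1 5 a))"
      unfolding int_op_def ft_def integral_wild_exp
      by (intro Bochner_Integration.integral_cong refl) simp
    also have "\<dots> = complex_of_real (lacunary_ft M s * m s)"
      unfolding m_def of_real_mult[of "lacunary_ft M s"]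
      by (simp only: integral_mult_right_zero integral_complex_of_real)
    finally show ?thesis .
  qed
  define h where "h s = lacunary_ft M s * m s * spikes M s" for s
  have m_nonneg: "0 \<le> m s" for s
    unfolding m_def by (intro integral_nonneg_AE) (simp add: weight_nonneg test_fun_nonneg tent_bounds)
  have h_nonneg: "0 \<le> h s" for s
    by (simp add: h_def m_nonneg lacunary_ft_nonneg spikes_nonneg)
  have hV: "complex_of_real (h s) = int_op rho_plus ?v s * cnj (?\<psi> s)" for s
    by (simp add: int_op h_def)
  have int: "integrable ?HL h"
    using ip_integrable[OF int_op_bounded(1)[OF v] spikes_L2[of M rho_plus]]
    unfolding hV [symmetric] by (simp add: complex_of_real_integrable_eq)
  have ip: "ip ?HL w ?\<psi> = complex_of_real (LINT s|?HL. h s)"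
  proof -
    have "ip ?HL w ?\<psi> = ip ?HL (int_op rho_plus ?v) ?\<psi>"
      using W v spikes_L2[of M rho_plus] by (simp add: weak_integral_iff ip_int_op)
    also have "\<dots> = (LINT s|?HL. complex_of_real (h s))"
      unfolding ip_def hV ..
    finally show ?thesis by simp
  qed
  define c where "c = (1/4) ^ k * N powr r * ((1 - cos 1) / 16)"
  have c: "0 \<le> c" by (simp add: c_def)
  have ge: "c * indicator {N + 1..N + 2} s \<le> h s" for s
  proof (cases "s \<in> {N + 1..N + 2}")
    case True
    then have s: "M ^ k + 1 \<le> s" "s \<le> M ^ k + 2" by (auto simp: N_def)
    have "N powr r / 8 \<le> m s"
      unfolding m_def weight_def N_def using M r s by (rule dilated_mass_ge)
    then have "(1/2) ^ k * ((1 - cos 1) / 2) * (N powr r / 8) * (1/2) ^ k \<le> h s"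
      unfolding h_def using s
      by (intro mult_mono lacunary_ft_ge spikes_ge mult_nonneg_nonneg lacunary_ft_nonneg m_nonneg) auto
    moreover have "(1/2) ^ k * ((1 - cos 1) / 2) * (N powr r / 8) * (1/2) ^ k = c"
    proof -
      have "(1/2 :: real) ^ k * (1/2) ^ k = (1/4) ^ k" by (simp flip: power_mult_distrib)
      then have "((1/2) ^ k * (1/2) ^ k) * (N powr r * ((1 - cos 1) / 16)) = c"
        by (simp only: c_def mult.assoc)
      then show ?thesis by (simp add: ac_simps)
    qed
    ultimately show ?thesis using True by simp
  qed (simp add: h_nonneg)
  have "{N + 1..N + 2} \<subseteq> half_line rho_plus" using N by auto
  then have ms: "{N + 1..N + 2} \<in> sets ?HL" and em: "emeasure ?HL {N + 1..N + 2} = 1"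
    by (auto simp: HL_def sets_restrict_space_iff emeasure_restrict_space)
  have "c = (LINT s|?HL. c * indicator {N + 1..N + 2} s)"
    using ms em by (simp add: measure_def)
  also have "\<dots> \<le> (LINT s|?HL. h s)"
    using ge ms em by (intro integral_mono int integrable_mult_right integrable_real_indicator) auto
  finally show ?thesis
    unfolding ip c_def N_def by simp
qed

lemma op_adj_antimono: "A \<subseteq> B \<Longrightarrow> op_adj M B \<subseteq> op_adj M A"
  unfolding op_adj_def by blast

lemma op_closure_increasing:
  assumes "(u, v) \<in> A" "u \<in> L2 M" "v \<in> L2 M"
  shows "(u, v) \<in> op_closure M A"
proof -
  have "\<exists>un vn. (\<forall>n::nat. (un n, vn n) \<in> A) \<and> (\<lambda>n. l2norm M (\<lambda>x. un n x - u x)) \<longlonglongrightarrow> 0 \<and>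
      (\<lambda>n. l2norm M (\<lambda>x. vn n x - v x)) \<longlonglongrightarrow> 0"
    by (rule exI[of _ "\<lambda>n. u"], rule exI[of _ "\<lambda>n. v"]) (simp add: assms l2norm_zero)
  with assms show ?thesis by (simp add: op_closure_def)
qed

text \<open>The constant \<open>M\<close> is chosen with \<open>M\<^bsup>1/2-1/p\<^esup> = 8\<close>, so that the gain \<open>M\<^bsup>k(1/2-1/p)\<^esup>\<close> from the
  surplus of the Duflo-Moore factor exceeds the loss \<open>4\<^bsup>-k\<^esup>\<close> by \<open>2\<^sup>k\<close>.\<close>

lemma weyl_prod_unbounded:
  fixes p :: real
  assumes p: "2 < p" and x: "x \<in> Q"
  defines "M \<equiv> 8 powr (1 / (1/2 - 1/p))"
  assumes \<sigma>: "K rho_plus (1/p) O \<sigma> x rho_plus \<subseteq>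
      rank_one (HL rho_plus) unit_bump (\<lambda>s. complex_of_real (spikes M s))"
  shows "\<not> bounded_opr (HL rho_plus) (weyl_prod p \<sigma> (wigner_Cc (wild M) plateau) x rho_plus)"
proof
  let ?HL = "HL rho_plus" and ?w = "wigner_Cc (wild M) plateau"
  let ?\<psi> = "\<lambda>s. complex_of_real (spikes M s)"
  assume "bounded_opr ?HL (weyl_prod p \<sigma> ?w x rho_plus)"
  then obtain C where C: "\<And>u z. (u, z) \<in> weyl_prod p \<sigma> ?w x rho_plus \<Longrightarrow> l2norm ?HL z \<le> C * l2norm ?HL u"
    unfolding bounded_opr_def norm_bounded_def by blast
  define d where "d = 1/2 - 1/p"
  have d: "0 < d" using p by (simp add: d_def field_simps)
  have M: "1 \<le> M" unfolding M_def d_def [symmetric] using d by (simp add: ge_one_powr_ge_zero)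
  have Md: "M powr d = 8" using d by (simp add: M_def powr_powr flip: d_def)
  define r where "r = 1 - 1/p"
  have r: "0 \<le> r" "r = 1/2 + d" using p by (auto simp: r_def d_def field_simps)
  define c where "c = (1 - cos 1) / (16::real)"
  have "cos 1 < cos (0::real)" using pi_gt3 by (intro cos_monotone_0_pi) auto
  then have c: "0 < c" by (simp add: c_def)
  have main: "2 ^ k * c \<le> C * sqrt 10" for k :: nat
  proof -
    define N where "N = M ^ k"
    have N: "1 \<le> N" unfolding N_def using M by (rule one_le_power)
    let ?u = "\<lambda>s. complex_of_real (test_fun N 0 s)" and ?v = "\<lambda>s. complex_of_real (test_fun N r s)"
    have u: "?u \<in> L2 ?HL" and v: "?v \<in> L2 ?HL" using N r(1) by (auto intro: test_fun_L2)
    from box_kernel_aff_kernel[OF wild_Cc[of M] plateau_Cc Q_aff[OF x]]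
    obtain R a0 a1 D where bk: "box_kernel (aff_kernel (wild M) plateau x) R a0 a1 D" .
    from box_kernel.int_op_in_weak_integral[OF bk v]
    obtain w where w: "(?v, w) \<in> ?w x rho_plus"
      unfolding wigner_Cc_eq[OF bk Q_aff[OF x]] by blast
    then have wL: "w \<in> L2 ?HL" by (simp add: wigner_Cc_def)
    define z where "z = (\<lambda>s. ip ?HL w ?\<psi> * unit_bump s)"
    have "(w, z) \<in> rank_one ?HL ?\<psi> unit_bump"
      unfolding z_def using wL unit_bump(1) by (rule rank_oneI)
    then have "(w, z) \<in> op_adj ?HL (K rho_plus (1/p) O \<sigma> x rho_plus)"
      using op_adj_antimono[OF \<sigma>, of ?HL] by (auto simp: op_adj_rank_one unit_bump spikes_L2)
    then have A: "(?u, z) \<in> (K rho_plus (1 - 1/p) O ?w x rho_plus) O op_adj ?HL (K rho_plus (1/p) O \<sigma> x rho_plus)"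
      using test_fun_K[OF N r(1), of rho_plus] w unfolding r_def by blast
    have "z \<in> L2 ?HL" unfolding z_def by (intro L2_scale unit_bump)
    with A u have "(?u, z) \<in> weyl_prod p \<sigma> ?w x rho_plus"
      unfolding weyl_prod_def by (rule op_closure_increasing)
    from C[OF this] have le: "cmod (ip ?HL w ?\<psi>) \<le> C * l2norm ?HL ?u"
      by (simp add: z_def l2norm_scale unit_bump)
    have ge: "(1/4) ^ k * N powr r * c \<le> cmod (ip ?HL w ?\<psi>)"
      unfolding c_def N_def using M r(1) x w[unfolded N_def] by (rule wigner_coefficient_ge)
    have pos: "0 < (1/4) ^ k * N powr r * c" using N c by simp
    with le ge have "0 < C * l2norm ?HL ?u" by linarith
    then have "0 \<le> C"
      using mult_nonpos_nonneg[OF _ l2norm_nonneg[of ?HL ?u], of C] by linarith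
    then have "C * l2norm ?HL ?u \<le> C * sqrt (10 * N)"
      using l2norm_test_fun[OF N] by (intro mult_left_mono)
    with le ge have "(1/4) ^ k * N powr r * c \<le> (C * sqrt 10) * sqrt N"
      by (simp add: real_sqrt_mult)
    also have "N powr r = sqrt N * 8 ^ k"
    proof -
      have "N powr d = (M powr real k) powr d" using M by (simp add: N_def powr_realpow)
      also have "\<dots> = (M powr d) powr real k" by (simp add: powr_powr mult.commute)
      also have "\<dots> = 8 ^ k" by (simp add: Md powr_realpow)
      finally have "N powr d = 8 ^ k" .
      then show ?thesis using N by (simp add: r(2) powr_add powr_half_sqrt)
    qed
    finally have "(1/4) ^ k * 8 ^ k * c * sqrt N \<le> (C * sqrt 10) * sqrt N" by (simp add: ac_simps)
    moreover have "(1/4 :: real) ^ k * 8 ^ k = 2 ^ k" by (simp flip: power_mult_distrib)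
    ultimately show ?thesis using N by (simp add: mult_le_cancel_right)
  qed
  obtain k :: nat where "C * sqrt 10 / c < 2 ^ k" using real_arch_pow[of 2] by auto
  then have "C * sqrt 10 < 2 ^ k * c" using c by (simp add: divide_less_eq)
  with main[of k] show False by simp
qed

theorem theorem2p3:
  fixes p :: real
  assumes "2 < p"
  shows "\<exists>\<sigma>\<in>Lp_op p. \<not> weyl_bounded p \<sigma>"
proof -
  define M :: real where "M = 8 powr (1 / (1/2 - 1/p))"
  define \<phi> where "\<phi> s = complex_of_real (\<bar>s\<bar> powr (- 1/p)) * unit_bump s" for s
  define \<psi> where "\<psi> = (\<lambda>s. complex_of_real (spikes M s))"
  define \<sigma> :: op_field where "\<sigma> = (\<lambda>x \<rho>. rank_one (HL \<rho>) \<phi> (\<lambda>s. indicator Q x * \<psi> s))"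
  have \<psi>: "\<psi> \<in> L2 (HL \<rho>)" for \<rho> unfolding \<psi>_def by (rule spikes_L2)
  have \<phi>: "\<phi> \<in> L2 (HL \<rho>)" for \<rho>
    using unit_bump(1)[of \<rho>]
  proof (rule L2_dominated[where C = 1])
    show "\<phi> \<in> borel_measurable (HL \<rho>)"
      unfolding \<phi>_def [abs_def]
      using powr_HL_measurable unit_bump(1)[THEN L2_measurable] by (rule borel_measurable_times)
    fix s
    have "\<bar>s\<bar> powr (- 1/p) \<le> 1" if "1 \<le> \<bar>s\<bar>"
      using powr_mono[of "-1/p" 0 "\<bar>s\<bar>"] that assms by (cases "s = 0") simp_all
    then show "cmod (\<phi> s) \<le> 1 * cmod (unit_bump s)"
      by (auto simp: \<phi>_def unit_bump_def indicator_def)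
  qed
  have bump: "unit_bump s = complex_of_real (\<bar>s\<bar> powr (1/p)) * \<phi> s" for s
    by (auto simp: \<phi>_def unit_bump_def indicator_def simp flip: of_real_mult powr_add)
  have Q_borel: "Q \<in> sets borel" by (simp add: Q_def)
  have Q_fin: "emeasure haar Q < \<infinity>"
  proof (rule le_less_trans)
    show "emeasure haar Q \<le> ennreal (1 / 10\<^sup>2) * emeasure lborel Q"
      using Q_borel by (intro emeasure_haar_le) (auto simp: Q_def)
    have "emeasure lborel Q < \<infinity>" unfolding Q_def by (rule emeasure_lborel_cbox_finite)
    then show "ennreal (1 / 10\<^sup>2) * emeasure lborel Q < \<infinity>" by (simp add: ennreal_mult_less_top)
  qed
  \<comment> \<open>\<open>\<phi> = K\<^bsup>-1/p\<^esup> unit_bump\<close>, so that \<open>\<sigma>(x) K\<^bsup>1/p\<^esup>\<close> is \<open>u \<mapsto> \<langle>u, unit_bump\<rangle> \<psi>\<close> for \<open>x \<in> Q\<close>.\<close>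
  have "\<sigma> \<in> Lp_op p"
    unfolding \<sigma>_def using assms bump Q_borel Q_fin Q_aff
    by (intro rank_one_field_in_Lp_op[where \<phi> = "\<lambda>\<rho>. unit_bump"] unit_bump \<phi> \<psi>) auto
  moreover have "\<not> weyl_bounded p \<sigma>"
  proof
    let ?w = "wigner_Cc (wild M) plateau"
    assume "weyl_bounded p \<sigma>"
    moreover have "wild M \<in> L2 haar" "plateau \<in> L2 haar"
      by (intro Cc_L2 wild_Cc plateau_Cc)+
    ultimately have "weyl_form_defined p \<sigma> ?w"
      using is_wigner_wigner_Cc[OF wild_Cc plateau_Cc] unfolding weyl_bounded_def by blast
    then have "AE x in haar. bounded_opr (HL rho_plus) (weyl_prod p \<sigma> ?w x rho_plus)"
      unfolding weyl_form_defined_def trace_class_def by (auto elim: eventually_mono)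
    then have "AE x in lborel. x \<in> aff \<longrightarrow> bounded_opr (HL rho_plus) (weyl_prod p \<sigma> ?w x rho_plus)"
      by (simp only: AE_haar)
    moreover have "\<not> bounded_opr (HL rho_plus) (weyl_prod p \<sigma> ?w x rho_plus)" if x: "x \<in> Q" for x
      unfolding M_def
    proof (rule weyl_prod_unbounded[OF assms x])
      have "\<sigma> x rho_plus = rank_one (HL rho_plus) \<phi> \<psi>" using x by (simp add: \<sigma>_def)
      then show "K rho_plus (1/p) O \<sigma> x rho_plus \<subseteq> rank_one (HL rho_plus) unit_bump
          (\<lambda>s. complex_of_real (spikes (8 powr (1 / (1/2 - 1/p))) s))"
        using K_comp_rank_one[OF unit_bump(1) \<phi> bump, where \<rho> = rho_plus and \<psi> = \<psi>] by (auto simp: \<psi>_def M_def)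
    qed
    ultimately have "AE x in lborel. x \<notin> Q" using Q_aff by (auto elim: eventually_mono)
    then have "emeasure lborel Q = 0"
      using Q_borel by (subst (asm) AE_iff_measurable[where N = Q]) auto
    then show False
      by (simp add: Q_def emeasure_lborel_cbox_eq Basis_prod_def)
  qed
  ultimately show ?thesis by blast
qed

end
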